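(* Let $r\in[1,\infty]$, $\vec u=(u_t,u_x)\in[1,\infty]^2$, $\vec v=(v_t,v_x)\in[1,\infty]^2$, $\kappa,M\in\mathbb R$ and $m\in[1,\infty)$. Let $T$ be a singular operator of type $(\kappa,m,r,\vec u,\vec v,M)$. Then for all $f,g\in L^\infty_c(\mathbb R^{1+n}_+)$, with implicit constant independent of $f,g$, $$\int_{\mathbb R^{1+n}_+}|Tf|\,|g|\ \lesssim\ \sum_{Q\in\mathcal D}\ell(Q)^{m\kappa}\,\langle f\rangle_{r,\widetilde{Q}^{\mathrm w}}\,\langle g\rangle_{r',Q^{\mathrm w}}\,|Q^{\mathrm w}|\ +\ \mathrm{(w\text{-}w)}+\mathrm{(ca\text{-}w)}+\mathrm{(w\text{-}ca)},$$ where $$\mathrm{(w\text{-}w)}=\sum_{j=0}^\infty 2^{-jm(M+[u_t,v_t]-\kappa)}\int_{\mathbb R^{1+n}_+}t^\kappa\, H^{\mathrm w}_{(r,u_x),2^{jm}}f(t,x)\, H^{\mathrm w}_{(r',v_x'),2^{jm}}g(t,x)\,dx\,dt,$$ $$\mathrm{(ca\text{-}w)}=\sum_{j=0}^\infty 2^{-jm(M+[u_t,v_t]-\kappa)}\int_{\mathbb R^{1+n}_+}t^\kappa\, H^{\mathrm{ca}}_{\vec u,2^{jm}}f(t,x)\, H^{\mathrm w}_{\vec v',2^{jm}}g(t,x)\,dx\,dt,$$ $$\mathrm{(w\text{-}ca)}=\sum_{j=0}^\infty 2^{-jm(M+[u_t,v_t]-\kappa)}\int_{\mathbb R^{1+n}_+}t^\kappa\,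 H^{\mathrm w}_{\vec u,2^{jm}}f(t,x)\, H^{\mathrm{ca}}_{\vec v',2^{jm}}g(t,x)\,dx\,dt.$$ If $T$ is causal, the term (w-ca) can be omitted; if $T$ is anti-causal, the term (ca-w) can be omitted.
   Context: Notation. $n\ge1$; $\mathbb R_+=(0,\infty)$, $\mathbb R^{1+n}_+=\mathbb R_+\times\mathbb R^n$ with points $(t,x)$. $L^0(\mathbb R^{1+n}_+)$: measurable complex functions; $L^\infty_c(\mathbb R^{1+n}_+)$: bounded ones with compact support in $\mathbb R^{1+n}_+$. In algebraic expressions $[p,q]:=\frac1p-\frac1q$ for $p,q\in(0,\infty]$ ($1/\infty=0$). $p'$ is the Hölder conjugate exponent, $\vec v'=(v_t',v_x')$. $\|f\|_{L^a_tL^b_x}=\big\|t\mapsto\|f(t,\cdot)\|_{L^b(\mathbb R^n)}\big\|_{L^a(\mathbb R_+)}$, $L^a_{t,x}=L^a_tL^a_x$. $\langle f\rangle_{p,E}=(\frac1{|E|}\int_E|f|^p)^{1/p}$ (ess sup over $E$ if $p=\infty$). A constant $c\in(0,1)$ with $c\le\frac1{16\sqrt n}$, depending only on $n$, is fixed. Singular operators. A rectangle is a set $\boldsymbol E=E_t\times E_x\subseteq\mathbb R^{1+n}_+$ with $E_t\subseteq\mathbb R_+$ an interval and $E_x\subseteq\mathbb R^n$ a cube with sides parallel to the axes. For two rectangles $\boldsymbol E,\boldsymbol F$ put $\ell_x=\operatorname{diam}(E_x\cup F_x)$, $\ell_t=\sup(E_t\cup F_t)$; $d$ denotes distance. $T:L^\infty_c(\mathbb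 R^{1+n}_+)\to L^0(\mathbb R^{1+n}_+)$ is subadditive if $|T(f+g)|\le|Tf|+|Tg|$ a.e. For $r\in[1,\infty]$, $\vec u,\vec v\in[1,\infty]^2$, $\kappa,M\in\mathbb R$, $m\in(0,\infty)$, a subadditive operator $T:L^\infty_c\to L^0$ is a singular operator of type $(\kappa,m,r,\vec u,\vec v,M)$ if there is $C<\infty$ such that for all $f\in L^\infty_c$ and all rectangles $\boldsymbol E,\boldsymbol F$: (i) if $\boldsymbol F=\boldsymbol E$, $c\,\ell_x\le\ell_t^{1/m}\le\ell_x$ and $\inf E_t\ge c^m\ell_t$, then $\|1_{\boldsymbol E}T(f1_{\boldsymbol E})\|_{L^r_{t,x}}\le C(\inf E_t)^\kappa\|f1_{\boldsymbol E}\|_{L^r_{t,x}}$; (ii) if $c\,\ell_x\le\ell_t^{1/m}\le\ell_x$ and $d(E_t,F_t)\ge c^m\ell_t$, then $\|1_{\boldsymbol F}T(f1_{\boldsymbol E})\|_{L^{v_t}_tL^{v_x}_x}\le C\,d(E_t,F_t)^{-[u_t,v_t]-\frac nm[u_x,v_x]+\kappa}\|f1_{\boldsymbol E}\|_{L^{u_t}_tL^{u_x}_x}$; (iii) if $\ell_t^{1/m}\le\ell_x$, $d(E_t,F_t)\ge c^m\ell_t$ and $d(E_x,F_x)\ge c\,\ell_x$, then $\|1_{\boldsymbol F}T(f1_{\boldsymbol E})\|_{L^{v_t}_tL^{v_x}_x}\le C\,d(E_x,F_x)^{-m[u_t,v_t]-n[u_x,v_x]+m\kappa}\Big(\frac{\operatorname{diam}(E_t\cup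 F_t)}{d(E_x,F_x)^m}\Big)^{M}\|f1_{\boldsymbol E}\|_{L^{u_t}_tL^{u_x}_x}$; (iv) if $\ell_t^{1/m}\le\ell_x$ and $d(E_x,F_x)\ge c\,\ell_x$, then $\|1_{\boldsymbol F}T(f1_{\boldsymbol E})\|_{L^{r}_tL^{v_x}_x}\le C\,d(E_x,F_x)^{-n[u_x,v_x]+m\kappa}\Big(\frac{\operatorname{diam}(E_t\cup F_t)}{d(E_x,F_x)^m}\Big)^{M+[u_t,v_t]}\|f1_{\boldsymbol E}\|_{L^{r}_tL^{u_x}_x}$. $T$ is causal if $T(f1_{\boldsymbol E})(t,x)=0$ for $t<\inf E_t$, for all $f\in L^\infty_c$ and $\boldsymbol E=E_t\times E_x$ with $E_t\subseteq\mathbb R_+$, $E_x\subseteq\mathbb R^n$; anti-causal if $T(f1_{\boldsymbol E})(t,x)=0$ for $t>\sup E_t$, for all such $f,\boldsymbol E$. Dyadic geometry. $\mathcal D$ is a fixed dyadic system in $\mathbb R^n$ (nested partitions into cubes of side length $2^{-j}$, $j\in\mathbb Z$) such that every bounded set is contained in some $Q\in\mathcal D$. $\ell(Q)$ is the side length, $3Q$ the concentric cube of side $3\ell(Q)$. $Q^{\mathrm w}=(2^{-m}\ell(Q)^m,\ell(Q)^m)\times Q$ and $\widetilde Q^{\mathrm w}=(4^{-m}\ell(Q)^m,2^m\ell(Q)^m)\times 3Q$. Model operators. For measurable $f$, $\vec u=(u_t,u_x)\in(0,\infty]^2$, $\delta>0$ (with averages $\frac{1}{|\cdot|}\int$ denoted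 by barred integrals and usual modifications for infinite exponents): $$H^{\mathrm{ca}}_{\vec u,\delta}f(t,x)=\Big(⨍_0^t\Big(⨍_{B(x,(\delta t)^{1/m})}|f(s,y)|^{u_x}dy\Big)^{u_t/u_x}ds\Big)^{1/u_t},\quad H^{\mathrm{w}}_{\vec u,\delta}f(t,x)=\Big(⨍_{c^mt}^t\Big(⨍_{B(x,(\delta t)^{1/m})}|f(s,y)|^{u_x}dy\Big)^{u_t/u_x}ds\Big)^{1/u_t},$$ where ⨍ denotes the mean value integral. *)

theory Defs
  imports "HOL-Probability.Essential_Supremum"
begin

text \<open>
  Points of the upper half space are pairs \<open>(t, x)\<close> with \<open>t > 0\<close> and \<open>x :: real ^ 'n\<close>, so that
  \<open>n = CARD('n)\<close>.  Elements of \<open>L\<^sup>0\<close>, which are equivalence classes modulo null sets, are represented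
  by Borel measurable functions; every class of Lebesgue measurable functions contains such
  a representative.  Norms, integrals and sums are \<open>ennreal\<close>-valued.
\<close>

definition half_space :: "(real \<times> (real ^ 'n)) set" where
  "half_space = {0<..} \<times> UNIV"

definition hs_measure :: "(real \<times> (real ^ 'n)) measure" where
  "hs_measure = restrict_space lborel half_space"

definition Linf_c :: "(real \<times> (real ^ 'n) \<Rightarrow> complex) set" where
  "Linf_c = {f. f \<in> borel_measurable borel \<and> bounded (range f) \<and>
      (\<exists>K. compact K \<and> K \<subseteq> half_space \<and> (\<forall>p. p \<notin> K \<longrightarrow> f p = 0))}"

definition cut :: "'a set \<Rightarrow> ('a \<Rightarrow> complex) \<Rightarrow> 'a \<Rightarrow> complex" where
  "cut E f = (\<lambda>p. indicator E p * f p)"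

text \<open>Exponents are elements of \<open>ennreal\<close>, where \<open>inverse top = 0\<close> and \<open>inverse 0 = top\<close>.\<close>

definition bracket :: "ennreal \<Rightarrow> ennreal \<Rightarrow> real" where
  "bracket p q = enn2real (inverse p) - enn2real (inverse q)"

definition conj_exp :: "ennreal \<Rightarrow> ennreal" where
  "conj_exp p = inverse (1 - inverse p)"

text \<open>Real powers of extended nonnegative numbers, for positive exponents \<open>a\<close> only.\<close>

definition epow :: "ennreal \<Rightarrow> real \<Rightarrow> ennreal" where
  "epow x a = (if x = top then top else ennreal (enn2real x powr a))"

definition Lnorm :: "ennreal \<Rightarrow> 'a measure \<Rightarrow> ('a \<Rightarrow> ennreal) \<Rightarrow> ennreal" where
  "Lnorm p M h =
     (if p = top then esssup M h
      else epow (\<integral>\<^sup>+ x. epow (h x) (enn2real p) \<partial>M) (1 / enn2real p))"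

definition mixed_norm ::
    "ennreal \<Rightarrow> ennreal \<Rightarrow> (real \<times> (real ^ 'n) \<Rightarrow> complex) \<Rightarrow> ennreal" where
  "mixed_norm a b f =
     Lnorm a (restrict_space lborel {0<..}) (\<lambda>t. Lnorm b lborel (\<lambda>x. ennreal (norm (f (t, x)))))"

text \<open>
  The \<open>L\<^sup>p\<close> average over \<open>E\<close> (of positive finite measure) is the \<open>L\<^sup>p\<close> norm for the normalised
  Lebesgue measure on \<open>E\<close>.
\<close>

definition avg :: "ennreal \<Rightarrow> 'a::euclidean_space set \<Rightarrow> ('a \<Rightarrow> ennreal) \<Rightarrow> ennreal" where
  "avg p E h = Lnorm p (uniform_measure lborel E) h"

text \<open>
  \<open>cube z l Q\<close>: \<open>Q\<close> is a product of intervals of length \<open>l\<close>, with centre \<open>z\<close>.  Each of these intervals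
  may contain any of its endpoints, so open, closed and half-open cubes are all covered.
\<close>

definition cube :: "real ^ 'n \<Rightarrow> real \<Rightarrow> (real ^ 'n) set \<Rightarrow> bool" where
  "cube z l Q \<longleftrightarrow> l > 0 \<and>
     (\<exists>I. (\<forall>i. {z $ i - l / 2 <..< z $ i + l / 2} \<subseteq> I i \<and> I i \<subseteq> {z $ i - l / 2 .. z $ i + l / 2}) \<and>
          Q = {x. \<forall>i. x $ i \<in> I i})"

definition side :: "(real ^ 'n) set \<Rightarrow> real" where
  "side Q = (THE l. \<exists>z. cube z l Q)"

definition centre :: "(real ^ 'n) set \<Rightarrow> real ^ 'n" where
  "centre Q = (THE z. \<exists>l. cube z l Q)"

definition triple :: "(real ^ 'n) set \<Rightarrow> (real ^ 'n) set" where
  "triple Q = (\<lambda>x. centre Q + 3 *\<^sub>R (x - centre Q)) ` Q"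

text \<open>
  Time intervals are nonempty and bounded, so that the library's real-valued \<open>Sup\<close>, \<open>setdist\<close> and
  \<open>diameter\<close> are the usual ones.  Unbounded intervals can be left out: for them
  \<open>\<ell>\<^sub>t = \<infinity>\<close>, which is excluded by the condition \<open>\<ell>\<^sub>t powr (1 / m) \<le> \<ell>\<^sub>x\<close> in each bound below.
\<close>

definition rectangle :: "real set \<Rightarrow> (real ^ 'n) set \<Rightarrow> bool" where
  "rectangle E\<^sub>t E\<^sub>x \<longleftrightarrow>
     is_interval E\<^sub>t \<and> E\<^sub>t \<noteq> {} \<and> E\<^sub>t \<subseteq> {0<..} \<and> bdd_above E\<^sub>t \<and> (\<exists>z l. cube z l E\<^sub>x)"

text \<open>
  An operator from \<open>Linf_c\<close> to \<open>L\<^sup>0\<close> acts on equivalence classes, hence the second condition.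
\<close>

definition operator_L0 ::
    "((real \<times> (real ^ 'n) \<Rightarrow> complex) \<Rightarrow> (real \<times> (real ^ 'n) \<Rightarrow> complex)) \<Rightarrow> bool" where
  "operator_L0 T \<longleftrightarrow>
     (\<forall>f\<in>Linf_c. T f \<in> borel_measurable hs_measure) \<and>
     (\<forall>f\<in>Linf_c. \<forall>g\<in>Linf_c.
        (AE p in hs_measure. f p = g p) \<longrightarrow> (AE p in hs_measure. T f p = T g p))"

definition subadditive_op ::
    "((real \<times> (real ^ 'n) \<Rightarrow> complex) \<Rightarrow> (real \<times> (real ^ 'n) \<Rightarrow> complex)) \<Rightarrow> bool" where
  "subadditive_op T \<longleftrightarrow>
     (\<forall>f\<in>Linf_c. \<forall>g\<in>Linf_c.
        AE p in hs_measure. norm (T (\<lambda>q. f q + g q) p) \<le> norm (T f p) + norm (T g p))"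

definition ell_x :: "(real ^ 'n) set \<Rightarrow> (real ^ 'n) set \<Rightarrow> real" where
  "ell_x E\<^sub>x F\<^sub>x = diameter (E\<^sub>x \<union> F\<^sub>x)"

definition ell_t :: "real set \<Rightarrow> real set \<Rightarrow> real" where
  "ell_t E\<^sub>t F\<^sub>t = Sup (E\<^sub>t \<union> F\<^sub>t)"

definition singular_operator ::
    "real \<Rightarrow> real \<Rightarrow> real \<Rightarrow> ennreal \<Rightarrow> ennreal \<times> ennreal \<Rightarrow> ennreal \<times> ennreal \<Rightarrow> real \<Rightarrow>
     ((real \<times> (real ^ 'n) \<Rightarrow> complex) \<Rightarrow> (real \<times> (real ^ 'n) \<Rightarrow> complex)) \<Rightarrow> bool" where
  "singular_operator c \<kappa> m r u v M T \<longleftrightarrow>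
    operator_L0 T \<and> subadditive_op T \<and>
    (let (ut, ux) = u; (vt, vx) = v; n = real CARD('n) in
     \<exists>C\<ge>0. \<forall>f\<in>Linf_c. \<forall>E\<^sub>t E\<^sub>x F\<^sub>t F\<^sub>x. rectangle E\<^sub>t E\<^sub>x \<longrightarrow> rectangle F\<^sub>t F\<^sub>x \<longrightarrow>
      (let E = E\<^sub>t \<times> E\<^sub>x; F = F\<^sub>t \<times> F\<^sub>x; lx = ell_x E\<^sub>x F\<^sub>x; lt = ell_t E\<^sub>t F\<^sub>t;
           dt = setdist E\<^sub>t F\<^sub>t; dx = setdist E\<^sub>x F\<^sub>x; diam_t = diameter (E\<^sub>t \<union> F\<^sub>t) in
        (F = E \<longrightarrow> c * lx \<le> lt powr (1 / m) \<longrightarrow> lt powr (1 / m) \<le> lx \<longrightarrow>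
           Inf E\<^sub>t \<ge> c powr m * lt \<longrightarrow>
           mixed_norm r r (cut E (T (cut E f)))
             \<le> ennreal (C * Inf E\<^sub>t powr \<kappa>) * mixed_norm r r (cut E f)) \<and>
        (c * lx \<le> lt powr (1 / m) \<longrightarrow> lt powr (1 / m) \<le> lx \<longrightarrow> dt \<ge> c powr m * lt \<longrightarrow>
           mixed_norm vt vx (cut F (T (cut E f)))
             \<le> ennreal (C * dt powr (- bracket ut vt - n / m * bracket ux vx + \<kappa>))
                 * mixed_norm ut ux (cut E f)) \<and>
        (lt powr (1 / m) \<le> lx \<longrightarrow> dt \<ge> c powr m * lt \<longrightarrow> dx \<ge> c * lx \<longrightarrow>
           mixed_norm vt vx (cut F (T (cut E f)))
             \<le> ennreal (C * dx powr (- m * bracket ut vt - n * bracket ux vx + m * \<kappa>)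
                          * (diam_t / dx powr m) powr M)
                 * mixed_norm ut ux (cut E f)) \<and>
        (lt powr (1 / m) \<le> lx \<longrightarrow> dx \<ge> c * lx \<longrightarrow>
           mixed_norm r vx (cut F (T (cut E f)))
             \<le> ennreal (C * dx powr (- n * bracket ux vx + m * \<kappa>)
                          * (diam_t / dx powr m) powr (M + bracket ut vt))
                 * mixed_norm r ux (cut E f))))"

definition causal ::
    "((real \<times> (real ^ 'n) \<Rightarrow> complex) \<Rightarrow> (real \<times> (real ^ 'n) \<Rightarrow> complex)) \<Rightarrow> bool" where
  "causal T \<longleftrightarrow>
     (\<forall>f\<in>Linf_c. \<forall>E\<^sub>t\<in>sets borel. \<forall>E\<^sub>x\<in>sets borel. E\<^sub>t \<noteq> {} \<longrightarrow> E\<^sub>t \<subseteq> {0<..} \<longrightarrow>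
        (AE (t, x) in hs_measure. t < Inf E\<^sub>t \<longrightarrow> T (cut (E\<^sub>t \<times> E\<^sub>x) f) (t, x) = 0))"

text \<open>If \<open>E\<^sub>t\<close> is unbounded, then \<open>sup E\<^sub>t = \<infinity>\<close> and there is nothing to require.\<close>

definition anti_causal ::
    "((real \<times> (real ^ 'n) \<Rightarrow> complex) \<Rightarrow> (real \<times> (real ^ 'n) \<Rightarrow> complex)) \<Rightarrow> bool" where
  "anti_causal T \<longleftrightarrow>
     (\<forall>f\<in>Linf_c. \<forall>E\<^sub>t\<in>sets borel. \<forall>E\<^sub>x\<in>sets borel. E\<^sub>t \<noteq> {} \<longrightarrow> E\<^sub>t \<subseteq> {0<..} \<longrightarrow> bdd_above E\<^sub>t \<longrightarrow>
        (AE (t, x) in hs_measure. t > Sup E\<^sub>t \<longrightarrow> T (cut (E\<^sub>t \<times> E\<^sub>x) f) (t, x) = 0))"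

definition dyadic_system :: "(real ^ 'n) set set \<Rightarrow> bool" where
  "dyadic_system \<D> \<longleftrightarrow>
     (\<exists>D :: int \<Rightarrow> (real ^ 'n) set set.
        \<D> = (\<Union>j. D j) \<and>
        (\<forall>j. partition_on UNIV (D j) \<and>
             (\<forall>Q\<in>D j. \<exists>z. cube z (2 powi (- j)) Q) \<and>
             (\<forall>Q\<in>D (j + 1). \<exists>Q'\<in>D j. Q \<subseteq> Q'))) \<and>
     (\<forall>B. bounded B \<longrightarrow> (\<exists>Q\<in>\<D>. B \<subseteq> Q))"

definition whitney :: "real \<Rightarrow> (real ^ 'n) set \<Rightarrow> (real \<times> (real ^ 'n)) set" where
  "whitney m Q = {2 powr (- m) * side Q powr m <..< side Q powr m} \<times> Q"

definition whitney_enl :: "real \<Rightarrow> (real ^ 'n) set \<Rightarrow> (real \<times> (real ^ 'n)) set" where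
  "whitney_enl m Q = {4 powr (- m) * side Q powr m <..< 2 powr m * side Q powr m} \<times> triple Q"

definition sparse_part ::
    "real \<Rightarrow> real \<Rightarrow> ennreal \<Rightarrow> (real ^ 'n) set set \<Rightarrow>
     (real \<times> (real ^ 'n) \<Rightarrow> complex) \<Rightarrow> (real \<times> (real ^ 'n) \<Rightarrow> complex) \<Rightarrow> ennreal" where
  "sparse_part \<kappa> m r \<D> f g =
     (\<Sum>\<^sub>\<infinity>Q\<in>\<D>. ennreal (side Q powr (m * \<kappa>))
        * avg r (whitney_enl m Q) (\<lambda>p. ennreal (norm (f p)))
        * avg (conj_exp r) (whitney m Q) (\<lambda>p. ennreal (norm (g p)))
        * emeasure lborel (whitney m Q))"

definition H_ca ::
    "real \<Rightarrow> ennreal \<times> ennreal \<Rightarrow> real \<Rightarrow> (real \<times> (real ^ 'n) \<Rightarrow> complex) \<Rightarrow> real \<Rightarrow> real ^ 'n \<Rightarrow> ennreal"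
  where
  "H_ca m u \<delta> f t x =
     avg (fst u) {0<..<t}
       (\<lambda>s. avg (snd u) (ball x ((\<delta> * t) powr (1 / m))) (\<lambda>y. ennreal (norm (f (s, y)))))"

definition H_w ::
    "real \<Rightarrow> real \<Rightarrow> ennreal \<times> ennreal \<Rightarrow> real \<Rightarrow> (real \<times> (real ^ 'n) \<Rightarrow> complex) \<Rightarrow> real \<Rightarrow> real ^ 'n \<Rightarrow> ennreal"
  where
  "H_w c m u \<delta> f t x =
     avg (fst u) {c powr m * t<..<t}
       (\<lambda>s. avg (snd u) (ball x ((\<delta> * t) powr (1 / m))) (\<lambda>y. ennreal (norm (f (s, y)))))"

text \<open>
  The common shape of the three remaining terms: \<open>G \<delta>\<close> and \<open>H \<delta>\<close> are the functions obtained from \<open>f\<close>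
  and \<open>g\<close> by the respective model operators, and \<open>a\<close> is \<open>M + [u\<^sub>t, v\<^sub>t] - \<kappa>\<close>.
\<close>

definition model_term ::
    "real \<Rightarrow> real \<Rightarrow> real \<Rightarrow> (real \<Rightarrow> real \<Rightarrow> real ^ 'n \<Rightarrow> ennreal) \<Rightarrow>
     (real \<Rightarrow> real \<Rightarrow> real ^ 'n \<Rightarrow> ennreal) \<Rightarrow> ennreal" where
  "model_term m \<kappa> a G H =
     (\<Sum>j. ennreal (2 powr (- (real j * m * a)))
        * (\<integral>\<^sup>+ (t, x). ennreal (t powr \<kappa>)
             * G (2 powr (real j * m)) t x * H (2 powr (real j * m)) t x \<partial>hs_measure))"

end

theory Submission
  imports Defs
begin

text \<open>
  The pairs of points \<open>((s, y), (t, x))\<close> are split by their times and their places.  Let \<open>Z\<close> run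
  through the dyadic lengths.  If \<open>s\<close> and \<open>t\<close> are comparable to \<open>Z\<^sup>m\<close> and \<open>x\<close>, \<open>y\<close> lie in neighbouring
  cubes of side \<open>Z\<close>, then the diagonal bound (i) on an enlarged Whitney region gives the sparse sum.  In all
  other cases the larger of the two times fixes \<open>Z\<close>, and \<open>x\<close>, \<open>y\<close> either lie in neighbouring cubes of side
  \<open>Z\<close>, or there is exactly one \<open>l \<ge> 0\<close> such that the cubes of side \<open>2\<^sup>l Z\<close> around them are not neighbours
  while their parents are.  The smaller time may then run through a whole interval \<open>(0, \<epsilon> Z\<^sup>m)\<close> at once,
  which produces the averages from \<open>0\<close> to \<open>t\<close>; the bounds (ii), (iii), (iv) together with Hoelder's inequality
  turn each such pair of rectangles into its share of the \<open>l\<close>-th model term, integrated over a box just above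
  the rectangles.  For fixed \<open>l\<close> these boxes are disjoint.
\<close>

section \<open>Powers and norms\<close>

text \<open>\<open>T\<close> is only subadditive, so \<open>f\<close> can be cut into pieces, but
  the pieces cannot be put together again; the integral against \<open>g\<close> is additive and
  allows both. Hence small source times are kept in one window from the start, whereas small target
  times begin as separate Whitney windows and are collected afterwards on the side of
  \<open>g\<close>. Bounds (iii) and (iv) ask for a spatial distance of at least \<open>c\<close>
  times the diameter. Two cubes of equal side with disjoint closures could be arbitrarily close
  unless they lie on a common grid, so the grid is first extracted from nesting. With q = 2^-m, the
  bound c <= 1/16 gives c^m <= q^4. This lets the window (c^m t, t) contain all times from q^2 Z^m
  to Z^m / q whenever t lies between Z^m / q and Z^m / q^2. The boxes sit at these t because the
  model operators look down from t. Their balls must contain both cubes, which costs a fixed shift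
  \<open>l0\<close> of the index of the series. Compact supports make every sum over scales finite,
  with constants that do not depend on the number of scales.\<close>

lemma epow_ennreal [simp]: "0 \<le> x \<Longrightarrow> epow (ennreal x) a = ennreal (x powr a)"
  by (simp add: epow_def)

lemma epow_top [simp]: "epow top a = top"
  by (simp add: epow_def)

lemma epow_0 [simp]: "epow 0 a = 0"
  by (simp add: epow_def)

lemma epow_1 [simp]: "epow x 1 = x"
  by (cases x) auto

lemma epow_mono: "x \<le> y \<Longrightarrow> 0 \<le> a \<Longrightarrow> epow x a \<le> epow y a"
  by (cases x; cases y) (auto intro!: ennreal_leI powr_mono2 simp: top_unique)

lemma epow_mult: "0 < a \<Longrightarrow> epow (x * y) a = epow x a * epow y a"
proof (cases x; cases y)
  fix r s assume a: "0 < a" "0 \<le> r" "x = ennreal r" "0 \<le> s" "y = ennreal s"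
  then show "epow (x * y) a = epow x a * epow y a"
    by (simp add: ennreal_mult[symmetric] powr_mult)
next
  fix r assume a: "0 < a" "0 \<le> r" "x = ennreal r" "y = top"
  then show "epow (x * y) a = epow x a * epow y a"
    by (cases "r = 0") (auto simp: ennreal_mult_top)
next
  fix r assume a: "0 < a" "0 \<le> r" "y = ennreal r" "x = top"
  then show "epow (x * y) a = epow x a * epow y a"
    by (cases "r = 0") (auto simp: ennreal_top_mult)
qed auto

lemma epow_epow: "epow (epow x a) b = epow x (a * b)"
  by (cases x) (auto simp: powr_powr)

lemma borel_measurable_epow [measurable (raw)]:
  assumes [measurable]: "f \<in> borel_measurable M"
  shows "(\<lambda>x. epow (f x) a) \<in> borel_measurable M"
  unfolding epow_def by measurable

section \<open>Reciprocal and conjugate exponents\<close>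

abbreviation rcp :: "ennreal \<Rightarrow> real" where "rcp p \<equiv> enn2real (inverse p)"

lemma exponent_cases:
  fixes p :: ennreal
  assumes "1 \<le> p"
  obtains "p = top" | x where "1 \<le> x" "p = ennreal x" "rcp p = 1 / x" "enn2real p = x"
proof (cases p)
  case (real x)
  with assms have "1 \<le> x" by (metis ennreal_le_iff ennreal_1)
  with real that(2)[of x] show ?thesis
    by (auto simp: inverse_ennreal inverse_eq_divide)
qed (use that in auto)

lemma rcp_bounds: "1 \<le> p \<Longrightarrow> 0 \<le> rcp p \<and> rcp p \<le> 1"
  by (rule exponent_cases[of p]) auto

text \<open>At p = 1 and p = top one of the two exponents is infinite, and the norm belonging to it
  is an essential supremum; only the third case is accessible to Young's inequality.\<close>

lemma conj_exp_cases:
  fixes p :: ennreal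
  assumes "1 \<le> p"
  obtains "p = top" "conj_exp p = 1" "rcp (conj_exp p) = 1"
  | "p = 1" "conj_exp p = top" "rcp (conj_exp p) = 0"
  | x y where "1 < x" "1 < y" "1 / x + 1 / y = 1" "p = ennreal x" "conj_exp p = ennreal y"
  using assms
proof (cases rule: exponent_cases)
  case 1
  then show ?thesis using that(1) by (simp add: conj_exp_def)
next
  case (2 x)
  show ?thesis
  proof (cases "x = 1")
    case True
    then show ?thesis using that(2) 2 by (simp add: conj_exp_def)
  next
    case False
    with 2 have x: "1 < x" by simp
    have "conj_exp p = inverse (ennreal 1 - ennreal (1 / x))"
      using 2 x by (simp add: conj_exp_def inverse_ennreal inverse_eq_divide)
    also have "\<dots> = inverse (ennreal (1 - 1 / x))"
      using x by (subst ennreal_minus) auto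
    also have "\<dots> = ennreal (inverse (1 - 1 / x))"
      using x by (subst inverse_ennreal) auto
    also have "inverse (1 - 1 / x) = x / (x - 1)"
      using x by (simp add: field_simps)
    finally have "conj_exp p = ennreal (x / (x - 1))" .
    with 2 x show ?thesis
      by (intro that(3)[of x "x / (x - 1)"]) (auto simp: field_simps)
  qed
qed

lemma one_le_conj_exp: "1 \<le> p \<Longrightarrow> 1 \<le> conj_exp p"
  by (erule conj_exp_cases) auto

lemma rcp_conj_exp: "1 \<le> p \<Longrightarrow> rcp (conj_exp p) = 1 - rcp p"
proof (erule conj_exp_cases)
  fix x y :: real
  assume h: "1 < x" "1 < y" "1 / x + 1 / y = 1" "p = ennreal x" "conj_exp p = ennreal y"
  then show ?thesis by (simp add: inverse_ennreal inverse_eq_divide)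
qed auto

section \<open>Elementary properties of the norms on a general measure space\<close>

lemma Lnorm_top: "Lnorm top M h = esssup M h"
  by (simp add: Lnorm_def)

lemma Lnorm_finite:
  "0 \<le> x \<Longrightarrow> Lnorm (ennreal x) M h = epow (\<integral>\<^sup>+ y. epow (h y) x \<partial>M) (1 / x)"
  by (simp add: Lnorm_def)

lemma Lnorm_mono_AE:
  assumes "h \<in> borel_measurable M" "AE x in M. h x \<le> k x"
  shows "Lnorm p M h \<le> Lnorm p M k"
proof (cases "p = top")
  case True
  then show ?thesis using assms by (simp add: Lnorm_top esssup_AE_mono)
next
  case False
  show ?thesis unfolding Lnorm_def using False assms(2)
    by (auto intro!: epow_mono nn_integral_mono_AE elim!: eventually_mono)
qed

lemma Lnorm_mono:
  assumes "h \<in> borel_measurable M" "\<And>x. x \<in> space M \<Longrightarrow> h x \<le> k x"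
  shows "Lnorm p M h \<le> Lnorm p M k"
  using assms by (intro Lnorm_mono_AE AE_I2)

text \<open>The reverse inequality is this one for the function c h and the factor 1/c, so a single
  direction has to be proved. For an infinite exponent, the almost everywhere bound of c h by its
  essential supremum is divided by c.\<close>

lemma Lnorm_cmult_le:
  assumes "1 \<le> p" "h \<in> borel_measurable M" "0 \<le> c"
  shows "ennreal c * Lnorm p M h \<le> Lnorm p M (\<lambda>x. ennreal c * h x)"
proof (cases "c = 0")
  case True
  then show ?thesis by simp
next
  case False
  with assms have c: "0 < c" by simp
  show ?thesis using assms(1)
  proof (cases rule: exponent_cases)
    case 1
    have inv: "ennreal (1 / c) * (ennreal c * y) = y" for y
      using c by (simp add: mult.assoc[symmetric] ennreal_mult[symmetric])
    have inv': "ennreal c * (ennreal (1 / c) * y) = y" for y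
      using c by (simp add: mult.assoc[symmetric] ennreal_mult[symmetric])
    have "AE x in M. ennreal c * h x \<le> esssup M (\<lambda>x. ennreal c * h x)"
      by (rule esssup_AE)
    then have "AE x in M. h x \<le> ennreal (1 / c) * esssup M (\<lambda>x. ennreal c * h x)"
    proof eventually_elim
      case (elim x)
      from mult_left_mono[OF this, of "ennreal (1 / c)"] show ?case by (simp add: inv)
    qed
    then have "esssup M h \<le> ennreal (1 / c) * esssup M (\<lambda>x. ennreal c * h x)"
      using assms by (intro esssup_I) auto
    from mult_left_mono[OF this, of "ennreal c"] show ?thesis
      using 1 by (simp add: inv' Lnorm_top)
  next
    case (2 x)
    have "Lnorm p M (\<lambda>x. ennreal c * h x) =
        epow (\<integral>\<^sup>+ y. ennreal (c powr x) * epow (h y) x \<partial>M) (1 / x)"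
      using 2 c by (simp add: Lnorm_finite epow_mult)
    also have "\<dots> = ennreal ((c powr x) powr (1 / x)) * Lnorm p M h"
      using 2 c assms(2) by (subst nn_integral_cmult) (auto simp: epow_mult Lnorm_finite)
    finally show ?thesis using 2 c by (simp add: powr_powr)
  qed
qed

lemma Lnorm_cmult:
  assumes "1 \<le> p" "h \<in> borel_measurable M" "0 < c"
  shows "Lnorm p M (\<lambda>x. ennreal c * h x) = ennreal c * Lnorm p M h"
proof (rule antisym)
  have inv: "ennreal c * (ennreal (1 / c) * y) = y" "ennreal (1 / c) * (ennreal c * y) = y" for y
    using assms by (simp_all add: mult.assoc[symmetric] ennreal_mult[symmetric])
  have "ennreal (1 / c) * Lnorm p M (\<lambda>x. ennreal c * h x) \<le> Lnorm p M h"
    using Lnorm_cmult_le[of p "\<lambda>x. ennreal c * h x" M "1 / c"] assms by (simp add: inv)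
  from mult_left_mono[OF this, of "ennreal c"]
  show "Lnorm p M (\<lambda>x. ennreal c * h x) \<le> ennreal c * Lnorm p M h" by (simp add: inv)
qed (use assms in \<open>simp add: Lnorm_cmult_le\<close>)

lemma Lnorm_0 [simp]: "1 \<le> p \<Longrightarrow> Lnorm p M (\<lambda>x. 0) = 0"
proof (erule exponent_cases)
  assume "p = top"
  then show "Lnorm p M (\<lambda>x. 0) = 0"
    using esssup_I[of "\<lambda>x. 0::ennreal" M 0] by (simp add: Lnorm_top)
qed (simp add: Lnorm_finite)

lemma Lnorm_restrict_space:
  assumes "1 \<le> p" "S \<in> sets M" "h \<in> borel_measurable M"
  shows "Lnorm p (restrict_space M S) h = Lnorm p M (\<lambda>x. h x * indicator S x)"
  using assms(1)
proof (cases rule: exponent_cases)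
  case 1
  have m: "h \<in> borel_measurable (restrict_space M S)" "(\<lambda>x. h x * indicator S x) \<in> borel_measurable M"
    using assms by (auto intro: measurable_restrict_space1)
  have "esssup (restrict_space M S) h \<le> esssup M (\<lambda>x. h x * indicator S x)"
  proof (intro esssup_I m(1))
    have "AE x in M. h x * indicator S x \<le> esssup M (\<lambda>x. h x * indicator S x)"
      by (rule esssup_AE)
    then show "AE x in restrict_space M S. h x \<le> esssup M (\<lambda>x. h x * indicator S x)"
      using assms by (subst AE_restrict_space_iff) (auto simp: indicator_def)
  qed
  moreover have "esssup M (\<lambda>x. h x * indicator S x) \<le> esssup (restrict_space M S) h"
  proof (intro esssup_I m(2))
    have "AE x in restrict_space M S. h x \<le> esssup (restrict_space M S) h"
      by (rule esssup_AE)
    then have "AE x in M. x \<in> S \<longrightarrow> h x \<le> esssup (restrict_space M S) h"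
      using assms by (subst (asm) AE_restrict_space_iff) auto
    then show "AE x in M. h x * indicator S x \<le> esssup (restrict_space M S) h"
      by eventually_elim (auto simp: indicator_def)
  qed
  ultimately show ?thesis using 1 by (simp add: Lnorm_top)
next
  case (2 x)
  have "(\<integral>\<^sup>+ y. epow (h y) x \<partial>restrict_space M S) = (\<integral>\<^sup>+ y. epow (h y) x * indicator S y \<partial>M)"
    using assms by (intro nn_integral_restrict_space) simp
  also have "\<dots> = (\<integral>\<^sup>+ y. epow (h y * indicator S y) x \<partial>M)"
    by (intro nn_integral_cong) (auto simp: indicator_def)
  finally show ?thesis using 2 by (simp add: Lnorm_finite)
qed

text \<open>Converts norms into averages. Normalising the measure on \<open>A\<close> costs the
  factor a^(1/p), which is 1 for p = top because \<open>rcp top\<close> is 0.\<close>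

lemma Lnorm_uniform_measure:
  assumes "1 \<le> p" "A \<in> sets M" "h \<in> borel_measurable M" "emeasure M A = ennreal a" "0 < a"
  shows "Lnorm p M (\<lambda>x. h x * indicator A x) \<le> ennreal (a powr rcp p) * Lnorm p (uniform_measure M A) h"
  using assms(1)
proof (cases rule: exponent_cases)
  case 1
  have "AE x in uniform_measure M A. h x \<le> esssup (uniform_measure M A) h"
    by (rule esssup_AE)
  then have "AE x in M. x \<in> A \<longrightarrow> h x \<le> esssup (uniform_measure M A) h"
    using assms by (subst (asm) AE_uniform_measure) auto
  then have "AE x in M. h x * indicator A x \<le> esssup (uniform_measure M A) h"
    by eventually_elim (auto simp: indicator_def)
  then have "esssup M (\<lambda>x. h x * indicator A x) \<le> esssup (uniform_measure M A) h"
    using assms by (intro esssup_I) auto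
  then show ?thesis using 1 assms by (simp add: Lnorm_top)
next
  case (2 x)
  let ?I = "\<integral>\<^sup>+ y. epow (h y * indicator A y) x \<partial>M"
  have "(\<integral>\<^sup>+ y. epow (h y) x \<partial>uniform_measure M A) = (\<integral>\<^sup>+ y. epow (h y) x * indicator A y \<partial>M) / ennreal a"
    using assms by (subst nn_integral_uniform_measure) auto
  also have "(\<integral>\<^sup>+ y. epow (h y) x * indicator A y \<partial>M) = ?I"
    by (intro nn_integral_cong) (auto simp: indicator_def)
  finally have eq: "(\<integral>\<^sup>+ y. epow (h y) x \<partial>uniform_measure M A) = ?I / ennreal a" .
  have "?I = ennreal a * (?I / ennreal a)"
    using assms by (metis ennreal_0 ennreal_eq_0_iff ennreal_mult_divide_eq ennreal_neq_top leD mult.commute ennreal_times_divide)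
  then have "epow ?I (1 / x) = epow (ennreal a) (1 / x) * epow (?I / ennreal a) (1 / x)"
    using 2 epow_mult[of "1 / x" "ennreal a" "?I / ennreal a"] by simp
  then show ?thesis using 2 assms eq by (simp add: Lnorm_finite)
qed

text \<open>For finite exponents this is Tonelli. For the essential supremum, a sublevel set
  consists of those t for which the section of {F > a} is null, and the measure of a section depends
  measurably on t because \<open>N\<close> is sigma-finite.\<close>

lemma borel_measurable_Lnorm [measurable (raw)]:
  assumes "sigma_finite_measure N" and [measurable]: "(\<lambda>(t, x). F t x) \<in> borel_measurable (M \<Otimes>\<^sub>M N)"
  shows "(\<lambda>t. Lnorm p N (\<lambda>x. F t x)) \<in> borel_measurable M"
proof -
  interpret sigma_finite_measure N by fact
  show ?thesis
  proof (cases "p = top")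
    case False
    then show ?thesis unfolding Lnorm_def by simp
  next
    case True
    have "(\<lambda>t. esssup N (\<lambda>x. F t x)) \<in> borel_measurable M"
    proof (rule borel_measurableI_le)
      fix a :: ennreal
      have m: "{p \<in> space (M \<Otimes>\<^sub>M N). a < F (fst p) (snd p)} \<in> sets (M \<Otimes>\<^sub>M N)" by measurable
      have "{t \<in> space M. esssup N (\<lambda>x. F t x) \<le> a} =
          {t \<in> space M. emeasure N (Pair t -` {p \<in> space (M \<Otimes>\<^sub>M N). a < F (fst p) (snd p)}) = 0}"
      proof (intro Collect_cong conj_cong refl)
        fix t assume t: "t \<in> space M"
        have [measurable]: "F t \<in> borel_measurable N" using t by measurable
        have "esssup N (F t) \<le> a \<longleftrightarrow> (AE x in N. F t x \<le> a)"
          using esssup_AE[of "F t" N] by (auto intro!: esssup_I elim!: eventually_mono)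
        also have "\<dots> \<longleftrightarrow> emeasure N {x \<in> space N. \<not> F t x \<le> a} = 0"
          by (rule AE_iff_measurable[OF _ refl]) measurable
        also have "{x \<in> space N. \<not> F t x \<le> a} =
            Pair t -` {p \<in> space (M \<Otimes>\<^sub>M N). a < F (fst p) (snd p)}"
          using t by (auto simp: space_pair_measure)
        finally show "esssup N (\<lambda>x. F t x) \<le> a \<longleftrightarrow>
            emeasure N (Pair t -` {p \<in> space (M \<Otimes>\<^sub>M N). a < F (fst p) (snd p)}) = 0" by simp
      qed
      also have "\<dots> \<in> sets M"
        using measurable_emeasure_Pair[OF m] by measurable
      finally show "{t \<in> space M. esssup N (\<lambda>x. F t x) \<le> a} \<in> sets M" .
    qed
    then show ?thesis using True by (simp add: Lnorm_top)
  qed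
qed

section \<open>Hoelder's inequality\<close>

lemma Lnorm_Holder_endpoint:
  assumes "a \<in> borel_measurable M" "b \<in> borel_measurable M"
  shows "(\<integral>\<^sup>+ x. a x * b x \<partial>M) \<le> Lnorm top M a * Lnorm 1 M b"
proof -
  have "AE x in M. a x \<le> esssup M a" by (rule esssup_AE)
  then have "(\<integral>\<^sup>+ x. a x * b x \<partial>M) \<le> (\<integral>\<^sup>+ x. esssup M a * b x \<partial>M)"
    by (intro nn_integral_mono_AE) (auto intro: mult_right_mono elim!: eventually_mono)
  also have "\<dots> = esssup M a * (\<integral>\<^sup>+ x. b x \<partial>M)"
    using assms by (intro nn_integral_cmult)
  also have "(\<integral>\<^sup>+ x. b x \<partial>M) = Lnorm 1 M b"
    using Lnorm_finite[of 1 M b] by simp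
  finally show ?thesis by (simp add: Lnorm_top)
qed

lemma Youngs_inequality_ennreal:
  fixes a b :: ennreal
  assumes "1 < x" "1 < y" "1 / x + 1 / y = 1"
  shows "a * b \<le> ennreal (1 / x) * epow a x + ennreal (1 / y) * epow b y"
proof (cases a; cases b)
  fix r s assume h: "0 \<le> r" "a = ennreal r" "0 \<le> s" "b = ennreal s"
  have "r * s \<le> r powr x / x + s powr y / y"
    using assms h by (intro Youngs_inequality) auto
  then show ?thesis using assms h
    by (simp add: ennreal_mult[symmetric] ennreal_plus[symmetric] del: ennreal_plus)
qed (use assms in \<open>auto simp: ennreal_mult_top\<close>)

text \<open>Both functions are normalised and Young's inequality is integrated. Normalising fails
  when a norm is 0 or infinite. Since 0 times top is 0, these cases require that a vanishing norm
  makes the integral vanish.\<close>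

lemma Lnorm_Holder:
  assumes p: "1 \<le> p" and ab[measurable]: "a \<in> borel_measurable M" "b \<in> borel_measurable M"
  shows "(\<integral>\<^sup>+ x. a x * b x \<partial>M) \<le> Lnorm p M a * Lnorm (conj_exp p) M b"
  using p
proof (cases rule: conj_exp_cases)
  case 1
  then show ?thesis using Lnorm_Holder_endpoint[OF ab] by simp
next
  case 2
  then show ?thesis using Lnorm_Holder_endpoint[OF ab(2,1)] by (simp add: mult.commute)
next
  case (3 x y)
  let ?A = "\<integral>\<^sup>+ z. epow (a z) x \<partial>M" and ?B = "\<integral>\<^sup>+ z. epow (b z) y \<partial>M"
  have L: "Lnorm p M a = epow ?A (1 / x)" "Lnorm (conj_exp p) M b = epow ?B (1 / y)"
    using 3 by (auto simp: Lnorm_finite)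
  have zero: "(\<integral>\<^sup>+ z. a z * b z \<partial>M) = 0" if "?A = 0 \<or> ?B = 0"
  proof -
    have "AE z in M. a z = 0 \<or> b z = 0"
    proof -
      have e: "epow w u = 0 \<longleftrightarrow> w = 0" for w u by (cases w) auto
      from that show ?thesis
        by (auto simp: nn_integral_0_iff_AE e elim: eventually_mono)
    qed
    then show ?thesis by (subst nn_integral_0_iff_AE) (auto elim: eventually_mono)
  qed
  show ?thesis
  proof (cases "?A = 0 \<or> ?B = 0 \<or> ?A = top \<or> ?B = top")
    case True
    then consider "?A = 0 \<or> ?B = 0" | "?A \<noteq> 0" "?B = top" | "?A = top" "?B \<noteq> 0" by blast
    then show ?thesis
    proof cases
      case 1
      then show ?thesis by (simp add: zero)
    next
      case 2
      then have "epow ?A (1 / x) \<noteq> 0" using 3 by (cases ?A) auto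
      then show ?thesis using L 2 by (simp add: ennreal_mult_top)
    next
      case 3
      then have "epow ?B (1 / y) \<noteq> 0" by (cases ?B) auto
      then show ?thesis using L 3 by (simp add: ennreal_top_mult)
    qed
  next
    case False
    then obtain A B where A: "?A = ennreal A" "0 < A" and B: "?B = ennreal B" "0 < B"
      by (cases ?A; cases ?B) (auto simp: less_le)
    \<comment> \<open>These are the two norms. Division by them turns the integrals of the powers
      into 1, so that Young's inequality integrates to 1/x + 1/y = 1.\<close>
    let ?s = "A powr (1 / x)" and ?t = "B powr (1 / y)"
    have st: "0 < ?s" "0 < ?t" using A B by auto
    have pw: "(1 / ?s) powr x = 1 / A" "(1 / ?t) powr y = 1 / B"
      using A B 3 by (auto simp: powr_divide powr_powr)
    have "ennreal (1 / ?s * (1 / ?t)) * (\<integral>\<^sup>+ z. a z * b z \<partial>M) =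
        (\<integral>\<^sup>+ z. (ennreal (1 / ?s) * a z) * (ennreal (1 / ?t) * b z) \<partial>M)"
    proof -
      have "ennreal (u * v) * (\<integral>\<^sup>+ z. a z * b z \<partial>M) = (\<integral>\<^sup>+ z. (ennreal u * a z) * (ennreal v * b z) \<partial>M)"
        if "0 < u" "0 < v" for u v
        using that by (subst nn_integral_cmult[symmetric]) (auto simp: ennreal_mult ac_simps)
      from this[of "1 / ?s" "1 / ?t"] st show ?thesis by (simp only: zero_less_divide_1_iff)
    qed
    also have "\<dots> \<le> (\<integral>\<^sup>+ z. ennreal (1 / x) * epow (ennreal (1 / ?s) * a z) x
        + ennreal (1 / y) * epow (ennreal (1 / ?t) * b z) y \<partial>M)"
      using 3 by (intro nn_integral_mono Youngs_inequality_ennreal)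
    also have "\<dots> = (\<integral>\<^sup>+ z. ennreal (1 / x * (1 / A)) * epow (a z) x
        + ennreal (1 / y * (1 / B)) * epow (b z) y \<partial>M)"
    proof -
      have "ennreal (1 / x) * epow (ennreal u * w) x = ennreal (1 / x * u powr x) * epow w x"
        if "0 < x" "0 \<le> u" for u x w
        using that by (simp add: epow_mult mult.assoc[symmetric] ennreal_mult[symmetric])
      from this[of x "1 / ?s"] this[of y "1 / ?t"] 3 st show ?thesis by (simp only: pw) simp
    qed
    also have "\<dots> = ennreal (1 / x * (1 / A)) * ?A + ennreal (1 / y * (1 / B)) * ?B"
      by (simp add: nn_integral_add nn_integral_cmult)
    also have "\<dots> = ennreal (1 / x) + ennreal (1 / y)"
      using A B 3 by (simp add: ennreal_mult[symmetric])
    also have "\<dots> = 1" using 3 by (simp add: ennreal_plus[symmetric] del: ennreal_plus)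
    finally have "ennreal (?s * ?t) * (ennreal (1 / ?s * (1 / ?t)) * (\<integral>\<^sup>+ z. a z * b z \<partial>M)) \<le> ennreal (?s * ?t) * 1"
      by (rule mult_left_mono) simp
    moreover have "ennreal (?s * ?t) * (ennreal (1 / ?s * (1 / ?t)) * w) = w" for w
      using st A B by (simp add: mult.assoc[symmetric] ennreal_mult[symmetric])
    ultimately show ?thesis using A B L by (simp add: ennreal_mult)
  qed
qed

section \<open>Functions on the half space and mixed norms\<close>

lemma half_space_borel [measurable]: "half_space \<in> sets borel"
  unfolding half_space_def by (intro borel_open open_Times) auto

lemma measurable_cut [measurable (raw)]:
  "E \<in> sets M \<Longrightarrow> f \<in> borel_measurable M \<Longrightarrow> cut E f \<in> borel_measurable M"
  unfolding cut_def by (intro borel_measurable_times borel_measurable_indicator)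

text \<open>\<open>T f\<close> is measurable on the half space only. Cutting to a set inside it
  discards all outer values, so \<open>h\<close> may be replaced by its extension by 0.\<close>

lemma measurable_cut_hs:
  assumes "F \<in> sets borel" "F \<subseteq> half_space" "h \<in> borel_measurable hs_measure"
  shows "cut F h \<in> borel_measurable borel"
proof -
  have "(\<lambda>p. if p \<in> half_space then h p else 0) \<in> borel_measurable borel"
    using assms(3) by (subst measurable_restrict_space_iff[symmetric])
      (auto simp: hs_measure_def cong: measurable_cong_sets sets_restrict_space_cong)
  then have "cut F (\<lambda>p. if p \<in> half_space then h p else 0) \<in> borel_measurable borel"
    using assms(1) by measurable
  also have "cut F (\<lambda>p. if p \<in> half_space then h p else 0) = cut F h"
    using assms(2) by (auto simp: cut_def fun_eq_iff indicator_def)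
  finally show ?thesis .
qed

lemma nn_integral_hs: "(\<integral>\<^sup>+ p. h p \<partial>hs_measure) = (\<integral>\<^sup>+ p. h p * indicator half_space p \<partial>lborel)"
  unfolding hs_measure_def by (intro nn_integral_restrict_space) simp

lemma borel_measurable_slice_norm:
  fixes F :: "real \<times> (real ^ 'n) \<Rightarrow> complex"
  assumes "F \<in> borel_measurable borel" "sets N = sets borel" "sigma_finite_measure N" "sets M = sets borel"
  shows "(\<lambda>t. Lnorm b N (\<lambda>x. ennreal (norm (F (t, x))))) \<in> borel_measurable M"
proof (rule borel_measurable_Lnorm[OF assms(3)])
  have "sets (M \<Otimes>\<^sub>M N) = sets (borel :: (real \<times> (real ^ 'n)) measure)"
    using assms by (simp add: borel_prod[symmetric] cong: sets_pair_measure_cong)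
  then have [measurable]: "F \<in> borel_measurable (M \<Otimes>\<^sub>M N)"
    using assms(1) by (simp cong: measurable_cong_sets)
  show "(\<lambda>(t, x). ennreal (norm (F (t, x)))) \<in> borel_measurable (M \<Otimes>\<^sub>M N)" by simp
qed

lemma mixed_norm_eq:
  assumes "1 \<le> a" "F \<in> borel_measurable borel"
  shows "mixed_norm a b F = Lnorm a lborel
    (\<lambda>t. Lnorm b lborel (\<lambda>x. ennreal (norm (F (t, x)))) * indicator {0<..} t)"
  unfolding mixed_norm_def using assms
  by (intro Lnorm_restrict_space borel_measurable_slice_norm lborel.sigma_finite_measure_axioms) auto

lemma AE_lborel_pairD:
  fixes P :: "'a::euclidean_space \<times> 'b::euclidean_space \<Rightarrow> bool"
  assumes "AE p in lborel. P p"
  shows "AE t in lborel. AE x in lborel. P (t, x)"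
  using assms by (intro lborel_pair.AE_pair) (subst lborel_prod)

lemma mixed_norm_mono_AE:
  fixes F G :: "real \<times> (real ^ 'n) \<Rightarrow> complex"
  assumes [measurable]: "F \<in> borel_measurable borel" and G: "G \<in> borel_measurable borel"
    and "1 \<le> a" "AE p in lborel. norm (F p) \<le> norm (G p)"
  shows "mixed_norm a b F \<le> mixed_norm a b G"
proof -
  have "AE t in lborel. AE x in lborel. norm (F (t, x)) \<le> norm (G (t, x))"
    using assms by (intro AE_lborel_pairD)
  then have "AE t in lborel. Lnorm b lborel (\<lambda>x. ennreal (norm (F (t, x)))) * indicator {0<..} t
      \<le> Lnorm b lborel (\<lambda>x. ennreal (norm (G (t, x)))) * indicator {0<..} t"
    by eventually_elim (intro mult_right_mono Lnorm_mono_AE; auto elim: eventually_mono intro!: ennreal_leI)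
  then show ?thesis
    unfolding mixed_norm_eq[OF \<open>1 \<le> a\<close> assms(1)] mixed_norm_eq[OF \<open>1 \<le> a\<close> G]
    using borel_measurable_slice_norm[OF assms(1) _ lborel.sigma_finite_measure_axioms, of lborel b]
    by (intro Lnorm_mono_AE borel_measurable_times) auto
qed

text \<open>Hoelder in x for each fixed t > 0, then Hoelder in t for the resulting slice
  norms.\<close>

lemma mixed_norm_Holder:
  fixes F G :: "real \<times> (real ^ 'n) \<Rightarrow> complex"
  assumes F[measurable]: "F \<in> borel_measurable borel" and G[measurable]: "G \<in> borel_measurable borel"
    and p: "1 \<le> p" and q: "1 \<le> q"
  shows "(\<integral>\<^sup>+ z. ennreal (norm (F z) * norm (G z)) \<partial>hs_measure)
    \<le> mixed_norm p q F * mixed_norm (conj_exp p) (conj_exp q) G"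
proof -
  let ?f = "\<lambda>t. Lnorm q lborel (\<lambda>x. ennreal (norm (F (t, x))))"
  let ?g = "\<lambda>t. Lnorm (conj_exp q) lborel (\<lambda>x. ennreal (norm (G (t, x))))"
  have [measurable]: "?f \<in> borel_measurable lborel" "?g \<in> borel_measurable lborel"
    using F G by (auto intro!: borel_measurable_slice_norm lborel.sigma_finite_measure_axioms)
  have "(\<integral>\<^sup>+ z. ennreal (norm (F z) * norm (G z)) \<partial>hs_measure) =
      (\<integral>\<^sup>+ z. ennreal (norm (F z) * norm (G z)) * indicator half_space z \<partial>(lborel \<Otimes>\<^sub>M lborel))"
    by (simp add: nn_integral_hs lborel_prod)
  also have "\<dots> = (\<integral>\<^sup>+ t. \<integral>\<^sup>+ x. ennreal (norm (F (t, x)) * norm (G (t, x))) * indicator half_space (t, x) \<partial>lborel \<partial>lborel)"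
    by (subst lborel.nn_integral_fst[symmetric]) (simp_all add: lborel_prod)
  also have "\<dots> \<le> (\<integral>\<^sup>+ t. (?f t * indicator {0<..} t) * (?g t * indicator {0<..} t) \<partial>lborel)"
  proof (intro nn_integral_mono)
    fix t :: real
    show "(\<integral>\<^sup>+ x. ennreal (norm (F (t, x)) * norm (G (t, x))) * indicator half_space (t, x) \<partial>lborel)
        \<le> (?f t * indicator {0<..} t) * (?g t * indicator {0<..} t)"
    proof (cases "t > 0")
      case True
      have [measurable]: "(\<lambda>x. F (t, x)) \<in> borel_measurable borel" "(\<lambda>x. G (t, x)) \<in> borel_measurable borel"
        using F G by (auto intro!: measurable_compose[of "Pair t" borel borel] simp: borel_prod[symmetric])
      show ?thesis using True
        Lnorm_Holder[OF q, of "\<lambda>x. ennreal (norm (F (t, x)))" lborel "\<lambda>x. ennreal (norm (G (t, x)))"]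
        by (simp add: half_space_def ennreal_mult)
    qed (simp add: half_space_def)
  qed
  also have "\<dots> \<le> mixed_norm p q F * mixed_norm (conj_exp p) (conj_exp q) G"
    unfolding mixed_norm_eq[OF p F] mixed_norm_eq[OF one_le_conj_exp[OF p] G]
    by (intro Lnorm_Holder p) auto
  finally show ?thesis .
qed

text \<open>Source of the nested averages in the model operators: {a<..<b} becomes the time window
  and \<open>B\<close> the ball. The rectangle may be smaller than their product; passing to the
  larger sets costs powers of their measures.\<close>

lemma mixed_norm_le_avg_avg:
  fixes f :: "real \<times> (real ^ 'n) \<Rightarrow> complex"
  assumes f: "f \<in> borel_measurable borel" and pq: "1 \<le> p" "1 \<le> q" and ab: "a < b"
    and B: "B \<in> sets borel" "emeasure lborel B = ennreal w" "0 < w"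
    and E: "I \<in> sets borel" "X \<in> sets borel" "I \<subseteq> {a<..<b}" "X \<subseteq> B"
  shows "mixed_norm p q (cut (I \<times> X) f) \<le> ennreal ((b - a) powr rcp p * w powr rcp q)
    * avg p {a<..<b} (\<lambda>s. avg q B (\<lambda>y. ennreal (norm (f (s, y)))))"
proof -
  let ?A = "{a<..<b}"
  let ?k = "\<lambda>s. avg q B (\<lambda>y. ennreal (norm (f (s, y))))"
  have [measurable]: "?A \<in> sets borel" "I \<times> X \<in> sets borel"
    using E by (auto simp: borel_prod[symmetric])
  have fm: "cut (I \<times> X) f \<in> borel_measurable borel" using f by measurable
  have sl[measurable]: "(\<lambda>x. f (t, x)) \<in> borel_measurable borel" for t
    using f by (auto intro!: measurable_compose[of "Pair t" borel borel] simp: borel_prod[symmetric])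
  have "finite_measure (uniform_measure lborel B)"
    using B by (intro finite_measureI) (simp add: divide_ennreal)
  then interpret U: finite_measure "uniform_measure lborel B" .
  have k[measurable]: "?k \<in> borel_measurable borel"
    unfolding avg_def using f U.sigma_finite_measure_axioms by (intro borel_measurable_slice_norm) auto
  have pt: "Lnorm q lborel (\<lambda>x. ennreal (norm (cut (I \<times> X) f (t, x)))) * indicator {0<..} t
      \<le> (ennreal (w powr rcp q) * ?k t) * indicator ?A t" for t
  proof (cases "t \<in> I")
    case True
    have "Lnorm q lborel (\<lambda>x. ennreal (norm (cut (I \<times> X) f (t, x))))
        \<le> Lnorm q lborel (\<lambda>x. ennreal (norm (f (t, x))) * indicator B x)"
      using E True by (intro Lnorm_mono) (auto simp: cut_def indicator_def)
    also have "\<dots> \<le> ennreal (w powr rcp q) * ?k t"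
      unfolding avg_def using pq B by (intro Lnorm_uniform_measure) auto
    finally show ?thesis using True E by (auto simp: indicator_def)
  next
    case False
    then show ?thesis using pq by (simp add: cut_def)
  qed
  have "mixed_norm p q (cut (I \<times> X) f) \<le> Lnorm p lborel (\<lambda>t. (ennreal (w powr rcp q) * ?k t) * indicator ?A t)"
    unfolding mixed_norm_eq[OF pq(1) fm] using pt
      borel_measurable_slice_norm[OF fm _ lborel.sigma_finite_measure_axioms, of lborel q]
    by (intro Lnorm_mono borel_measurable_times) auto
  also have "\<dots> \<le> ennreal ((b - a) powr rcp p) * Lnorm p (uniform_measure lborel ?A) (\<lambda>t. ennreal (w powr rcp q) * ?k t)"
    using pq ab by (intro Lnorm_uniform_measure) auto
  also have "\<dots> = ennreal ((b - a) powr rcp p * w powr rcp q) * avg p ?A ?k"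
  proof (subst Lnorm_cmult)
    show "?k \<in> borel_measurable (uniform_measure lborel ?A)"
      using k by (simp cong: measurable_cong_sets)
  qed (use pq B in \<open>auto simp: avg_def ennreal_mult mult.assoc\<close>)
  finally show ?thesis .
qed

text \<open>Fubini. For finite p both sides come from the same iterated integral, up to the
  restriction to t > 0; for p = top, almost every section of a null set of the product is
  null.\<close>

lemma mixed_norm_diagonal_le:
  fixes F :: "real \<times> (real ^ 'n) \<Rightarrow> complex"
  assumes p: "1 \<le> p" and F[measurable]: "F \<in> borel_measurable borel"
  shows "mixed_norm p p F \<le> Lnorm p lborel (\<lambda>z. ennreal (norm (F z)))"
  using p
proof (cases rule: exponent_cases)
  case 1
  have sl[measurable]: "(\<lambda>x. F (t, x)) \<in> borel_measurable borel" for t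
    using F by (auto intro!: measurable_compose[of "Pair t" borel borel] simp: borel_prod[symmetric])
  let ?c = "esssup lborel (\<lambda>z. ennreal (norm (F z)))"
  have "AE t in lborel. AE x in lborel. ennreal (norm (F (t, x))) \<le> ?c"
    by (intro AE_lborel_pairD esssup_AE)
  then have "AE t in lborel. esssup lborel (\<lambda>x. ennreal (norm (F (t, x)))) * indicator {0<..} t \<le> ?c"
    by eventually_elim (auto simp: indicator_def intro!: esssup_I)
  moreover have "(\<lambda>t. esssup lborel (\<lambda>x. ennreal (norm (F (t, x))))) \<in> borel_measurable lborel"
    using borel_measurable_slice_norm[OF F, of lborel lborel top] lborel.sigma_finite_measure_axioms
    by (simp add: Lnorm_top)
  ultimately show ?thesis
    unfolding mixed_norm_eq[OF p F] unfolding 1 Lnorm_top by (intro esssup_I) auto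
next
  case (2 x)
  have "(\<integral>\<^sup>+ t. epow (Lnorm p lborel (\<lambda>x. ennreal (norm (F (t, x)))) * indicator {0<..} t) x \<partial>lborel)
    \<le> (\<integral>\<^sup>+ t. \<integral>\<^sup>+ y. epow (ennreal (norm (F (t, y)))) x \<partial>lborel \<partial>lborel)"
    using 2 by (intro nn_integral_mono) (auto simp: indicator_def Lnorm_finite epow_epow)
  also have "\<dots> = (\<integral>\<^sup>+ z. epow (ennreal (norm (F z))) x \<partial>(lborel \<Otimes>\<^sub>M lborel))"
    by (subst lborel.nn_integral_fst[symmetric]) (simp_all add: lborel_prod)
  finally show ?thesis
    unfolding mixed_norm_eq[OF p F] using 2
    by (simp add: Lnorm_finite lborel_prod epow_mono)
qed

text \<open>The inclusion is asked for almost everywhere only: the time windows below are half open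
  and the tripled cubes closed, whereas the Whitney regions of the theorem have open time
  intervals.\<close>

lemma mixed_norm_le_avg:
  fixes f :: "real \<times> (real ^ 'n) \<Rightarrow> complex"
  assumes f[measurable]: "f \<in> borel_measurable borel" and p: "1 \<le> p"
    and E[measurable]: "E \<in> sets borel" "E' \<in> sets borel" and w: "emeasure lborel E' = ennreal w" "0 < w"
    and AE: "AE z in lborel. z \<in> E \<longrightarrow> z \<in> E'"
  shows "mixed_norm p p (cut E f) \<le> ennreal (w powr rcp p) * avg p E' (\<lambda>z. ennreal (norm (f z)))"
proof -
  have "mixed_norm p p (cut E f) \<le> Lnorm p lborel (\<lambda>z. ennreal (norm (cut E f z)))"
    by (intro mixed_norm_diagonal_le p) measurable
  also have "\<dots> \<le> Lnorm p lborel (\<lambda>z. ennreal (norm (f z)) * indicator E' z)"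
    using AE by (intro Lnorm_mono_AE) (auto simp: cut_def indicator_def elim: eventually_mono)
  also have "\<dots> \<le> ennreal (w powr rcp p) * avg p E' (\<lambda>z. ennreal (norm (f z)))"
    unfolding avg_def using p w by (intro Lnorm_uniform_measure) auto
  finally show ?thesis .
qed

section \<open>Cubes and dyadic trees\<close>

declare le_divide_eq_numeral1 [simp del] less_divide_eq_numeral1 [simp del]

lemma norm_le_sqrt_card:
  fixes v :: "real ^ 'n"
  assumes "\<And>i. \<bar>v $ i\<bar> \<le> b" "0 \<le> b"
  shows "norm v \<le> sqrt (real CARD('n)) * b"
proof -
  have "(\<Sum>i\<in>UNIV. (norm (v $ i))\<^sup>2) \<le> (\<Sum>i\<in>(UNIV :: 'n set). b\<^sup>2)"
    using assms by (intro sum_mono power_mono) auto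
  then have "norm v \<le> sqrt (real CARD('n) * b\<^sup>2)"
    unfolding norm_vec_def L2_set_def by (intro real_sqrt_le_mono) simp
  then show ?thesis using assms by (simp add: real_sqrt_mult)
qed

section \<open>Closed cubes, closures and volumes\<close>

definition ccube :: "real ^ 'n \<Rightarrow> real \<Rightarrow> (real ^ 'n) set" where
  "ccube z l = {x. \<forall>i. \<bar>x $ i - z $ i\<bar> \<le> l / 2}"

lemma ccube_eq_cbox: "ccube z l = cbox (\<chi> i. z $ i - l / 2) (\<chi> i. z $ i + l / 2)"
  unfolding ccube_def by (simp add: set_eq_iff mem_box_cart abs_diff_le_iff)

lemma closed_ccube: "closed (ccube z l)"
  unfolding ccube_eq_cbox by (rule closed_cbox)

lemma ccube_borel: "ccube z l \<in> sets borel"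
  by (intro borel_closed closed_ccube)

lemma cube_ccube: "0 < l \<Longrightarrow> cube z l (ccube z l)"
  unfolding cube_def ccube_def
  by (intro conjI exI[of _ "\<lambda>i. {z $ i - l / 2..z $ i + l / 2}"]) (simp_all add: abs_diff_le_iff subset_iff)

lemma cube_pos: "cube z l Q \<Longrightarrow> 0 < l"
  by (simp add: cube_def)

lemma cube_interiorI: "cube z l Q \<Longrightarrow> (\<And>i. \<bar>x $ i - z $ i\<bar> < l / 2) \<Longrightarrow> x \<in> Q"
  unfolding cube_def by (auto simp: abs_diff_less_iff subset_iff)

lemma cube_subset_ccube: "cube z l Q \<Longrightarrow> Q \<subseteq> ccube z l"
  unfolding cube_def ccube_def by (auto simp: abs_diff_le_iff subset_iff)

lemma cubeD: "cube z l Q \<Longrightarrow> x \<in> Q \<Longrightarrow> \<bar>x $ i - z $ i\<bar> \<le> l / 2"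
  using cube_subset_ccube[of z l Q] by (auto simp: ccube_def)

lemma centre_in_cube: "cube z l Q \<Longrightarrow> z \<in> Q"
  by (rule cube_interiorI) (auto simp: cube_pos)

lemma box_subset_cube: "cube z l Q \<Longrightarrow> box (\<chi> i. z $ i - l / 2) (\<chi> i. z $ i + l / 2) \<subseteq> Q"
  by (auto intro!: cube_interiorI simp: mem_box_cart abs_diff_less_iff)

text \<open>Whichever endpoints a cube contains, it lies between the open box and the closed one,
  and these have the same closure. Centre and side can therefore be recovered from the set
  alone.\<close>

lemma closure_cube:
  assumes "cube z l Q"
  shows "closure Q = ccube z l"
proof (rule antisym)
  show "closure Q \<subseteq> ccube z l"
    using cube_subset_ccube[OF assms] closed_ccube by (rule closure_minimal)
  have "box (\<chi> i. z $ i - l / 2) (\<chi> i. z $ i + l / 2) \<noteq> {}"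
  proof -
    have "z \<in> box (\<chi> i. z $ i - l / 2) (\<chi> i. z $ i + l / 2)"
      using cube_pos[OF assms] by (simp add: mem_box_cart)
    then show ?thesis by blast
  qed
  then have "ccube z l = closure (box (\<chi> i. z $ i - l / 2) (\<chi> i. z $ i + l / 2))"
    by (simp add: ccube_eq_cbox)
  also have "\<dots> \<subseteq> closure Q" by (intro closure_mono box_subset_cube assms)
  finally show "ccube z l \<subseteq> closure Q" .
qed

lemma ccube_subset_iff:
  assumes "0 < l"
  shows "ccube z l \<subseteq> ccube w k \<longleftrightarrow> (\<forall>i. \<bar>z $ i - w $ i\<bar> \<le> k / 2 - l / 2)"
proof
  assume h: "ccube z l \<subseteq> ccube w k"
  have "(\<chi> i. z $ i + l / 2) \<in> ccube z l" "(\<chi> i. z $ i - l / 2) \<in> ccube z l"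
    using assms by (auto simp: ccube_def)
  with h have "(\<chi> i. z $ i + l / 2) \<in> ccube w k" "(\<chi> i. z $ i - l / 2) \<in> ccube w k"
    by blast+
  then have b: "\<bar>z $ i + l / 2 - w $ i\<bar> \<le> k / 2" "\<bar>z $ i - l / 2 - w $ i\<bar> \<le> k / 2" for i
    by (auto simp: ccube_def)
  show "\<forall>i. \<bar>z $ i - w $ i\<bar> \<le> k / 2 - l / 2"
  proof
    fix i show "\<bar>z $ i - w $ i\<bar> \<le> k / 2 - l / 2" using b[of i] by linarith
  qed
next
  assume h: "\<forall>i. \<bar>z $ i - w $ i\<bar> \<le> k / 2 - l / 2"
  have "\<bar>x - w $ i\<bar> \<le> k / 2" if "\<bar>x - z $ i\<bar> \<le> l / 2" for x i
  proof -
    have "\<bar>z $ i - w $ i\<bar> \<le> k / 2 - l / 2" using h by blast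
    with that show ?thesis by linarith
  qed
  then show "ccube z l \<subseteq> ccube w k" by (auto simp: ccube_def)
qed

lemma cube_subset_centres:
  assumes "cube z l Q" "cube w k R" "Q \<subseteq> R"
  shows "\<bar>z $ i - w $ i\<bar> \<le> k / 2 - l / 2"
  using closure_mono[OF assms(3)] assms
  by (simp add: closure_cube ccube_subset_iff cube_pos)

lemma cube_unique:
  assumes "cube z l Q" "cube w k Q"
  shows "z = w \<and> l = k"
proof -
  have h: "\<bar>z $ i - w $ i\<bar> \<le> k / 2 - l / 2" "\<bar>w $ i - z $ i\<bar> \<le> l / 2 - k / 2" for i
    using cube_subset_centres[OF assms] cube_subset_centres[OF assms(2,1)] by auto
  have "z $ i = w $ i \<and> l = k" for i
    using h[of i] by linarith
  then show ?thesis by (simp add: vec_eq_iff)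
qed

lemma side_eq: "cube z l Q \<Longrightarrow> side Q = l"
  unfolding side_def by (rule the_equality) (auto dest: cube_unique)

lemma centre_eq: "cube z l Q \<Longrightarrow> centre Q = z"
  unfolding centre_def by (rule the_equality) (auto dest: cube_unique)

lemma cube_borel [measurable]:
  assumes "cube z l Q"
  shows "Q \<in> sets borel"
proof -
  obtain I where I: "\<And>i. {z $ i - l / 2 <..< z $ i + l / 2} \<subseteq> I i"
      "\<And>i. I i \<subseteq> {z $ i - l / 2 .. z $ i + l / 2}" and Q: "Q = {x. \<forall>i. x $ i \<in> I i}"
    using assms by (auto simp: cube_def)
  have [measurable]: "I i \<in> sets borel" for i
  proof -
    \<comment> \<open>Each factor differs from the open interval by at most two points.\<close>
    have "I i = {z $ i - l / 2 <..< z $ i + l / 2} \<union> (I i \<inter> {z $ i - l / 2, z $ i + l / 2})"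
    proof (intro equalityI subsetI)
      fix x assume "x \<in> I i"
      then show "x \<in> {z $ i - l / 2 <..< z $ i + l / 2} \<union> (I i \<inter> {z $ i - l / 2, z $ i + l / 2})"
        using subsetD[OF I(2)[of i], of x] by (cases "x = z $ i - l / 2 \<or> x = z $ i + l / 2") auto
    qed (use I(1)[of i] in blast)
    moreover have "I i \<inter> {z $ i - l / 2, z $ i + l / 2} \<in> sets borel"
      by (intro borel_closed finite_imp_closed) auto
    ultimately show ?thesis
      using sets.Un[OF borel_open[OF open_greaterThanLessThan]] by metis
  qed
  have "Q = (\<Inter>i. (\<lambda>x. x $ i) -` I i \<inter> space borel)" using Q by auto
  also have "\<dots> \<in> sets borel"
    by (intro sets.finite_INT measurable_sets[of _ borel borel] borel_measurable_continuous_onI) (auto intro!: continuous_intros)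
  finally show ?thesis .
qed

lemma emeasure_box_ccube:
  fixes z :: "real ^ 'n"
  assumes "0 < l"
  shows "emeasure lborel (box (\<chi> i. z $ i - l / 2) (\<chi> i. z $ i + l / 2)) = ennreal (l ^ CARD('n))"
    "emeasure lborel (ccube z l) = ennreal (l ^ CARD('n))"
proof -
  let ?a = "(\<chi> i. z $ i - l / 2) :: real ^ 'n" and ?b = "(\<chi> i. z $ i + l / 2) :: real ^ 'n"
  have le: "?a \<bullet> b \<le> ?b \<bullet> b" and pr: "(?b - ?a) \<bullet> b = l" if "b \<in> Basis" for b
    using that assms by (auto simp: Basis_vec_def inner_axis)
  have "(\<Prod>b\<in>Basis. (?b - ?a) \<bullet> b) = l ^ CARD('n)"
  proof -
    have "(\<Prod>b\<in>Basis. (?b - ?a) \<bullet> b) = (\<Prod>b\<in>(Basis :: (real ^ 'n) set). l)"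
      by (rule prod.cong[OF refl pr])
    then show ?thesis by simp
  qed
  then show "emeasure lborel (box ?a ?b) = ennreal (l ^ CARD('n))"
    "emeasure lborel (ccube z l) = ennreal (l ^ CARD('n))"
    using le by (auto simp: ccube_eq_cbox emeasure_lborel_box emeasure_lborel_cbox)
qed

lemma emeasure_cube:
  fixes Q :: "(real ^ 'n) set"
  assumes "cube z l Q"
  shows "emeasure lborel Q = ennreal (l ^ CARD('n))"
proof (rule antisym)
  have [measurable]: "Q \<in> sets borel" "ccube z l \<in> sets borel"
    using assms by (auto intro: cube_borel ccube_borel)
  show "emeasure lborel Q \<le> ennreal (l ^ CARD('n))"
    unfolding emeasure_box_ccube(2)[OF cube_pos[OF assms], of z, symmetric]
    by (rule emeasure_mono) (use cube_subset_ccube[OF assms] in auto)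
  show "ennreal (l ^ CARD('n)) \<le> emeasure lborel Q"
    unfolding emeasure_box_ccube(1)[OF cube_pos[OF assms], of z, symmetric]
    by (rule emeasure_mono) (use box_subset_cube[OF assms] in auto)
qed

lemma cube_triple:
  assumes "cube z l Q"
  shows "cube z (3 * l) (triple Q)"
proof -
  obtain I where l: "0 < l" and I: "\<And>i. {z $ i - l / 2 <..< z $ i + l / 2} \<subseteq> I i"
      "\<And>i. I i \<subseteq> {z $ i - l / 2 .. z $ i + l / 2}" and Q: "Q = {x. \<forall>i. x $ i \<in> I i}"
    using assms by (auto simp: cube_def)
  let ?J = "\<lambda>i. {y. z $ i + (y - z $ i) / 3 \<in> I i}"
  have "triple Q = {x. \<forall>i. x $ i \<in> ?J i}"
  proof (intro equalityI subsetI)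
    fix x assume "x \<in> triple Q"
    then obtain y where y: "y \<in> Q" and x: "x = z + 3 *\<^sub>R (y - z)"
      unfolding triple_def centre_eq[OF assms] by blast
    have "z $ i + (x $ i - z $ i) / 3 = y $ i" for i by (simp add: x field_simps)
    with y show "x \<in> {x. \<forall>i. x $ i \<in> ?J i}"
      by (simp add: Q)
  next
    fix x assume "x \<in> {x. \<forall>i. x $ i \<in> ?J i}"
    then have "z + (1 / 3) *\<^sub>R (x - z) \<in> Q" by (simp add: Q)
    moreover have "x = z + 3 *\<^sub>R (z + (1 / 3) *\<^sub>R (x - z) - z)" by simp
    ultimately show "x \<in> triple Q" unfolding triple_def centre_eq[OF assms] by blast
  qed
  moreover have "{z $ i - 3 * l / 2 <..< z $ i + 3 * l / 2} \<subseteq> ?J i" for i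
    using I(1)[of i] by (auto simp: subset_iff field_simps)
  moreover have "?J i \<subseteq> {z $ i - 3 * l / 2 .. z $ i + 3 * l / 2}" for i
    using I(2)[of i] by (auto simp: subset_iff field_simps)
  ultimately show ?thesis unfolding cube_def using l by (intro conjI exI[of _ ?J]) auto
qed

lemma bounded_cube: "cube z l Q \<Longrightarrow> bounded Q"
  using cube_subset_ccube bounded_subset bounded_cbox by (metis ccube_eq_cbox)

text \<open>Volume comparison: each cube has volume l^n, and the disjoint cubes together fit into
  volume (k l)^n. Treating finite subfamilies gives finiteness at the same time.\<close>

lemma card_disjoint_cubes:
  fixes \<Q> :: "(real ^ 'n) set set"
  assumes "disjoint \<Q>" "\<And>Q. Q \<in> \<Q> \<Longrightarrow> \<exists>z. cube z l Q" "\<And>Q. Q \<in> \<Q> \<Longrightarrow> Q \<subseteq> ccube w (real k * l)"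
    "0 < l" "0 < k"
  shows "finite \<Q> \<and> card \<Q> \<le> k ^ CARD('n)"
proof (rule finite_if_finite_subsets_card_bdd)
  fix F assume F: "F \<subseteq> \<Q>" "finite F"
  have meas: "Q \<in> sets lborel" "emeasure lborel Q = ennreal (l ^ CARD('n))" if "Q \<in> F" for Q
    using assms(2)[of Q] that F by (auto intro: cube_borel emeasure_cube)
  have "ennreal (real (card F) * l ^ CARD('n)) = (\<Sum>Q\<in>F. emeasure lborel Q)"
    using meas(2) assms(4) by (simp add: ennreal_mult ennreal_of_nat_eq_real_of_nat)
  also have "\<dots> = emeasure lborel (\<Union>Q\<in>F. Q)"
  proof (rule sum_emeasure)
    show "disjoint_family_on (\<lambda>Q. Q) F"
      using F assms(1) unfolding disjoint_family_on_def disjoint_def by blast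
  qed (use meas F in auto)
  also have "\<dots> \<le> emeasure lborel (ccube w (real k * l))"
    using assms(3) F(1) by (intro emeasure_mono UN_least) (auto simp: ccube_borel)
  also have "\<dots> = ennreal ((real k * l) ^ CARD('n))"
    using assms by (intro emeasure_box_ccube) auto
  finally have "real (card F) * l ^ CARD('n) \<le> (real k * l) ^ CARD('n)"
    using assms by (subst (asm) ennreal_le_iff) auto
  then have "real (card F) \<le> real k ^ CARD('n)"
    using assms by (simp add: power_mult_distrib)
  then show "card F \<le> k ^ CARD('n)" by (metis of_nat_le_iff of_nat_power)
qed

text \<open>Closures are compared, so that it does not matter which faces belong to a cube; every
  cube is its own neighbour.\<close>

definition nb :: "(real ^ 'n) set \<Rightarrow> (real ^ 'n) set \<Rightarrow> bool" where
  "nb R Q \<longleftrightarrow> closure R \<inter> closure Q \<noteq> {}"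

lemma nb_mono: "nb R Q \<Longrightarrow> R \<subseteq> R' \<Longrightarrow> Q \<subseteq> Q' \<Longrightarrow> nb R' Q'"
  unfolding nb_def using closure_mono by blast

lemma nb_cube_iff:
  assumes "cube z l Q" "cube w l R"
  shows "nb Q R \<longleftrightarrow> (\<forall>i. \<bar>z $ i - w $ i\<bar> \<le> l)"
proof
  assume "nb Q R"
  then obtain x where "x \<in> ccube z l" "x \<in> ccube w l"
    using assms by (auto simp: nb_def closure_cube)
  then have h: "\<bar>x $ i - z $ i\<bar> \<le> l / 2" "\<bar>x $ i - w $ i\<bar> \<le> l / 2" for i
    by (auto simp: ccube_def)
  show "\<forall>i. \<bar>z $ i - w $ i\<bar> \<le> l"
  proof
    fix i show "\<bar>z $ i - w $ i\<bar> \<le> l" using h[of i] by linarith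
  qed
next
  assume h: "\<forall>i. \<bar>z $ i - w $ i\<bar> \<le> l"
  have "\<bar>(z $ i + w $ i) / 2 - z $ i\<bar> \<le> l / 2" "\<bar>(z $ i + w $ i) / 2 - w $ i\<bar> \<le> l / 2" for i
    using h[rule_format, of i] by (auto simp: abs_if field_simps split: if_splits)
  then have "(\<chi> i. (z $ i + w $ i) / 2) \<in> ccube z l \<inter> ccube w l"
    by (auto simp: ccube_def)
  then show "nb Q R" using assms by (auto simp: nb_def closure_cube)
qed

section \<open>Dyadic trees below one root cube\<close>

locale dyadic_tree =
  fixes P :: "nat \<Rightarrow> (real ^ 'n) set set" and Q0 :: "(real ^ 'n) set" and L :: "nat \<Rightarrow> real"
  assumes L_pos: "\<And>d. 0 < L d" and L_Suc: "\<And>d. L d = 2 * L (Suc d)"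
    and root: "P 0 = {Q0}"
    and part: "\<And>d. partition_on Q0 (P d)"
    and cubes: "\<And>d Q. Q \<in> P d \<Longrightarrow> \<exists>z. cube z (L d) Q"
    and parent: "\<And>d Q. Q \<in> P (Suc d) \<Longrightarrow> \<exists>Q'\<in>P d. Q \<subseteq> Q'"
begin

lemma cube_centre: "Q \<in> P d \<Longrightarrow> cube (centre Q) (L d) Q"
  using cubes centre_eq by blast

lemma P_disjoint: "Q \<in> P d \<Longrightarrow> R \<in> P d \<Longrightarrow> x \<in> Q \<Longrightarrow> x \<in> R \<Longrightarrow> Q = R"
  using part[of d] by (auto simp: partition_on_def disjoint_def)

lemma P_subset: "Q \<in> P d \<Longrightarrow> Q \<subseteq> Q0"
  using part[of d] by (auto simp: partition_on_def)

lemma P_cover: "x \<in> Q0 \<Longrightarrow> \<exists>Q\<in>P d. x \<in> Q"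
  using part[of d] by (auto simp: partition_on_def)

lemma P_borel: "Q \<in> P d \<Longrightarrow> Q \<in> sets borel"
  using cube_centre cube_borel by blast

lemma Q0_borel: "Q0 \<in> sets borel"
  using P_borel[of Q0 0] root by simp

text \<open>The quotient of powers, rather than one power of e - d, keeps the formula valid for
  either order of the two levels.\<close>

lemma L_eq: "L d = L e * 2 ^ e / 2 ^ d"
proof -
  have "L d * 2 ^ d = L 0" for d
  proof (induction d)
    case (Suc d)
    then show ?case by (simp add: L_Suc[of d])
  qed simp
  from this[of d] this[of e] show ?thesis by (simp add: field_simps)
qed

lemma finite_P: "finite (P d)"
proof -
  have Q0: "cube (centre Q0) (L 0) Q0" using cube_centre[of Q0 0] root by simp
  have "finite (P d) \<and> card (P d) \<le> (2 ^ d) ^ CARD('n)"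
  proof (rule card_disjoint_cubes)
    show "disjoint (P d)" using part[of d] by (simp add: partition_on_def)
    show "Q \<subseteq> ccube (centre Q0) (real (2 ^ d) * L d)" if "Q \<in> P d" for Q
    proof -
      have "real (2 ^ d) * L d = L 0" by (subst L_eq[of d 0]) simp
      then show ?thesis using P_subset[OF that] cube_subset_ccube[OF Q0] by (simp only:)
    qed
  qed (use cubes L_pos in auto)
  then show ?thesis ..
qed

text \<open>
  The cubes of a dyadic system are not assumed to lie on a lattice.  This follows from nesting: if a child did not
  touch one of two opposite faces of its parent, then the slab between the child and that face would be
  thinner than a child, and the child covering a point of the slab would overlap the first one.
\<close>

lemma child_centre:
  assumes Q: "Q \<in> P (Suc d)" "Q' \<in> P d" "Q \<subseteq> Q'"
  shows "\<bar>centre Q $ i - centre Q' $ i\<bar> = L (Suc d) / 2"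
proof (rule ccontr)
  let ?h = "L (Suc d)" and ?z = "centre Q" and ?z' = "centre Q'"
  assume ne: "\<bar>?z $ i - ?z' $ i\<bar> \<noteq> ?h / 2"
  have h: "0 < ?h" by (rule L_pos)
  have cQ: "cube ?z ?h Q" and cQ': "cube ?z' (2 * ?h) Q'"
    using cube_centre[OF Q(1)] cube_centre[OF Q(2)] L_Suc[of d] by auto
  have le: "\<bar>?z $ j - ?z' $ j\<bar> \<le> ?h / 2" for j
    using cube_subset_centres[OF cQ cQ' Q(3), of j] by simp
  have i: "\<bar>?z $ i - ?z' $ i\<bar> < ?h / 2" using le[of i] ne by simp
  then have i12: "?z $ i - ?z' $ i < ?h / 2" "- (?h / 2) < ?z $ i - ?z' $ i" by linarith+
  \<comment> \<open>The centre of \<open>Q\<close>, with its i-th coordinate moved to the middle of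
    the slab between the lower faces of \<open>Q\<close> and \<open>Q'\<close>.\<close>
  define y where "y = (\<chi> j. if j = i then ((?z $ i - ?h / 2) + (?z' $ i - ?h)) / 2 else ?z $ j)"
  have yi: "y $ i = ((?z $ i - ?h / 2) + (?z' $ i - ?h)) / 2" and yj: "j \<noteq> i \<Longrightarrow> y $ j = ?z $ j" for j
    by (auto simp: y_def)
  have yQ': "y \<in> Q'"
  proof (rule cube_interiorI[OF cQ'])
    fix j show "\<bar>y $ j - ?z' $ j\<bar> < 2 * ?h / 2"
    proof (cases "j = i")
      case True
      from i12 have "y $ i - ?z' $ i < ?h" "- ?h < y $ i - ?z' $ i"
        using yi h by (simp_all add: field_simps)
      then have "\<bar>y $ i - ?z' $ i\<bar> < ?h" by linarith
      then show ?thesis using True by simp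
    next
      case False
      then show ?thesis using yj[of j] le[of j] h by linarith
    qed
  qed
  then obtain S where S: "S \<in> P (Suc d)" "y \<in> S"
    using P_cover[of y "Suc d"] P_subset[OF Q(2)] by blast
  obtain S' where S': "S' \<in> P d" "S \<subseteq> S'" using parent[OF S(1)] by blast
  have "S' = Q'" using P_disjoint[OF S'(1) Q(2), of y] S(2) S'(2) yQ' by blast
  let ?s = "centre S"
  have cS: "cube ?s ?h S" using cube_centre[OF S(1)] .
  have sle: "\<bar>?s $ j - ?z' $ j\<bar> \<le> ?h / 2" for j
    using cube_subset_centres[OF cS cQ', of j] S' \<open>S' = Q'\<close> by simp
  have ys: "\<bar>y $ j - ?s $ j\<bar> \<le> ?h / 2" for j using cubeD[OF cS S(2)] .
  \<comment> \<open>\<open>S\<close> fits into \<open>Q'\<close> and contains \<open>y\<close>, so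
    its centre is less than one side away from that of \<open>Q\<close> in every coordinate. The
    midpoint of the two centres is then interior to both cubes.\<close>
  have close: "\<bar>?s $ j - ?z $ j\<bar> < ?h" for j
  proof (cases "j = i")
    case True
    have "?s $ i - y $ i \<le> ?h / 2" "?z' $ i - ?s $ i \<le> ?h / 2"
      using ys[of i] sle[of i] by linarith+
    then have "?z $ i - ?s $ i < ?h" "?s $ i - ?z $ i < 0"
      using i12 yi h by (simp_all add: field_simps)
    then show ?thesis unfolding True by linarith
  next
    case False
    then show ?thesis using ys[of j] yj[of j] h by linarith
  qed
  define x where "x = (\<chi> j. (?s $ j + ?z $ j) / 2)"
  have x: "x $ j = (?s $ j + ?z $ j) / 2" for j by (simp add: x_def)
  have "x \<in> Q" 
  proof (rule cube_interiorI[OF cQ])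
    fix j
    have "x $ j - ?z $ j = (?s $ j - ?z $ j) / 2" using x[of j] by (simp add: field_simps)
    then show "\<bar>x $ j - ?z $ j\<bar> < ?h / 2" using close[of j] by (simp add: divide_strict_right_mono)
  qed
  moreover have "x \<in> S" 
  proof (rule cube_interiorI[OF cS])
    fix j
    have "x $ j - ?s $ j = (?z $ j - ?s $ j) / 2" using x[of j] by (simp add: field_simps)
    then show "\<bar>x $ j - ?s $ j\<bar> < ?h / 2"
      using close[of j] by (simp add: divide_strict_right_mono abs_minus_commute)
  qed
  ultimately have "S = Q" using P_disjoint[OF S(1) Q(1), of x] by blast
  \<comment> \<open>Now \<open>y\<close> would lie in \<open>Q\<close>, although its i-th coordinate
    is below the lower face of \<open>Q\<close>.\<close>
  then have "\<bar>y $ i - ?z $ i\<bar> \<le> ?h / 2" using ys[of i] by simp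
  then have "?z $ i - y $ i \<le> ?h / 2" by linarith
  then show False using yi i12 by (simp add: field_simps)
qed

text \<open>The offset of a child from its parent is plus or minus half the side of the child, so
  two such offsets differ by 0 or by one side; the parents contribute an even multiple of that
  side.\<close>

lemma aligned:
  assumes "Q \<in> P d" "R \<in> P d"
  shows "\<exists>k::int. centre Q $ i - centre R $ i = k * L d"
  using assms
proof (induction d arbitrary: Q R)
  case 0
  then have "centre Q $ i - centre R $ i = real_of_int 0 * L 0" by (simp add: root)
  then show ?case by blast
next
  case (Suc d)
  obtain Q' R' where Q': "Q' \<in> P d" "Q \<subseteq> Q'" and R': "R' \<in> P d" "R \<subseteq> R'"
    using parent[OF Suc.prems(1)] parent[OF Suc.prems(2)] by blast
  obtain k :: int where k: "centre Q' $ i - centre R' $ i = k * L d" using Suc.IH[OF Q'(1) R'(1)] by blast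
  have a: "\<bar>centre Q $ i - centre Q' $ i\<bar> = L (Suc d) / 2" "\<bar>centre R $ i - centre R' $ i\<bar> = L (Suc d) / 2"
    by (rule child_centre[OF Suc.prems(1) Q'], rule child_centre[OF Suc.prems(2) R'])
  define X where "X = real_of_int k * L (Suc d)"
  have X: "centre Q' $ i - centre R' $ i = 2 * X" using k by (simp add: X_def L_Suc[of d])
  have "real_of_int (2 * k) * L (Suc d) = 2 * X" "real_of_int (2 * k + 1) * L (Suc d) = 2 * X + L (Suc d)"
    "real_of_int (2 * k - 1) * L (Suc d) = 2 * X - L (Suc d)"
    by (simp_all add: X_def algebra_simps)
  then have "centre Q $ i - centre R $ i = real_of_int (2 * k) * L (Suc d)
      \<or> centre Q $ i - centre R $ i = real_of_int (2 * k + 1) * L (Suc d)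
      \<or> centre Q $ i - centre R $ i = real_of_int (2 * k - 1) * L (Suc d)"
    using a X by linarith
  then show ?case by blast
qed

text \<open>Alignment leaves nothing strictly between \<open>L d\<close> and \<open>2 * L d\<close>:
  an integer multiple of the side that exceeds the side is at least twice the side. Non-neighbours
  are therefore a full side apart in some coordinate.\<close>

lemma not_nbD:
  assumes "Q \<in> P d" "R \<in> P d" "\<not> nb R Q"
  shows "\<exists>i. 2 * L d \<le> \<bar>centre R $ i - centre Q $ i\<bar>"
proof -
  obtain i where i: "L d < \<bar>centre R $ i - centre Q $ i\<bar>"
    using assms(3) nb_cube_iff[OF cube_centre[OF assms(2)] cube_centre[OF assms(1)]] by (auto simp: not_le)
  obtain k :: int where k: "centre R $ i - centre Q $ i = k * L d"
    using aligned[OF assms(2,1)] by blast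
  have "\<bar>centre R $ i - centre Q $ i\<bar> = real_of_int \<bar>k\<bar> * L d"
    using L_pos[of d] by (simp add: k abs_mult)
  moreover have "1 < \<bar>k\<bar>"
  proof (rule ccontr)
    assume "\<not> 1 < \<bar>k\<bar>"
    then have "real_of_int \<bar>k\<bar> * L d \<le> 1 * L d"
      using L_pos[of d] by (intro mult_right_mono) auto
    with calculation i show False by simp
  qed
  then have "2 * L d \<le> real_of_int \<bar>k\<bar> * L d"
    using L_pos[of d] by (intro mult_right_mono) auto
  ultimately show ?thesis by (auto intro: exI[of _ i])
qed

definition near :: "nat \<Rightarrow> (real ^ 'n) set \<Rightarrow> (real ^ 'n) set set" where
  "near d Q = {R \<in> P d. nb R Q}"

text \<open>The Whitney decomposition off the diagonal: pairs that separate in this generation while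
  their parents still touch.\<close>

definition far :: "nat \<Rightarrow> (real ^ 'n) set \<Rightarrow> (real ^ 'n) set set" where
  "far d Q = {R \<in> P (Suc d). \<not> nb R Q \<and> (\<exists>Q'\<in>P d. \<exists>R'\<in>P d. Q \<subseteq> Q' \<and> R \<subseteq> R' \<and> nb R' Q')}"

lemma near_root: "\<Union> (near 0 Q0) = Q0"
  using centre_in_cube[OF cube_centre[of Q0 0]] closure_subset[of Q0]
  by (auto simp: near_def root nb_def)

lemma finite_near: "finite (near d Q)" and finite_far: "finite (far d Q)"
  using finite_P by (auto simp: near_def far_def)

text \<open>The recursion behind the spatial telescoping. A child of a neighbour of
  \<open>Q'\<close> is either a neighbour of \<open>Q\<close> or, by definition, far from it;
  conversely, neighbours have neighbouring parents.\<close>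

lemma near_parent_eq:
  assumes Q: "Q \<in> P (Suc d)" "Q' \<in> P d" "Q \<subseteq> Q'"
  shows "\<Union> (near d Q') = \<Union> (near (Suc d) Q) \<union> \<Union> (far d Q)" (is "?l = ?r")
proof (rule antisym)
  obtain q where q: "q \<in> Q" using centre_in_cube[OF cube_centre[OF Q(1)]] by blast
  show "?l \<subseteq> ?r"
  proof
    fix x assume "x \<in> ?l"
    then obtain R' where R': "R' \<in> P d" "nb R' Q'" "x \<in> R'" by (auto simp: near_def)
    obtain R where R: "R \<in> P (Suc d)" "x \<in> R" using P_cover P_subset R' by blast
    obtain S where S: "S \<in> P d" "R \<subseteq> S" using parent R by blast
    then have "S = R'" using P_disjoint R' R by blast
    then have "\<not> nb R Q \<Longrightarrow> R \<in> far d Q" "nb R Q \<Longrightarrow> R \<in> near (Suc d) Q"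
      using R(1) R'(1,2) S(2) Q unfolding far_def near_def by blast+
    then show "x \<in> ?r" using R(2) by blast
  qed
  show "?r \<subseteq> ?l"
  proof
    fix x assume "x \<in> ?r"
    then consider R where "R \<in> P (Suc d)" "x \<in> R" "nb R Q"
      | R R' S where "x \<in> R" "R \<subseteq> R'" "R' \<in> P d" "S \<in> P d" "Q \<subseteq> S" "nb R' S"
      by (auto simp: near_def far_def)
    then show "x \<in> ?l"
    proof cases
      case 1
      obtain R' where "R' \<in> P d" "R \<subseteq> R'" using parent 1 by blast
      then show ?thesis using 1 Q nb_mono[of R Q R' Q'] by (auto simp: near_def)
    next
      case 2
      then have "S = Q'" using P_disjoint[of S d Q' q] Q q by blast
      then show ?thesis using 2 by (auto simp: near_def)
    qed
  qed
qed

lemma near_far_disjoint: "\<Union> (near (Suc d) Q) \<inter> \<Union> (far d Q) = {}"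
proof (rule ccontr)
  assume "\<not> ?thesis"
  then obtain x R S where "R \<in> near (Suc d) Q" "S \<in> far d Q" "x \<in> R" "x \<in> S" by blast
  then show False using P_disjoint[of R "Suc d" S x] by (auto simp: near_def far_def)
qed

text \<open>Let h be the side of \<open>Q\<close>. In each coordinate a point of a far cube is at
  most h + 2 h + h / 2 away from the centre of \<open>Q\<close>: half a parent, the step between the
  parents, and the offset of \<open>Q\<close> in its parent. Rounding up to 4 h gives a cube of side
  8 h, hence the base 8.\<close>

lemma card_far:
  assumes "Q \<in> P (Suc d)"
  shows "card (far d Q) \<le> 8 ^ CARD('n)"
proof -
  let ?h = "L (Suc d)"
  have "finite (far d Q) \<and> card (far d Q) \<le> 8 ^ CARD('n)"
  proof (rule card_disjoint_cubes)
    show "disjoint (far d Q)"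
      using part[of "Suc d"] by (auto simp: partition_on_def disjoint_def far_def)
    show "R \<subseteq> ccube (centre Q) (real 8 * ?h)" if far: "R \<in> far d Q" for R
    proof
      fix x assume x: "x \<in> R"
      obtain Q' R' where h: "Q' \<in> P d" "R' \<in> P d" "Q \<subseteq> Q'" "R \<subseteq> R'" "nb R' Q'"
        using far by (auto simp: far_def)
      have "\<bar>x $ i - centre Q $ i\<bar> \<le> real 8 * ?h / 2" for i
      proof -
        have "\<bar>x $ i - centre R' $ i\<bar> \<le> L d / 2"
          using cubeD[OF cube_centre[OF h(2)]] x h(4) by blast
        moreover have "\<bar>centre R' $ i - centre Q' $ i\<bar> \<le> L d"
          using nb_cube_iff[OF cube_centre[OF h(2)] cube_centre[OF h(1)]] h(5) by blast
        ultimately have "\<bar>x $ i - centre Q $ i\<bar> \<le> 4 * ?h"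
          using child_centre[OF assms h(1,3), of i] L_Suc[of d] L_pos[of "Suc d"] by linarith
        then show ?thesis by simp
      qed
      then show "x \<in> ccube (centre Q) (real 8 * ?h)" by (simp add: ccube_def)
    qed
  qed (use cubes L_pos in \<open>auto simp: far_def\<close>)
  then show ?thesis ..
qed

text \<open>Both cubes lie in two neighbouring cubes of side 2 h, which together span at most 4 h in
  each coordinate. The lower bounds come from a coordinate in which the centres are 2 h apart: half
  a side removed at either end leaves h.\<close>

lemma far_geometry:
  assumes Q: "Q \<in> P (Suc d)" and R: "R \<in> far d Q"
  defines "h \<equiv> L (Suc d)"
  shows "\<And>x y. x \<in> Q \<Longrightarrow> y \<in> R \<Longrightarrow> dist x y \<le> 4 * sqrt (real CARD('n)) * h"
    "h \<le> setdist R Q" "setdist R Q \<le> 4 * sqrt (real CARD('n)) * h"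
    "2 * h \<le> diameter (R \<union> Q)" "diameter (R \<union> Q) \<le> 4 * sqrt (real CARD('n)) * h"
proof -
  have h: "0 < h" by (simp add: h_def L_pos)
  have RP: "R \<in> P (Suc d)" "\<not> nb R Q" using R by (auto simp: far_def)
  obtain Q' R' where p: "Q' \<in> P d" "R' \<in> P d" "Q \<subseteq> Q'" "R \<subseteq> R'" "nb R' Q'"
    using R by (auto simp: far_def)
  have cQ: "cube (centre Q) h Q" and cR: "cube (centre R) h R"
    using cube_centre[OF Q] cube_centre[OF RP(1)] by (auto simp: h_def)
  have cQ': "cube (centre Q') (2 * h) Q'" and cR': "cube (centre R') (2 * h) R'"
    using cube_centre[OF p(1)] cube_centre[OF p(2)] L_Suc[of d] by (auto simp: h_def)
  have zz: "\<bar>centre R' $ i - centre Q' $ i\<bar> \<le> 2 * h" for i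
    using p(5) nb_cube_iff[OF cR' cQ'] by simp
  have dist: "dist x y \<le> 4 * sqrt (real CARD('n)) * h" if "x \<in> R \<union> Q" "y \<in> R \<union> Q" for x y
  proof -
    have "x \<in> R' \<or> x \<in> Q'" "y \<in> R' \<or> y \<in> Q'" using that p by auto
    then have xy: "\<bar>x $ i - centre R' $ i\<bar> \<le> h \<or> \<bar>x $ i - centre Q' $ i\<bar> \<le> h"
      "\<bar>y $ i - centre R' $ i\<bar> \<le> h \<or> \<bar>y $ i - centre Q' $ i\<bar> \<le> h" for i
      using cubeD[OF cR', of x i] cubeD[OF cQ', of x i] cubeD[OF cR', of y i] cubeD[OF cQ', of y i] by auto
    have "\<bar>(x - y) $ i\<bar> \<le> 4 * h" for i
      using xy[of i] zz[of i] h unfolding vector_minus_component by (smt (verit))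
    then have "norm (x - y) \<le> sqrt (real CARD('n)) * (4 * h)"
      using h by (intro norm_le_sqrt_card) auto
    then show ?thesis by (simp add: dist_norm mult_ac)
  qed
  show "dist x y \<le> 4 * sqrt (real CARD('n)) * h" if "x \<in> Q" "y \<in> R" for x y
    using dist that by auto
  have ne: "centre R \<in> R" "centre Q \<in> Q" using cR cQ centre_in_cube by auto
  obtain i where i: "2 * h \<le> \<bar>centre R $ i - centre Q $ i\<bar>"
    using not_nbD[OF Q RP] by (auto simp: h_def)
  show "h \<le> setdist R Q"
  proof (rule le_setdistI)
    fix x y assume "x \<in> R" "y \<in> Q"
    then have "h \<le> \<bar>(x - y) $ i\<bar>"
      using cubeD[OF cR, of x i] cubeD[OF cQ, of y i] i by simp
    also have "\<dots> \<le> dist x y" unfolding dist_norm by (rule component_le_norm_cart)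
    finally show "h \<le> dist x y" .
  qed (use ne in auto)
  show "setdist R Q \<le> 4 * sqrt (real CARD('n)) * h"
    using setdist_le_dist[OF ne] dist[of "centre R" "centre Q"] ne by auto
  have b: "bounded (R \<union> Q)" using cR cQ bounded_cube by auto
  have "2 * h \<le> \<bar>(centre R - centre Q) $ i\<bar>" using i by simp
  also have "\<dots> \<le> dist (centre R) (centre Q)" unfolding dist_norm by (rule component_le_norm_cart)
  also have "\<dots> \<le> diameter (R \<union> Q)" using b ne by (intro diameter_bounded_bound) auto
  finally show "2 * h \<le> diameter (R \<union> Q)" .
  show "diameter (R \<union> Q) \<le> 4 * sqrt (real CARD('n)) * h"
    using dist ne by (intro diameter_le) (auto simp: dist_norm)
qed

text \<open>An inclusion and not an equality: next to the boundary of the root some neighbours are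
  missing, so the union need not be a cube.\<close>

lemma near_subset: "Q \<in> P d \<Longrightarrow> \<Union> (near d Q) \<subseteq> ccube (centre Q) (3 * L d)"
proof
  fix x assume Q: "Q \<in> P d" and "x \<in> \<Union> (near d Q)"
  then obtain R where R: "R \<in> P d" "nb R Q" "x \<in> R" by (auto simp: near_def)
  have "\<bar>x $ i - centre Q $ i\<bar> \<le> 3 * L d / 2" for i
    using cubeD[OF cube_centre[OF R(1)] R(3), of i]
      nb_cube_iff[OF cube_centre[OF R(1)] cube_centre[OF Q], THEN iffD1, OF R(2), rule_format, of i]
    by linarith
  then show "x \<in> ccube (centre Q) (3 * L d)" by (simp add: ccube_def)
qed

end

text \<open>Bounds (i) and (ii) speak of cubes, so the union of the neighbours of \<open>Q\<close>
  is replaced by the closed cube of three times its side.\<close>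

lemma near_geometry:
  fixes Q :: "(real ^ 'n) set"
  assumes Q: "cube z h Q"
  defines "E \<equiv> ccube z (3 * h)"
  shows "Q \<subseteq> E" "\<And>x y. x \<in> Q \<Longrightarrow> y \<in> E \<Longrightarrow> dist x y \<le> 4 * sqrt (real CARD('n)) * h"
    "3 * h \<le> diameter E" "diameter E \<le> 3 * sqrt (real CARD('n)) * h"
proof -
  have h: "0 < h" using Q by (rule cube_pos)
  have "ccube z h \<subseteq> E" unfolding E_def using h by (subst ccube_subset_iff) auto
  then have QE: "Q \<subseteq> E" using cube_subset_ccube[OF Q] by blast
  then show "Q \<subseteq> E" .
  have dist: "dist x y \<le> 3 * sqrt (real CARD('n)) * h" if "x \<in> E" "y \<in> E" for x y
  proof -
    have a: "\<bar>x $ i - z $ i\<bar> \<le> 3 * h / 2" "\<bar>y $ i - z $ i\<bar> \<le> 3 * h / 2" for i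
      using that by (auto simp: E_def ccube_def)
    have "\<bar>(x - y) $ i\<bar> \<le> 3 * h" for i
      using a[of i] unfolding vector_minus_component by linarith
    then have "norm (x - y) \<le> sqrt (real CARD('n)) * (3 * h)"
      using h by (intro norm_le_sqrt_card) auto
    then show ?thesis by (simp add: dist_norm mult_ac)
  qed
  show "dist x y \<le> 4 * sqrt (real CARD('n)) * h" if "x \<in> Q" "y \<in> E" for x y
  proof -
    have "dist x y \<le> 3 * sqrt (real CARD('n)) * h" using dist that QE by auto
    also have "\<dots> \<le> 4 * sqrt (real CARD('n)) * h" using h by (intro mult_right_mono) auto
    finally show ?thesis .
  qed
  let ?a = "\<chi> i. z $ i + 3 * h / 2" and ?b = "\<chi> i. z $ i - 3 * h / 2"
  have E: "?a \<in> E" "?b \<in> E"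
    using h by (auto simp: E_def ccube_def)
  fix i :: 'n
  have "3 * h \<le> \<bar>(?a - ?b) $ i\<bar>" by simp
  also have "\<dots> \<le> dist ?a ?b" unfolding dist_norm by (rule component_le_norm_cart)
  also have "\<dots> \<le> diameter E"
    using E by (intro diameter_bounded_bound) (auto simp: E_def ccube_eq_cbox)
  finally show "3 * h \<le> diameter E" .
  show "diameter E \<le> 3 * sqrt (real CARD('n)) * h"
    using dist E by (intro diameter_le) (auto simp: dist_norm)
qed

text \<open>The root is made to contain a closed cube of side at least \<open>l\<close> together
  with \<open>B\<close>, which forces its own side up to \<open>l\<close>. The maximum with 1 keeps
  the auxiliary side positive.\<close>

lemma dyadic_system_tree:
  fixes \<D> :: "(real ^ 'n) set set"
  assumes "dyadic_system \<D>" "bounded B"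
  obtains P Q0 L where "dyadic_tree P Q0 L" "\<And>d. P d \<subseteq> \<D>" "B \<subseteq> Q0" "l \<le> L 0"
proof -
  obtain D :: "int \<Rightarrow> (real ^ 'n) set set" where D: "\<D> = (\<Union>j. D j)"
    and props: "\<forall>j. partition_on UNIV (D j) \<and> (\<forall>Q\<in>D j. \<exists>z. cube z (2 powi (- j)) Q) \<and>
      (\<forall>Q\<in>D (j + 1). \<exists>Q'\<in>D j. Q \<subseteq> Q')"
    and big: "\<forall>B. bounded B \<longrightarrow> (\<exists>Q\<in>\<D>. B \<subseteq> Q)"
    using assms(1) unfolding dyadic_system_def by (elim conjE exE) (rule that)
  have part: "partition_on UNIV (D j)" for j using props by simp
  have cubes: "\<exists>z. cube z (2 powi (- j)) Q" if "Q \<in> D j" for j Q using props that by blast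
  have par: "\<exists>Q'\<in>D j. Q \<subseteq> Q'" if "Q \<in> D (j + 1)" for j Q using props that by blast
  let ?l = "max l 1"
  have "bounded (B \<union> ccube 0 ?l)" using assms(2) by (simp add: ccube_eq_cbox)
  then obtain Q1 where "Q1 \<in> \<D>" "B \<union> ccube 0 ?l \<subseteq> Q1" using big by blast
  then obtain Q0 j where Q0: "B \<subseteq> Q0" "ccube 0 ?l \<subseteq> Q0" "Q0 \<in> D j"
    using D by blast
  obtain z where z: "cube z (2 powi (- j)) Q0" using cubes Q0 by blast
  fix i0 :: 'n
  have "\<bar>(0 :: real ^ 'n) $ i0 - z $ i0\<bar> \<le> 2 powi (- j) / 2 - ?l / 2"
    by (rule cube_subset_centres[OF cube_ccube z Q0(2)]) simp
  then have l: "l \<le> 2 powi (- j)" by linarith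
  define P where "P d = {Q \<in> D (j + int d). Q \<subseteq> Q0}" for d
  define L where "L d = (2 :: real) powi (- (j + int d))" for d
  have Suc_int: "j + int (Suc d) = (j + int d) + 1" for d by simp
  have anc: "\<exists>Q'\<in>D j. Q \<subseteq> Q'" if "Q \<in> D (j + int d)" for Q d
    using that
  proof (induction d arbitrary: Q)
    case (Suc d)
    then have "Q \<in> D ((j + int d) + 1)" by (simp only: Suc_int)
    then obtain Q' where Q': "Q' \<in> D (j + int d)" "Q \<subseteq> Q'"
      using par by blast
    show ?case using Suc.IH[OF Q'(1)] Q'(2) by blast
  qed auto
  have uniq: "Q = R" if "Q \<in> D k" "R \<in> D k" "x \<in> Q" "x \<in> R" for Q R x k
    using part[of k] that by (auto simp: partition_on_def disjoint_def)
  \<comment> \<open>A finer cube with one point in the root has an ancestor of the root's generation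
    through that point, and this ancestor is the root.\<close>
  have sub: "Q \<subseteq> Q0" if Qx: "Q \<in> D (j + int d)" "x \<in> Q" "x \<in> Q0" for Q x d
  proof -
    obtain Q' where Q': "Q' \<in> D j" "Q \<subseteq> Q'" using anc[OF Qx(1)] by blast
    then have "Q' = Q0" using uniq[OF Q'(1) Q0(3), of x] Qx by blast
    with Q' show ?thesis by blast
  qed
  have ne: "Q \<noteq> {}" if "Q \<in> D k" for Q k
    using part[of k] that by (auto simp: partition_on_def)
  have cov: "\<exists>Q\<in>D k. x \<in> Q" for x k
    using part[of k] by (auto simp: partition_on_def)
  have tree: "dyadic_tree P Q0 L"
  proof
    show "0 < L d" for d by (simp add: L_def)
    show "L d = 2 * L (Suc d)" for d
    proof -
      have "L d = 2 powi (1 + (- (j + int (Suc d))))"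
        unfolding L_def by (rule arg_cong) simp
      also have "\<dots> = 2 powi 1 * L (Suc d)"
        unfolding L_def by (rule power_int_add) simp
      finally show ?thesis by simp
    qed
    show "P 0 = {Q0}"
    proof -
      have "Q = Q0" if "Q \<in> D j" "Q \<subseteq> Q0" for Q
        using ne[OF that(1)] uniq[OF that(1) Q0(3)] that(2) by blast
      then show ?thesis using Q0(3) by (auto simp: P_def)
    qed
    show "partition_on Q0 (P d)" for d
    proof (rule partition_onI)
      show "\<Union> (P d) = Q0"
      proof (intro equalityI subsetI)
        fix x assume x: "x \<in> Q0"
        obtain Q where "Q \<in> D (j + int d)" "x \<in> Q" using cov by blast
        then show "x \<in> \<Union> (P d)" using sub[of Q d x] x by (auto simp: P_def)
      qed (auto simp: P_def)
      show "disjnt p q" if "p \<in> P d" "q \<in> P d" "p \<noteq> q" for p q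
        using that uniq[of p _ q] by (auto simp: P_def disjnt_iff)
      show "{} \<notin> P d" using ne by (auto simp: P_def)
    qed
    show "\<exists>z. cube z (L d) Q" if "Q \<in> P d" for Q d
      using that cubes[of Q "j + int d"] unfolding P_def L_def by blast
    show "\<exists>Q'\<in>P d. Q \<subseteq> Q'" if "Q \<in> P (Suc d)" for Q d
    proof -
      have Q: "Q \<in> D ((j + int d) + 1)" "Q \<subseteq> Q0" using that unfolding P_def Suc_int by auto
      obtain Q' where Q': "Q' \<in> D (j + int d)" "Q \<subseteq> Q'" using par[OF Q(1)] by blast
      obtain x where "x \<in> Q" using ne[OF Q(1)] by blast
      then have "Q' \<subseteq> Q0" using sub[OF Q'(1), of x] Q(2) Q'(2) by blast
      with Q' show ?thesis unfolding P_def by blast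
    qed
  qed
  show ?thesis
  proof (rule that[OF tree])
    show "P d \<subseteq> \<D>" for d unfolding P_def D by blast
    show "B \<subseteq> Q0" by (rule Q0)
    show "l \<le> L 0" using l by (simp add: L_def)
  qed
qed

section \<open>Estimates on separated rectangles\<close>

text \<open>Exponents of either sign occur below. The sum a^e + b^e dominates the values at both
  ends and serves both signs.\<close>

lemma powr_comparable:
  fixes a b e :: real
  assumes "0 < a" "0 < b"
  shows "\<exists>K>0. \<forall>x y. 0 < y \<longrightarrow> a * y \<le> x \<longrightarrow> x \<le> b * y \<longrightarrow> x powr e \<le> K * y powr e"
proof (intro exI[of _ "a powr e + b powr e"] conjI allI impI)
  show "0 < a powr e + b powr e" using assms by (simp add: add_pos_pos)
  fix x y :: real assume h: "0 < y" "a * y \<le> x" "x \<le> b * y"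
  have x: "0 < x" using h assms by (smt (verit) mult_pos_pos)
  have "x powr e \<le> max ((a * y) powr e) ((b * y) powr e)"
  proof (cases "0 \<le> e")
    case True
    then have "x powr e \<le> (b * y) powr e" using h x by (intro powr_mono2) auto
    then show ?thesis by simp
  next
    case False
    then have "x powr e \<le> (a * y) powr e" using h x assms by (intro powr_mono2') auto
    then show ?thesis by simp
  qed
  also have "\<dots> \<le> (a * y) powr e + (b * y) powr e" by simp
  also have "\<dots> = (a powr e + b powr e) * y powr e"
    using h assms by (simp add: powr_mult algebra_simps)
  finally show "x powr e \<le> (a powr e + b powr e) * y powr e" .
qed

lemma powr_dyadic_mult: "0 < Z \<Longrightarrow> (2 ^ l * Z) powr e = 2 powr (real l * e) * Z powr e"
  for Z :: real
  by (simp add: powr_mult powr_realpow[symmetric] powr_powr)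

lemma setdist_bounds:
  fixes A B :: "'a::metric_space set"
  assumes "x \<in> A" "y \<in> B" "\<And>x y. x \<in> A \<Longrightarrow> y \<in> B \<Longrightarrow> a \<le> dist x y" "dist x y \<le> b"
  shows "a \<le> setdist A B \<and> setdist A B \<le> b"
  using assms setdist_le_dist[OF assms(1,2)] by (auto intro!: le_setdistI)

section \<open>The operator, its constants and the time windows\<close>

locale singular =
  fixes T :: "(real \<times> (real ^ 'n) \<Rightarrow> complex) \<Rightarrow> (real \<times> (real ^ 'n) \<Rightarrow> complex)"
    and r ut ux vt vx :: ennreal and c \<kappa> M m n :: real
  assumes card: "n = real CARD('n)" and c: "0 < c" "c \<le> 1 / (16 * sqrt n)"
    and exps: "1 \<le> r" "1 \<le> ut" "1 \<le> ux" "1 \<le> vt" "1 \<le> vx" and m: "1 \<le> m"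
    and sing: "singular_operator c \<kappa> m r (ut, ux) (vt, vx) M T"
begin

definition q :: real where "q = 2 powr (- m)"

lemma q_bounds: "0 < q" "q \<le> 1 / 2"
proof -
  have "2 powr (- m) \<le> 2 powr (- 1 :: real)" using m by (intro powr_mono) auto
  then show "0 < q" "q \<le> 1 / 2" by (auto simp: q_def powr_minus inverse_eq_divide)
qed

lemma n_ge_1: "1 \<le> n" "1 \<le> sqrt n"
  using zero_less_card_finite[where 'a = 'n] by (auto simp: card Suc_leI simp del: zero_less_card_finite)

lemma c_sqrt: "c * sqrt n \<le> 1 / 16"
  using c n_ge_1 by (simp add: field_simps)

lemma c_le: "c \<le> 1 / 16"
proof -
  have "c * 1 \<le> c * sqrt n" using c n_ge_1 by (intro mult_left_mono) auto
  with c_sqrt show ?thesis by simp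
qed

text \<open>1/16 = 2^-4 supplies four factors of \<open>q\<close>. They are spent in
  \<open>windows\<close>: the box above a window reaches up to \<tau> / q^2, the sources of
  comparable time reach down to q^2 \<tau>, and the ratio is q^4.\<close>

lemma c_powr: "c powr m \<le> q ^ 4"
proof -
  have "c powr m \<le> (1 / 16) powr m" using c c_le m by (intro powr_mono2) auto
  also have "(1 / 16 :: real) = 2 powr (- 4)" by (simp add: powr_minus powr_numeral)
  also have "(2 powr (- 4)) powr m = q ^ 4"
    by (simp add: q_def powr_powr powr_realpow[symmetric] mult.commute)
  finally show ?thesis .
qed

lemma q_powers: "q ^ 2 \<le> q / 2" "q ^ 3 \<le> q ^ 2 / 2" "q ^ 4 \<le> q ^ 3 / 2" "q\<^sup>2 \<le> 1 / 4" "q ^ 4 \<le> q\<^sup>2" "q ^ 4 \<le> q ^ 3"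
proof -
  show a: "q ^ 2 \<le> q / 2" using q_bounds mult_left_mono[of "q" "1 / 2" "q"] by (simp add: power2_eq_square)
  show b: "q ^ 3 \<le> q ^ 2 / 2" using q_bounds mult_left_mono[of "q" "1 / 2" "q ^ 2"] by (simp add: power2_eq_square power3_eq_cube)
  show c: "q ^ 4 \<le> q ^ 3 / 2" using q_bounds mult_left_mono[of "q" "1 / 2" "q ^ 3"] by (simp add: power3_eq_cube power4_eq_xxxx)
  show "q\<^sup>2 \<le> 1 / 4" using a q_bounds by linarith
  show "q ^ 4 \<le> q\<^sup>2" using b c q_bounds by (smt (verit) zero_le_power field_sum_of_halves)
  show "q ^ 4 \<le> q ^ 3" using c q_bounds by (smt (verit) zero_le_power field_sum_of_halves)
qed

text \<open>
  Here \<open>\<tau> = Z\<^sup>m\<close> is the time scale belonging to the length \<open>Z\<close>.  The windows are half open, so that they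
  partition the time axis exactly.
\<close>

definition whit :: "real \<Rightarrow> real set" where "whit \<tau> = {q * \<tau><..\<tau>}"
definition early :: "real \<Rightarrow> real set" where "early \<tau> = {0<..q\<^sup>2 * \<tau>}"
text \<open>Joined to \<open>early\<close>, this covers all times up to \<tau> / q. Up to an
  endpoint it is the time factor of \<open>whitney_enl\<close>, which dictates the two powers of
  \<open>q\<close>.\<close>

definition broad :: "real \<Rightarrow> real set" where "broad \<tau> = {q\<^sup>2 * \<tau><..\<tau> / q}"

definition A where "A = M + bracket ut vt - \<kappa>"

text \<open>Target form of the operator norms between rectangles of duration comparable to Z^m at
  spatial scale 2^l Z: a scaling factor times the decay 2^(-l m A). Bound (ii) is the case l = 0
  with (a, b) = (u_t, v_t), bound (iii) has the same exponents for general l, and (iv) has a = b =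
  r, so that the time bracket vanishes.\<close>

definition kbound :: "ennreal \<Rightarrow> ennreal \<Rightarrow> real \<Rightarrow> nat \<Rightarrow> real" where
  "kbound a b Z l = Z powr (m * \<kappa> - m * bracket a b) * (2 ^ l * Z) powr (- n * bracket ux vx)
     * 2 powr (- (real l * m * A))"

lemma kbound_eq: "0 < Z \<Longrightarrow> kbound a b Z l = 2 powr (- (real l * n * bracket ux vx) - real l * m * A)
    * Z powr (m * \<kappa> - m * bracket a b - n * bracket ux vx)"
  unfolding kbound_def powr_dyadic_mult powr_diff powr_minus_divide
  by (simp add: powr_dyadic_mult powr_minus_divide field_simps)

lemma rectangle_Ioc: "0 \<le> a \<Longrightarrow> a < b \<Longrightarrow> cube z l X \<Longrightarrow> rectangle {a<..b} X"
  unfolding rectangle_def by (auto simp: is_interval_oc)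

lemma q_time:
  assumes "0 < \<tau>"
  shows "q\<^sup>2 * \<tau> \<le> q / 2 * \<tau>" "q\<^sup>2 * \<tau> \<le> 1 / 4 * \<tau>" "q * \<tau> \<le> 1 / 2 * \<tau>" "0 < q\<^sup>2 * \<tau>" "0 < q * \<tau>"
  using mult_right_mono[OF q_powers(1)] mult_right_mono[OF q_powers(4)] mult_right_mono[OF q_bounds(2)] assms q_bounds by simp_all

lemma q_less_1: "q < 1" "q\<^sup>2 < 1"
  using q_bounds q_powers by auto

text \<open>The gap between the windows is at least q \<tau> - q^2 \<tau>, which is no less than q^2
  \<tau> because q \<le> 1/2.\<close>

lemma early_whit:
  assumes "0 < \<tau>"
  shows "ell_t (early \<tau>) (whit \<tau>) = \<tau>" "ell_t (whit \<tau>) (early \<tau>) = \<tau>"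
    "q\<^sup>2 * \<tau> \<le> setdist (early \<tau>) (whit \<tau>)" "setdist (early \<tau>) (whit \<tau>) \<le> 1 * \<tau>"
    "1 / 2 * \<tau> \<le> diameter (early \<tau> \<union> whit \<tau>)" "diameter (early \<tau> \<union> whit \<tau>) \<le> 1 * \<tau>"
    "c powr m * \<tau> \<le> setdist (early \<tau>) (whit \<tau>)"
    "\<And>X z l. cube z l X \<Longrightarrow> rectangle (early \<tau>) X" "\<And>X z l. cube z l X \<Longrightarrow> rectangle (whit \<tau>) X"
proof -
  note le = q_time[OF assms]
  have mem: "\<tau> \<in> whit \<tau>" "q\<^sup>2 * \<tau> \<in> early \<tau>"
    using le assms q_less_1 by (auto simp: whit_def early_def)
  have Sup: "Sup (early \<tau> \<union> whit \<tau>) = \<tau>"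
    using le assms mem by (intro cSup_eq_maximum) (auto simp: whit_def early_def)
  then show "ell_t (early \<tau>) (whit \<tau>) = \<tau>" "ell_t (whit \<tau>) (early \<tau>) = \<tau>"
    by (auto simp: ell_t_def Un_commute)
  have "q\<^sup>2 * \<tau> \<le> setdist (early \<tau>) (whit \<tau>) \<and> setdist (early \<tau>) (whit \<tau>) \<le> 1 * \<tau>"
  proof (rule setdist_bounds[OF mem(2,1)])
    show "q\<^sup>2 * \<tau> \<le> dist x y" if "x \<in> early \<tau>" "y \<in> whit \<tau>" for x y
      using that le by (auto simp: dist_real_def early_def whit_def)
    show "dist (q\<^sup>2 * \<tau>) \<tau> \<le> 1 * \<tau>" using le assms by (auto simp: dist_real_def)
  qed
  then show sd: "q\<^sup>2 * \<tau> \<le> setdist (early \<tau>) (whit \<tau>)" "setdist (early \<tau>) (whit \<tau>) \<le> 1 * \<tau>" by auto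
  have "c powr m * \<tau> \<le> q\<^sup>2 * \<tau>" using c_powr q_powers assms by (intro mult_right_mono) auto
  then show "c powr m * \<tau> \<le> setdist (early \<tau>) (whit \<tau>)" using sd by linarith
  have "1 / 2 * \<tau> \<le> \<tau> - q\<^sup>2 * \<tau>" using le assms by linarith
  also have "\<dots> \<le> dist (q\<^sup>2 * \<tau>) \<tau>" unfolding dist_real_def by linarith
  also have "\<dots> \<le> diameter (early \<tau> \<union> whit \<tau>)"
    using mem by (intro diameter_bounded_bound) (auto simp: early_def whit_def)
  finally show "1 / 2 * \<tau> \<le> diameter (early \<tau> \<union> whit \<tau>)" .
  show "diameter (early \<tau> \<union> whit \<tau>) \<le> 1 * \<tau>"
    using mem le assms by (intro diameter_le) (auto simp: early_def whit_def)
  show "rectangle (early \<tau>) X" "rectangle (whit \<tau>) X" if "cube z l X" for X z l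
    using that le assms q_less_1 unfolding early_def whit_def by (auto intro!: rectangle_Ioc)
qed

text \<open>For (i) the infimum must be at least c^m times the supremum. The ratio of q^2 \<tau> to
  \<tau> / q is q^3, and c^m <= q^4.\<close>

lemma broad_whit:
  assumes "0 < \<tau>"
  shows "ell_t (broad \<tau>) (whit \<tau>) = \<tau> / q" "ell_t (broad \<tau>) (broad \<tau>) = \<tau> / q"
    "1 / 2 * \<tau> \<le> diameter (broad \<tau> \<union> whit \<tau>)" "diameter (broad \<tau> \<union> whit \<tau>) \<le> 1 / q * \<tau>"
    "Inf (broad \<tau>) = q\<^sup>2 * \<tau>" "\<And>X z l. cube z l X \<Longrightarrow> rectangle (broad \<tau>) X" "whit \<tau> \<subseteq> broad \<tau>"
    "2 * \<tau> \<le> \<tau> / q" "c powr m * (\<tau> / q) \<le> q\<^sup>2 * \<tau>"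
proof -
  note le = q_time[OF assms]
  show big: "2 * \<tau> \<le> \<tau> / q" using le q_bounds assms by (simp add: field_simps)
  have mem: "\<tau> / q \<in> broad \<tau>" "\<tau> \<in> broad \<tau>"
    using le assms big q_less_1 by (auto simp: broad_def)
  show sub: "whit \<tau> \<subseteq> broad \<tau>" using le big assms by (auto simp: whit_def broad_def)
  have "Sup (broad \<tau>) = \<tau> / q" using le big assms by (auto simp: broad_def)
  then show "ell_t (broad \<tau>) (whit \<tau>) = \<tau> / q" "ell_t (broad \<tau>) (broad \<tau>) = \<tau> / q"
    using sub by (auto simp: ell_t_def Un_absorb2)
  show "Inf (broad \<tau>) = q\<^sup>2 * \<tau>" using le big assms by (auto simp: broad_def)
  have "1 / 2 * \<tau> \<le> \<tau> / q - \<tau>" using big assms by linarith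
  also have "\<dots> \<le> dist (\<tau> / q) \<tau>" unfolding dist_real_def by (rule abs_ge_self)
  also have "\<dots> \<le> diameter (broad \<tau>)"
    using mem by (intro diameter_bounded_bound) (auto simp: broad_def)
  finally show "1 / 2 * \<tau> \<le> diameter (broad \<tau> \<union> whit \<tau>)" using sub by (simp add: Un_absorb2)
  have "diameter (broad \<tau>) \<le> 1 / q * \<tau>"
    using mem le assms by (intro diameter_le) (auto simp: broad_def)
  then show "diameter (broad \<tau> \<union> whit \<tau>) \<le> 1 / q * \<tau>" using sub by (simp add: Un_absorb2)
  show "rectangle (broad \<tau>) X" if "cube z l X" for X z l
    using that le assms big unfolding broad_def by (auto intro!: rectangle_Ioc)
  have "c powr m * (\<tau> / q) \<le> q ^ 4 * (\<tau> / q)" using c_powr q_bounds assms by (intro mult_right_mono) auto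
  also have "\<dots> = q ^ 3 * \<tau>" using q_bounds by (simp add: power4_eq_xxxx power3_eq_cube)
  also have "\<dots> \<le> q\<^sup>2 * \<tau>" using q_powers q_bounds assms by (intro mult_right_mono) (auto intro: order_trans)
  finally show "c powr m * (\<tau> / q) \<le> q\<^sup>2 * \<tau>" .
qed

section \<open>The four operator bounds with a common constant\<close>

definition diagonal_bound :: "real \<Rightarrow> bool" where
  "diagonal_bound C \<longleftrightarrow> (\<forall>f\<in>Linf_c. \<forall>E\<^sub>t E\<^sub>x. rectangle E\<^sub>t E\<^sub>x \<longrightarrow>
     c * ell_x E\<^sub>x E\<^sub>x \<le> ell_t E\<^sub>t E\<^sub>t powr (1 / m) \<longrightarrow>
     ell_t E\<^sub>t E\<^sub>t powr (1 / m) \<le> ell_x E\<^sub>x E\<^sub>x \<longrightarrow>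
     c powr m * ell_t E\<^sub>t E\<^sub>t \<le> Inf E\<^sub>t \<longrightarrow>
     mixed_norm r r (cut (E\<^sub>t \<times> E\<^sub>x) (T (cut (E\<^sub>t \<times> E\<^sub>x) f)))
         \<le> ennreal (C * Inf E\<^sub>t powr \<kappa>) * mixed_norm r r (cut (E\<^sub>t \<times> E\<^sub>x) f))"

definition close_bound :: "real \<Rightarrow> bool" where
  "close_bound C \<longleftrightarrow> (\<forall>f\<in>Linf_c. \<forall>E\<^sub>t E\<^sub>x F\<^sub>t F\<^sub>x. rectangle E\<^sub>t E\<^sub>x \<longrightarrow>
     rectangle F\<^sub>t F\<^sub>x \<longrightarrow>
     c * ell_x E\<^sub>x F\<^sub>x \<le> ell_t E\<^sub>t F\<^sub>t powr (1 / m) \<longrightarrow>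
     ell_t E\<^sub>t F\<^sub>t powr (1 / m) \<le> ell_x E\<^sub>x F\<^sub>x \<longrightarrow>
     c powr m * ell_t E\<^sub>t F\<^sub>t \<le> setdist E\<^sub>t F\<^sub>t \<longrightarrow>
     mixed_norm vt vx (cut (F\<^sub>t \<times> F\<^sub>x) (T (cut (E\<^sub>t \<times> E\<^sub>x) f)))
         \<le> ennreal (C * setdist E\<^sub>t F\<^sub>t powr (- bracket ut vt - n / m * bracket ux vx + \<kappa>))
            * mixed_norm ut ux (cut (E\<^sub>t \<times> E\<^sub>x) f))"

definition time_space_bound :: "real \<Rightarrow> bool" where
  "time_space_bound C \<longleftrightarrow> (\<forall>f\<in>Linf_c. \<forall>E\<^sub>t E\<^sub>x F\<^sub>t F\<^sub>x. rectangle E\<^sub>t E\<^sub>x \<longrightarrow>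
     rectangle F\<^sub>t F\<^sub>x \<longrightarrow>
     ell_t E\<^sub>t F\<^sub>t powr (1 / m) \<le> ell_x E\<^sub>x F\<^sub>x \<longrightarrow>
     c powr m * ell_t E\<^sub>t F\<^sub>t \<le> setdist E\<^sub>t F\<^sub>t \<longrightarrow>
     c * ell_x E\<^sub>x F\<^sub>x \<le> setdist E\<^sub>x F\<^sub>x \<longrightarrow>
     mixed_norm vt vx (cut (F\<^sub>t \<times> F\<^sub>x) (T (cut (E\<^sub>t \<times> E\<^sub>x) f)))
         \<le> ennreal (C * setdist E\<^sub>x F\<^sub>x powr (- m * bracket ut vt - n * bracket ux vx + m * \<kappa>)
              * (diameter (E\<^sub>t \<union> F\<^sub>t) / setdist E\<^sub>x F\<^sub>x powr m) powr M)
            * mixed_norm ut ux (cut (E\<^sub>t \<times> E\<^sub>x) f))"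

definition space_bound :: "real \<Rightarrow> bool" where
  "space_bound C \<longleftrightarrow> (\<forall>f\<in>Linf_c. \<forall>E\<^sub>t E\<^sub>x F\<^sub>t F\<^sub>x. rectangle E\<^sub>t E\<^sub>x \<longrightarrow>
     rectangle F\<^sub>t F\<^sub>x \<longrightarrow>
     ell_t E\<^sub>t F\<^sub>t powr (1 / m) \<le> ell_x E\<^sub>x F\<^sub>x \<longrightarrow>
     c * ell_x E\<^sub>x F\<^sub>x \<le> setdist E\<^sub>x F\<^sub>x \<longrightarrow>
     mixed_norm r vx (cut (F\<^sub>t \<times> F\<^sub>x) (T (cut (E\<^sub>t \<times> E\<^sub>x) f)))
         \<le> ennreal (C * setdist E\<^sub>x F\<^sub>x powr (- n * bracket ux vx + m * \<kappa>)
              * (diameter (E\<^sub>t \<union> F\<^sub>t) / setdist E\<^sub>x F\<^sub>x powr m) powr (M + bracket ut vt))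
            * mixed_norm r ux (cut (E\<^sub>t \<times> E\<^sub>x) f))"

lemma operator_bounds: "\<exists>C\<ge>0. diagonal_bound C \<and> close_bound C \<and> time_space_bound C \<and> space_bound C"
  using sing unfolding singular_operator_def Let_def prod.case card[symmetric]
    diagonal_bound_def close_bound_def time_space_bound_def space_bound_def
  by (elim conjE exE) (intro conjI exI; (assumption | (intro ballI allI impI; blast)))


text \<open>What far pairs of a dyadic tree satisfy, h being their common side; it is stated without
  the tree so that the operator estimates do not refer to one.\<close>

definition separated :: "real \<Rightarrow> (real ^ 'n) set \<Rightarrow> (real ^ 'n) set \<Rightarrow> bool" where
  "separated h X Y \<longleftrightarrow> (\<exists>z l. cube z l X) \<and> (\<exists>z l. cube z l Y) \<and>
     h \<le> setdist X Y \<and> setdist X Y \<le> 4 * sqrt n * h \<and>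
     2 * h \<le> diameter (X \<union> Y) \<and> diameter (X \<union> Y) \<le> 4 * sqrt n * h"

text \<open>As c * sqrt n \<le> 1/16, \<open>c\<close> times the diameter is at most h / 4, well
  below the distance. The factor 2 in the second bound makes room for \<open>broad\<close>, which
  ends at time (2 Z)^m.\<close>

lemma separated_scale:
  assumes "separated h X Y" "0 < h"
  shows "c * ell_x X Y \<le> setdist X Y" "2 * h \<le> ell_x X Y"
proof -
  have "c * ell_x X Y \<le> c * (4 * sqrt n * h)"
    using assms c unfolding ell_x_def separated_def by (intro mult_left_mono) auto
  also have "\<dots> = (c * sqrt n) * (4 * h)" by simp
  also have "\<dots> \<le> 1 / 16 * (4 * h)" using c_sqrt assms by (intro mult_right_mono) auto
  also have "\<dots> \<le> setdist X Y" using assms by (auto simp: separated_def)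
  finally show "c * ell_x X Y \<le> setdist X Y" .
  show "2 * h \<le> ell_x X Y" using assms by (auto simp: ell_x_def separated_def)
qed

lemma time_root: "0 < Z \<Longrightarrow> (Z powr m) powr (1 / m) = Z"
  using m by (simp add: powr_powr)

lemma time_div_q: "0 < Z \<Longrightarrow> Z powr m / q = (2 * Z) powr m" "0 < Z \<Longrightarrow> Z powr m / q\<^sup>2 = (4 * Z) powr m"
proof -
  assume Z: "0 < Z"
  have "(4 :: real) powr m = (2 powr 2) powr m" by simp
  also have "\<dots> = 2 powr m * 2 powr m" unfolding powr_powr powr_add[symmetric] by simp
  finally have "(4 :: real) powr m = 2 powr m * 2 powr m" .
  then show "Z powr m / q = (2 * Z) powr m" "Z powr m / q\<^sup>2 = (4 * Z) powr m"
    using Z by (auto simp: q_def powr_mult powr_minus field_simps power2_eq_square)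
qed

lemma scale_le: "0 < Z \<Longrightarrow> Z \<le> 2 ^ l * Z"
  for Z :: real
  using mult_right_mono[of 1 "2 ^ l" Z] by simp

text \<open>The ratio is later raised to the power \<open>M\<close> or M + [u_t, v_t]. These have no
  definite sign, hence the bounds from both sides.\<close>

lemma ratio_bounds:
  assumes "0 < Z" "1 / 2 * Z powr m \<le> d" "d \<le> b * Z powr m" "0 < b"
    and D: "2 ^ l * Z \<le> D" "D \<le> 4 * sqrt n * (2 ^ l * Z)"
  shows "1 / 2 / (4 * sqrt n) powr m * 2 powr (- (real l * m)) \<le> d / D powr m"
    "d / D powr m \<le> b * 2 powr (- (real l * m))"
proof -
  let ?h = "2 ^ l * Z"
  have h: "0 < ?h" using assms by simp
  have eq: "2 powr (- (real l * m)) = Z powr m / ?h powr m"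
    unfolding powr_dyadic_mult[OF assms(1)] powr_minus using assms(1) by (simp add: field_simps)
  have Dm: "?h powr m \<le> D powr m" "D powr m \<le> (4 * sqrt n) powr m * ?h powr m"
  proof -
    show "?h powr m \<le> D powr m" using D h m by (intro powr_mono2) auto
    have "D powr m \<le> (4 * sqrt n * ?h) powr m" using D h m by (intro powr_mono2) auto
    also have "\<dots> = (4 * sqrt n) powr m * ?h powr m" by (rule powr_mult)
    finally show "D powr m \<le> (4 * sqrt n) powr m * ?h powr m" .
  qed
  have "0 < D" using h D by linarith
  then have pos: "0 < ?h powr m" "0 < D powr m" "0 < Z powr m" "0 < (4 * sqrt n) powr m"
    using h n_ge_1 assms(1) by auto
  have "0 \<le> 1 / 2 * Z powr m" by simp
  then have d0: "0 \<le> d" using assms(2) by linarith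
  have "1 / 2 / (4 * sqrt n) powr m * 2 powr (- (real l * m)) = (1 / 2 * Z powr m) / ((4 * sqrt n) powr m * ?h powr m)"
    by (simp add: eq)
  also have "\<dots> \<le> d / D powr m" using pos d0 assms Dm by (intro frac_le) auto
  finally show "1 / 2 / (4 * sqrt n) powr m * 2 powr (- (real l * m)) \<le> d / D powr m" .
  have "d / D powr m \<le> (b * Z powr m) / ?h powr m" using pos assms Dm by (intro frac_le) auto
  then show "d / D powr m \<le> b * 2 powr (- (real l * m))" by (simp add: eq)
qed

lemma kbound_nonneg: "0 < Z \<Longrightarrow> 0 \<le> kbound a b Z l"
  by (simp add: kbound_def)

text \<open>Bookkeeping common to (iii) and (iv). The two equations say that the powers of Z and of
  2^l produced by D^e1 (d / D^m)^e2 are those of \<open>kbound\<close>.\<close>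

lemma far_constant:
  fixes e1 e2 b :: real
  assumes "0 < b" "0 \<le> C"
    and e: "e1 = m * \<kappa> - m * bracket p p' - n * bracket ux vx"
    and e12: "e1 - m * e2 = - n * bracket ux vx - m * A"
  shows "\<exists>K>0. \<forall>Z l d D. 0 < Z \<longrightarrow> 1 / 2 * Z powr m \<le> d \<longrightarrow> d \<le> b * Z powr m \<longrightarrow> 2 ^ l * Z \<le> D \<longrightarrow>
    D \<le> 4 * sqrt n * (2 ^ l * Z) \<longrightarrow> C * D powr e1 * (d / D powr m) powr e2 \<le> K * kbound p p' Z l"
proof -
  obtain K1 where K1: "0 < K1" "\<And>x y. 0 < y \<Longrightarrow> 1 * y \<le> x \<Longrightarrow> x \<le> (4 * sqrt n) * y \<Longrightarrow> x powr e1 \<le> K1 * y powr e1"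
    using powr_comparable[of 1 "4 * sqrt n" e1] n_ge_1 by force
  have "0 < 1 / 2 / (4 * sqrt n) powr m" using n_ge_1 by simp
  then obtain K2 where K2: "0 < K2" "\<And>x y. 0 < y \<Longrightarrow> 1 / 2 / (4 * sqrt n) powr m * y \<le> x \<Longrightarrow> x \<le> b * y \<Longrightarrow> x powr e2 \<le> K2 * y powr e2"
    using powr_comparable[of "1 / 2 / (4 * sqrt n) powr m" b e2] assms(1) by blast
  show ?thesis
  \<comment> \<open>\<open>C\<close> may be 0; the added 1 keeps the constant positive.\<close>
  proof (intro exI[of _ "C * K1 * K2 + 1"] conjI allI impI)
    show "0 < C * K1 * K2 + 1" using assms K1 K2 by (simp add: add_nonneg_pos)
    fix Z d D :: real and l :: nat
    assume h: "0 < Z" "1 / 2 * Z powr m \<le> d" "d \<le> b * Z powr m" "2 ^ l * Z \<le> D" "D \<le> 4 * sqrt n * (2 ^ l * Z)"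
    have 1: "D powr e1 \<le> K1 * (2 ^ l * Z) powr e1" using h by (intro K1) auto
    have 2: "(d / D powr m) powr e2 \<le> K2 * (2 powr (- (real l * m))) powr e2"
      using ratio_bounds[OF h(1-3) assms(1) h(4-5)] by (intro K2) auto
    have "C * D powr e1 * (d / D powr m) powr e2 \<le> C * (K1 * (2 ^ l * Z) powr e1) * (K2 * (2 powr (- (real l * m))) powr e2)"
      using 1 2 assms K1 K2 by (intro mult_mono) auto
    also have "\<dots> = C * K1 * K2 * (2 powr (real l * (e1 - m * e2)) * Z powr e1)"
    proof -
      have e1: "(2 powr (- (real l * m))) powr e2 = 2 powr (- (real l * m * e2))"
        by (simp add: powr_powr)
      have e2: "2 powr (real l * (e1 - m * e2)) = 2 powr (real l * e1) * 2 powr (- (real l * m * e2))"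
        by (simp add: powr_add[symmetric] algebra_simps)
      show ?thesis unfolding powr_dyadic_mult[OF h(1)] e1 e2 by (simp only: mult_ac)
    qed
    also have "2 powr (real l * (e1 - m * e2)) * Z powr e1 = kbound p p' Z l"
      unfolding kbound_eq[OF h(1)] e12 by (simp add: e algebra_simps)
    also have "C * K1 * K2 * kbound p p' Z l \<le> (C * K1 * K2 + 1) * kbound p p' Z l"
      using kbound_nonneg[OF h(1)] by (intro mult_right_mono) auto
    finally show "C * D powr e1 * (d / D powr m) powr e2 \<le> (C * K1 * K2 + 1) * kbound p p' Z l" .
  qed
qed

text \<open>The hypotheses of (ii) and (iii) are symmetric in the two time intervals, so both orders
  of a small and a large time are treated at once.\<close>

definition early_late :: "real \<Rightarrow> real set \<Rightarrow> real set \<Rightarrow> bool" where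
  "early_late \<tau> E F \<longleftrightarrow> E = early \<tau> \<and> F = whit \<tau> \<or> E = whit \<tau> \<and> F = early \<tau>"

lemma early_late:
  assumes "early_late \<tau> E F" "0 < \<tau>"
  shows "ell_t E F = \<tau>" "q\<^sup>2 * \<tau> \<le> setdist E F" "setdist E F \<le> 1 * \<tau>" "1 / 2 * \<tau> \<le> diameter (E \<union> F)"
    "diameter (E \<union> F) \<le> 1 * \<tau>" "c powr m * \<tau> \<le> setdist E F"
    "\<And>X z l. cube z l X \<Longrightarrow> rectangle E X" "\<And>X z l. cube z l X \<Longrightarrow> rectangle F X"
  using assms early_whit[OF assms(2)] by (auto simp: early_late_def setdist_sym Un_commute)

lemma far_separated_estimate:
  "\<exists>K>0. \<forall>f\<in>Linf_c. \<forall>Z l X Y E F. 0 < Z \<longrightarrow> early_late (Z powr m) E F \<longrightarrow> separated (2 ^ l * Z) X Y \<longrightarrow>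
     mixed_norm vt vx (cut (F \<times> Y) (T (cut (E \<times> X) f)))
       \<le> ennreal (K * kbound ut vt Z l) * mixed_norm ut ux (cut (E \<times> X) f)"
proof -
  obtain C where C: "0 \<le> C" "time_space_bound C" using operator_bounds by blast
  note bound = C(2)[unfolded time_space_bound_def, rule_format]
  obtain K where K: "0 < K" "\<And>Z l d D. 0 < Z \<Longrightarrow> 1 / 2 * Z powr m \<le> d \<Longrightarrow> d \<le> 1 * Z powr m \<Longrightarrow> 2 ^ l * Z \<le> D \<Longrightarrow>
    D \<le> 4 * sqrt n * (2 ^ l * Z) \<Longrightarrow> C * D powr (- m * bracket ut vt - n * bracket ux vx + m * \<kappa>) * (d / D powr m) powr M \<le> K * kbound ut vt Z l"
    using far_constant[of 1 C "- m * bracket ut vt - n * bracket ux vx + m * \<kappa>" ut vt M] C(1)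
    by (auto simp: A_def algebra_simps)
  show ?thesis
  proof (intro exI[of _ K] conjI ballI allI impI K)
    fix f :: "real \<times> (real ^ 'n) \<Rightarrow> complex" and Z :: real and l :: nat and X Y E F
    assume f: "f \<in> Linf_c" and Z: "0 < Z" and EF: "early_late (Z powr m) E F" and XY: "separated (2 ^ l * Z) X Y"
    have Zm: "0 < Z powr m" and hZ: "0 < 2 ^ l * Z" using Z by auto
    note e = early_late[OF EF Zm]
    have "mixed_norm vt vx (cut (F \<times> Y) (T (cut (E \<times> X) f)))
       \<le> ennreal (C * setdist X Y powr (- m * bracket ut vt - n * bracket ux vx + m * \<kappa>)
              * (diameter (E \<union> F) / setdist X Y powr m) powr M) * mixed_norm ut ux (cut (E \<times> X) f)"
    proof (rule bound[OF f])
      show "rectangle E X" "rectangle F Y" using e XY by (auto simp: separated_def)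
      show "ell_t E F powr (1 / m) \<le> ell_x X Y"
      proof -
        have "Z \<le> ell_x X Y" using separated_scale(2)[OF XY hZ] scale_le[OF Z, of l] Z by linarith
        then show ?thesis by (simp add: e time_root[OF Z])
      qed
      show "c powr m * ell_t E F \<le> setdist E F" using e by simp
      show "c * ell_x X Y \<le> setdist X Y" by (rule separated_scale[OF XY hZ])
    qed
    also have "\<dots> \<le> ennreal (K * kbound ut vt Z l) * mixed_norm ut ux (cut (E \<times> X) f)"
      using e XY Z by (intro mult_right_mono ennreal_leI K) (auto simp: separated_def)
    finally show "mixed_norm vt vx (cut (F \<times> Y) (T (cut (E \<times> X) f)))
       \<le> ennreal (K * kbound ut vt Z l) * mixed_norm ut ux (cut (E \<times> X) f)" .
  qed
qed

lemma far_comparable_estimate: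
  "\<exists>K>0. \<forall>f\<in>Linf_c. \<forall>Z l X Y. 0 < Z \<longrightarrow> separated (2 ^ l * Z) X Y \<longrightarrow>
     mixed_norm r vx (cut (whit (Z powr m) \<times> Y) (T (cut (broad (Z powr m) \<times> X) f)))
       \<le> ennreal (K * kbound r r Z l) * mixed_norm r ux (cut (broad (Z powr m) \<times> X) f)"
proof -
  obtain C where C: "0 \<le> C" "space_bound C" using operator_bounds by blast
  note bound = C(2)[unfolded space_bound_def, rule_format]
  obtain K where K: "0 < K" "\<And>Z l d D. 0 < Z \<Longrightarrow> 1 / 2 * Z powr m \<le> d \<Longrightarrow> d \<le> 1 / q * Z powr m \<Longrightarrow> 2 ^ l * Z \<le> D \<Longrightarrow>
    D \<le> 4 * sqrt n * (2 ^ l * Z) \<Longrightarrow> C * D powr (- n * bracket ux vx + m * \<kappa>) * (d / D powr m) powr (M + bracket ut vt) \<le> K * kbound r r Z l"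
    using far_constant[of "1 / q" C "- n * bracket ux vx + m * \<kappa>" r r "M + bracket ut vt"] C(1) q_bounds
    by (auto simp: A_def algebra_simps bracket_def)
  show ?thesis
  proof (intro exI[of _ K] conjI ballI allI impI K)
    fix f :: "real \<times> (real ^ 'n) \<Rightarrow> complex" and Z :: real and l :: nat and X Y
    let ?E = "broad (Z powr m)" and ?F = "whit (Z powr m)"
    assume f: "f \<in> Linf_c" and Z: "0 < Z" and XY: "separated (2 ^ l * Z) X Y"
    have Zm: "0 < Z powr m" and hZ: "0 < 2 ^ l * Z" using Z by auto
    note e = broad_whit[OF Zm] early_whit[OF Zm]
    have "mixed_norm r vx (cut (?F \<times> Y) (T (cut (?E \<times> X) f)))
       \<le> ennreal (C * setdist X Y powr (- n * bracket ux vx + m * \<kappa>)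
              * (diameter (?E \<union> ?F) / setdist X Y powr m) powr (M + bracket ut vt)) * mixed_norm r ux (cut (?E \<times> X) f)"
    proof (rule bound[OF f])
      show "rectangle ?E X" "rectangle ?F Y" using e XY by (auto simp: separated_def)
      show "ell_t ?E ?F powr (1 / m) \<le> ell_x X Y"
      proof -
        have "2 * Z \<le> ell_x X Y" using separated_scale(2)[OF XY hZ] scale_le[OF Z, of l] Z by linarith
        then show ?thesis using Z by (simp add: e time_div_q time_root)
      qed
      show "c * ell_x X Y \<le> setdist X Y" by (rule separated_scale[OF XY hZ])
    qed
    also have "\<dots> \<le> ennreal (K * kbound r r Z l) * mixed_norm r ux (cut (?E \<times> X) f)"
      using e(3,4) XY Z by (intro mult_right_mono ennreal_leI K) (auto simp: separated_def)
    finally show "mixed_norm r vx (cut (?F \<times> Y) (T (cut (?E \<times> X) f)))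
       \<le> ennreal (K * kbound r r Z l) * mixed_norm r ux (cut (?E \<times> X) f)" .
  qed
qed

text \<open>The m-th root of the largest time is Z for (ii) and 2 Z for (i). Both values lie between
  \<open>c\<close> times the diameter and the diameter.\<close>

lemma near_scale:
  fixes Q :: "(real ^ 'n) set"
  assumes "cube z Z Q"
  shows "c * diameter (ccube z (3 * Z)) \<le> Z" "2 * Z \<le> diameter (ccube z (3 * Z))"
proof -
  have Z: "0 < Z" using assms by (rule cube_pos)
  note g = near_geometry[OF assms]
  have "c * diameter (ccube z (3 * Z)) \<le> c * (3 * sqrt n * Z)"
    using g c by (intro mult_left_mono) (auto simp: card)
  also have "\<dots> = (c * sqrt n) * (3 * Z)" by simp
  also have "\<dots> \<le> 1 / 16 * (3 * Z)" using c_sqrt Z by (intro mult_right_mono) auto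
  also have "\<dots> \<le> Z" using Z by simp
  finally show "c * diameter (ccube z (3 * Z)) \<le> Z" .
  show "2 * Z \<le> diameter (ccube z (3 * Z))" using g Z by linarith
qed

lemma near_separated_estimate:
  "\<exists>K>0. \<forall>f\<in>Linf_c. \<forall>Z z Q E F. cube z Z Q \<longrightarrow> early_late (Z powr m) E F \<longrightarrow>
     mixed_norm vt vx (cut (F \<times> Q) (T (cut (E \<times> ccube z (3 * Z)) f)))
       \<le> ennreal (K * kbound ut vt Z 0) * mixed_norm ut ux (cut (E \<times> ccube z (3 * Z)) f)"
proof -
  let ?e = "- bracket ut vt - n / m * bracket ux vx + \<kappa>"
  obtain C where C: "0 \<le> C" "close_bound C" using operator_bounds by blast
  note bound = C(2)[unfolded close_bound_def, rule_format]
  obtain K where K: "0 < K" "\<And>x y. 0 < y \<Longrightarrow> q\<^sup>2 * y \<le> x \<Longrightarrow> x \<le> 1 * y \<Longrightarrow> x powr ?e \<le> K * y powr ?e"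
    using powr_comparable[of "q\<^sup>2" 1 ?e] q_bounds by force
  show ?thesis
  proof (intro exI[of _ "C * K + 1"] conjI ballI allI impI)
    show "0 < C * K + 1" using C(1) K by (simp add: add_nonneg_pos)
    fix f :: "real \<times> (real ^ 'n) \<Rightarrow> complex" and Z :: real and z :: "real ^ 'n" and Q E F
    assume f: "f \<in> Linf_c" and Q: "cube z Z Q" and EF: "early_late (Z powr m) E F"
    let ?X = "ccube z (3 * Z)"
    have Z: "0 < Z" using Q by (rule cube_pos)
    have Zm: "0 < Z powr m" using Z by auto
    note e = early_late[OF EF Zm]
    have lx: "ell_x ?X Q = diameter ?X"
      using near_geometry(1)[OF Q] by (simp add: ell_x_def Un_absorb2)
    have le: "C * setdist E F powr ?e \<le> (C * K + 1) * kbound ut vt Z 0"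
    proof -
      have "C * setdist E F powr ?e \<le> C * (K * (Z powr m) powr ?e)"
        using e Zm C(1) by (intro mult_left_mono K) auto
      also have "\<dots> = C * K * kbound ut vt Z 0"
        using m by (simp add: kbound_eq[OF Z] powr_powr algebra_simps)
      also have "\<dots> \<le> (C * K + 1) * kbound ut vt Z 0"
        using kbound_nonneg[OF Z] by (intro mult_right_mono) auto
      finally show ?thesis .
    qed
    have "mixed_norm vt vx (cut (F \<times> Q) (T (cut (E \<times> ?X) f)))
       \<le> ennreal (C * setdist E F powr ?e) * mixed_norm ut ux (cut (E \<times> ?X) f)"
    proof (rule bound[OF f])
      show "rectangle E ?X" "rectangle F Q" using e Q Z cube_ccube[of "3 * Z" z] by auto
      show "c * ell_x ?X Q \<le> ell_t E F powr (1 / m)" "ell_t E F powr (1 / m) \<le> ell_x ?X Q"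
        using near_scale[OF Q] Z by (auto simp: e time_root lx)
      show "c powr m * ell_t E F \<le> setdist E F" using e by simp
    qed
    also have "\<dots> \<le> ennreal ((C * K + 1) * kbound ut vt Z 0) * mixed_norm ut ux (cut (E \<times> ?X) f)"
      by (intro mult_right_mono ennreal_leI le) auto
    finally show "mixed_norm vt vx (cut (F \<times> Q) (T (cut (E \<times> ?X) f)))
       \<le> ennreal ((C * K + 1) * kbound ut vt Z 0) * mixed_norm ut ux (cut (E \<times> ?X) f)" .
  qed
qed

lemma near_comparable_estimate:
  "\<exists>K>0. \<forall>f\<in>Linf_c. \<forall>Z z. 0 < Z \<longrightarrow>
     mixed_norm r r (cut (broad (Z powr m) \<times> ccube z (3 * Z)) (T (cut (broad (Z powr m) \<times> ccube z (3 * Z)) f)))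
       \<le> ennreal (K * Z powr (m * \<kappa>)) * mixed_norm r r (cut (broad (Z powr m) \<times> ccube z (3 * Z)) f)"
proof -
  obtain C where C: "0 \<le> C" "diagonal_bound C" using operator_bounds by blast
  note bound = C(2)[unfolded diagonal_bound_def, rule_format]
  let ?K = "C * q\<^sup>2 powr \<kappa> + 1"
  show ?thesis
  proof (intro exI[of _ ?K] conjI ballI allI impI)
    show "0 < ?K" using C(1) by (simp add: add_nonneg_pos)
    fix f :: "real \<times> (real ^ 'n) \<Rightarrow> complex" and z :: "real ^ 'n" and Z :: real
    assume f: "f \<in> Linf_c" and Z: "0 < Z"
    let ?X = "ccube z (3 * Z)" and ?E = "broad (Z powr m)"
    have Zm: "0 < Z powr m" using Z by auto
    note e = broad_whit[OF Zm]
    note ns = near_scale[OF cube_ccube[OF Z], of z]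
    have le: "C * Inf ?E powr \<kappa> \<le> ?K * Z powr (m * \<kappa>)"
    proof -
      have "C * Inf ?E powr \<kappa> = C * q\<^sup>2 powr \<kappa> * Z powr (m * \<kappa>)"
        using q_bounds Z by (simp add: e powr_mult powr_powr)
      also have "\<dots> \<le> ?K * Z powr (m * \<kappa>)" by (intro mult_right_mono) auto
      finally show ?thesis .
    qed
    have "mixed_norm r r (cut (?E \<times> ?X) (T (cut (?E \<times> ?X) f)))
       \<le> ennreal (C * Inf ?E powr \<kappa>) * mixed_norm r r (cut (?E \<times> ?X) f)"
    proof (rule bound[OF f])
      show "rectangle ?E ?X" using e Z cube_ccube[of "3 * Z" z] by auto
      show "c * ell_x ?X ?X \<le> ell_t ?E ?E powr (1 / m)" "ell_t ?E ?E powr (1 / m) \<le> ell_x ?X ?X"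
        using ns Z by (auto simp: e time_div_q time_root ell_x_def)
      show "c powr m * ell_t ?E ?E \<le> Inf ?E" using e by simp
    qed
    also have "\<dots> \<le> ennreal (?K * Z powr (m * \<kappa>)) * mixed_norm r r (cut (?E \<times> ?X) f)"
      by (intro mult_right_mono ennreal_leI le) auto
    finally show "mixed_norm r r (cut (?E \<times> ?X) (T (cut (?E \<times> ?X) f)))
       \<le> ennreal (?K * Z powr (m * \<kappa>)) * mixed_norm r r (cut (?E \<times> ?X) f)" .
  qed
qed

end

lemma Linf_c_borel: "f \<in> Linf_c \<Longrightarrow> f \<in> borel_measurable borel"
  by (simp add: Linf_c_def)

lemma Linf_c_cut:
  assumes "f \<in> Linf_c" "E \<in> sets borel"
  shows "cut E f \<in> Linf_c"
proof -
  obtain B where "\<And>p. norm (f p) \<le> B" using assms by (auto simp: Linf_c_def bounded_iff)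
  then have "norm (cut E f p) \<le> B" for p
    by (cases "p \<in> E") (auto simp: cut_def intro: order_trans[OF norm_ge_zero])
  then have "bounded (range (cut E f))" by (auto simp: bounded_iff)
  moreover obtain K where "compact K" "K \<subseteq> half_space" "\<And>p. p \<notin> K \<Longrightarrow> f p = 0"
    using assms by (auto simp: Linf_c_def)
  ultimately show ?thesis
    using assms by (auto simp: Linf_c_def cut_def[of E f] intro!: exI[of _ K] measurable_cut[unfolded cut_def])
qed

lemma borel_Times: "A \<in> sets borel \<Longrightarrow> B \<in> sets borel \<Longrightarrow> A \<times> B \<in> sets borel"
  for A :: "'a::second_countable_topology set" and B :: "'b::second_countable_topology set"
  by (subst borel_prod[symmetric]) simp

context singular
begin

text \<open>The number of doublings after which a ball of radius 2^l Z covers all points within the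
  distance bound of \<open>far_geometry\<close> and \<open>near_geometry\<close>.\<close>

definition l0 :: nat where "l0 = (LEAST k. 4 * sqrt n \<le> 2 ^ k)"

lemma l0: "4 * sqrt n \<le> 2 ^ l0"
proof -
  have "\<exists>k. 4 * sqrt n < 2 ^ k" by (rule real_arch_pow) simp
  then have "\<exists>k. 4 * sqrt n \<le> 2 ^ k" using less_imp_le by blast
  then show ?thesis unfolding l0_def by (rule LeastI_ex)
qed

text \<open>Its m-th root is 2^(l + l0): the pieces of spatial scale 2^l Z are charged to term l +
  l0 of the series.\<close>

definition dilation :: "nat \<Rightarrow> real" where "dilation l = 2 powr (real (l + l0) * m)"

text \<open>The hypotheses on t say that t^(1/m) lies strictly between 2 Z and 4 Z.\<close>

lemma radius:
  assumes "0 < Z" "Z powr m / q < t" "t < Z powr m / q\<^sup>2"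
  shows "2 ^ l0 * (2 ^ l * Z) < (dilation l * t) powr (1 / m)" "(dilation l * t) powr (1 / m) \<le> 4 * 2 ^ l0 * (2 ^ l * Z)"
proof -
  have t: "0 < t" using assms q_bounds by (smt (verit) divide_pos_pos powr_gt_zero)
  have "(dilation l * t) powr (1 / m) = dilation l powr (1 / m) * t powr (1 / m)" by (rule powr_mult)
  also have "dilation l powr (1 / m) = 2 ^ (l + l0)"
    using m by (simp add: dilation_def powr_powr powr_realpow del: of_nat_add)
  finally have eq: "(dilation l * t) powr (1 / m) = 2 ^ (l + l0) * t powr (1 / m)" .
  have "((2 * Z) powr m) powr (1 / m) < t powr (1 / m)"
    using assms m t by (intro powr_less_mono2) (auto simp: time_div_q)
  then have lo: "2 * Z < t powr (1 / m)" using assms by (simp add: time_root)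
  have "t powr (1 / m) < ((4 * Z) powr m) powr (1 / m)"
    using assms m t by (intro powr_less_mono2) (auto simp: time_div_q)
  then have hi: "t powr (1 / m) < 4 * Z" using assms by (simp add: time_root)
  have "2 ^ l0 * (2 ^ l * Z) = 2 ^ (l + l0) * Z" by (simp add: power_add)
  also have "\<dots> < 2 ^ (l + l0) * t powr (1 / m)"
    using lo assms by (intro mult_strict_left_mono) auto
  finally show "2 ^ l0 * (2 ^ l * Z) < (dilation l * t) powr (1 / m)" using eq by simp
  have "2 ^ (l + l0) * t powr (1 / m) \<le> 2 ^ (l + l0) * (4 * Z)"
    using hi by (intro mult_left_mono) auto
  then show "(dilation l * t) powr (1 / m) \<le> 4 * 2 ^ l0 * (2 ^ l * Z)" using eq by (simp add: power_add)
qed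

text \<open>With s = 0 the last factor is the average of \<open>H_ca\<close>, with s = c^m t that of
  \<open>H_w\<close>, in both cases evaluated at (t, x).\<close>

definition model_bound :: "ennreal \<Rightarrow> ennreal \<Rightarrow> real \<Rightarrow> bool" where
  "model_bound a b K \<longleftrightarrow> (\<forall>f\<in>(Linf_c :: (real \<times> (real ^ 'n) \<Rightarrow> complex) set). \<forall>Z l X E x t s. 0 < Z \<longrightarrow> Z powr m / q < t \<longrightarrow> t < Z powr m / q\<^sup>2 \<longrightarrow>
      0 \<le> s \<longrightarrow> s < t \<longrightarrow> E \<in> sets borel \<longrightarrow> E \<subseteq> {s<..<t} \<longrightarrow> X \<in> sets borel \<longrightarrow>
      (\<forall>y\<in>X. dist x y \<le> 4 * sqrt n * (2 ^ l * Z)) \<longrightarrow>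
      mixed_norm a b (cut (E \<times> X) f)
        \<le> ennreal (K * (Z powr (m * rcp a) * (2 ^ l * Z) powr (n * rcp b))) *
          avg a {s<..<t} (\<lambda>s. avg b (ball x ((dilation l * t) powr (1 / m))) (\<lambda>y. ennreal (norm (f (s, y))))))"

lemma model_lower:
  fixes a b :: ennreal
  assumes ab: "1 \<le> a" "1 \<le> b"
  shows "\<exists>K>0. model_bound a b K"
proof -
  let ?\<omega> = "unit_ball_vol n"
  have \<omega>: "0 < ?\<omega>" using n_ge_1 by simp
  have rc: "0 \<le> rcp a" "0 \<le> rcp b" using ab by (auto dest: rcp_bounds)
  \<comment> \<open>\<open>k\<close> bounds the volume of the ball in units of (2^l Z)^n, and 1 /
    q^2 bounds the length of the time window in units of Z^m.\<close>
  define k where "k = ?\<omega> * (4 * 2 ^ l0) powr n"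
  define K where "K = (1 / q\<^sup>2) powr rcp a * k powr rcp b"
  show ?thesis
    unfolding model_bound_def
  proof (intro exI[of _ K] conjI ballI allI impI)
    have "0 < k" using \<omega> by (simp add: k_def)
    then show "0 < K" using q_bounds by (simp add: K_def)
    fix f :: "real \<times> (real ^ 'n) \<Rightarrow> complex" and Z t s :: real and l :: nat and X :: "(real ^ 'n) set" and E x
    assume f: "f \<in> Linf_c" and Z: "0 < Z" and t: "Z powr m / q < t" "t < Z powr m / q\<^sup>2" and s: "0 \<le> s" "s < t"
      and E: "E \<in> sets borel" "E \<subseteq> {s<..<t}" and X: "X \<in> sets borel"
      and XB: "\<forall>y\<in>X. dist x y \<le> 4 * sqrt n * (2 ^ l * Z)"
    let ?h = "2 ^ l * Z" and ?\<rho> = "(dilation l * t) powr (1 / m)"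
    have h: "0 < ?h" using Z by simp
    note rad = radius[OF Z t, of l]
    have "4 * sqrt n * ?h \<le> 2 ^ l0 * ?h" using l0 h by (intro mult_right_mono) auto
    then have le: "4 * sqrt n * ?h < ?\<rho>" using rad(1) by linarith
    have sub: "X \<subseteq> ball x ?\<rho>"
    proof
      fix y assume "y \<in> X"
      then have "dist x y \<le> 4 * sqrt n * ?h" using XB by blast
      with le show "y \<in> ball x ?\<rho>" unfolding mem_ball by linarith
    qed
    have \<rho>: "0 < ?\<rho>" using rad(1) h by (smt (verit) zero_less_power mult_pos_pos)
    have vol: "emeasure lborel (ball x ?\<rho>) = ennreal (?\<omega> * ?\<rho> powr n)"
      using \<rho> by (simp add: emeasure_ball card powr_realpow)
    have vpos: "0 < ?\<omega> * ?\<rho> powr n" using \<omega> \<rho> by simp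
    have "mixed_norm a b (cut (E \<times> X) f) \<le> ennreal ((t - s) powr rcp a * (?\<omega> * ?\<rho> powr n) powr rcp b) *
       avg a {s<..<t} (\<lambda>s. avg b (ball x ?\<rho>) (\<lambda>y. ennreal (norm (f (s, y)))))"
      by (rule mixed_norm_le_avg_avg[OF Linf_c_borel[OF f] ab s(2) _ vol vpos E(1) X E(2) sub]) simp
    also have "\<dots> \<le> ennreal (K * (Z powr (m * rcp a) * ?h powr (n * rcp b))) *
       avg a {s<..<t} (\<lambda>s. avg b (ball x ?\<rho>) (\<lambda>y. ennreal (norm (f (s, y)))))"
    proof (intro mult_right_mono ennreal_leI)
      have "(t - s) powr rcp a \<le> (1 / q\<^sup>2 * Z powr m) powr rcp a"
        using s t rc by (intro powr_mono2) auto
      also have "\<dots> = (1 / q\<^sup>2) powr rcp a * Z powr (m * rcp a)"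
        by (simp only: powr_mult powr_powr)
      finally have 1: "(t - s) powr rcp a \<le> (1 / q\<^sup>2) powr rcp a * Z powr (m * rcp a)" .
      have "?\<rho> powr n \<le> (4 * 2 ^ l0 * ?h) powr n"
        using rad(2) n_ge_1 by (intro powr_mono2) auto
      then have "?\<omega> * ?\<rho> powr n \<le> k * ?h powr n"
        using \<omega> by (simp only: k_def powr_mult mult.assoc mult_le_cancel_left_pos)
      then have "(?\<omega> * ?\<rho> powr n) powr rcp b \<le> (k * ?h powr n) powr rcp b"
        using rc vpos by (intro powr_mono2) auto
      also have "\<dots> = k powr rcp b * ?h powr (n * rcp b)"
        by (simp only: powr_mult powr_powr)
      finally have 2: "(?\<omega> * ?\<rho> powr n) powr rcp b \<le> k powr rcp b * ?h powr (n * rcp b)" .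
      have "(t - s) powr rcp a * (?\<omega> * ?\<rho> powr n) powr rcp b
          \<le> ((1 / q\<^sup>2) powr rcp a * Z powr (m * rcp a)) * (k powr rcp b * ?h powr (n * rcp b))"
        using 1 2 by (intro mult_mono) auto
      also have "\<dots> = K * (Z powr (m * rcp a) * ?h powr (n * rcp b))"
        by (simp only: K_def mult_ac)
      finally show "(t - s) powr rcp a * (?\<omega> * ?\<rho> powr n) powr rcp b \<le> K * (Z powr (m * rcp a) * ?h powr (n * rcp b))" .
    qed simp
    finally show "mixed_norm a b (cut (E \<times> X) f)
        \<le> ennreal (K * (Z powr (m * rcp a) * ?h powr (n * rcp b))) *
          avg a {s<..<t} (\<lambda>s. avg b (ball x ?\<rho>) (\<lambda>y. ennreal (norm (f (s, y)))))" .
  qed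
qed

section \<open>The pairing of a source region with a target region and its bound at one
  point\<close>

definition J :: "(real \<times> (real ^ 'n) \<Rightarrow> complex) \<Rightarrow> (real \<times> (real ^ 'n) \<Rightarrow> complex) \<Rightarrow>
    (real \<times> (real ^ 'n)) set \<Rightarrow> (real \<times> (real ^ 'n)) set \<Rightarrow> ennreal" where
  "J f g E F = (\<integral>\<^sup>+ p. ennreal (norm (T (cut E f) p) * norm (g p)) * indicator F p \<partial>hs_measure)"

lemma T_measurable: "f \<in> Linf_c \<Longrightarrow> T f \<in> borel_measurable hs_measure"
  using sing by (simp add: singular_operator_def operator_L0_def)

lemma J_Holder:
  assumes f: "f \<in> Linf_c" and g: "g \<in> Linf_c" and E: "E \<in> sets borel" and F: "F \<in> sets borel" "F \<subseteq> half_space"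
    and ab: "1 \<le> a" "1 \<le> b"
  shows "J f g E F \<le> mixed_norm a b (cut F (T (cut E f))) * mixed_norm (conj_exp a) (conj_exp b) (cut F g)"
proof -
  have "J f g E F = (\<integral>\<^sup>+ p. ennreal (norm (cut F (T (cut E f)) p) * norm (cut F g p)) \<partial>hs_measure)"
    unfolding J_def by (intro nn_integral_cong) (auto simp: cut_def indicator_def)
  also have "\<dots> \<le> mixed_norm a b (cut F (T (cut E f))) * mixed_norm (conj_exp a) (conj_exp b) (cut F g)"
    using f g E F by (intro mixed_norm_Holder ab measurable_cut_hs T_measurable Linf_c_cut measurable_cut Linf_c_borel)
  finally show ?thesis .
qed

text \<open>The factor Z^m (2^l Z)^n is comparable to the measure of the box over \<open>Y\<close>
  in which (t, x) will range, so the right-hand side is prepared for integration over that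
  box.\<close>

definition pointwise_bound :: "ennreal \<Rightarrow> ennreal \<Rightarrow> real \<Rightarrow> bool" where
  "pointwise_bound a b K \<longleftrightarrow> (\<forall>f\<in>Linf_c. \<forall>g\<in>Linf_c. \<forall>Z l X Y E F x t s s' K1. 0 < Z \<longrightarrow> Z powr m / q < t \<longrightarrow> t < Z powr m / q\<^sup>2 \<longrightarrow>
      0 \<le> s \<longrightarrow> s < t \<longrightarrow> E \<in> sets borel \<longrightarrow> E \<subseteq> {s<..<t} \<longrightarrow> X \<in> sets borel \<longrightarrow>
      (\<forall>y\<in>X. dist x y \<le> 4 * sqrt n * (2 ^ l * Z)) \<longrightarrow>
      0 \<le> s' \<longrightarrow> s' < t \<longrightarrow> F \<in> sets borel \<longrightarrow> F \<subseteq> {s'<..<t} \<longrightarrow> Y \<in> sets borel \<longrightarrow>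
      (\<forall>y\<in>Y. dist x y \<le> 4 * sqrt n * (2 ^ l * Z)) \<longrightarrow> 0 \<le> K1 \<longrightarrow>
      mixed_norm b vx (cut (F \<times> Y) (T (cut (E \<times> X) f))) \<le> ennreal (K1 * kbound a b Z l) * mixed_norm a ux (cut (E \<times> X) f) \<longrightarrow>
      J f g (E \<times> X) (F \<times> Y) \<le> ennreal (K * K1 * 2 powr (- (real l * m * A)) * (Z powr m * (2 ^ l * Z) powr n)) *
        (ennreal (t powr \<kappa>)
         * avg a {s<..<t} (\<lambda>s. avg ux (ball x ((dilation l * t) powr (1 / m))) (\<lambda>y. ennreal (norm (f (s, y)))))
         * avg (conj_exp b) {s'<..<t} (\<lambda>s. avg (conj_exp vx) (ball x ((dilation l * t) powr (1 / m))) (\<lambda>y. ennreal (norm (g (s, y)))))))"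

text \<open>Hoelder, the operator bound and two applications of \<open>model_lower\<close>. The
  scaling powers cancel: -[a, b] + 1/a + 1/b' = 1 leaves one factor Z^m, and the same identity for
  u_x and v_x leaves (2^l Z)^n.\<close>

lemma key_estimate:
  fixes a b :: ennreal
  assumes ab: "1 \<le> a" "1 \<le> b"
  shows "\<exists>K>0. pointwise_bound a b K"
proof -
  obtain K2 where K2: "0 < K2" "model_bound a ux K2" using model_lower[OF ab(1) exps(3)] by blast
  obtain K3 where K3: "0 < K3" "model_bound (conj_exp b) (conj_exp vx) K3"
    using model_lower[OF one_le_conj_exp[OF ab(2)] one_le_conj_exp[OF exps(5)]] by blast
  note ml = K2(2)[unfolded model_bound_def, rule_format] and mr = K3(2)[unfolded model_bound_def, rule_format]
  have "0 < q\<^sup>2" using q_bounds by simp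
  then obtain K4 where K4: "0 < K4" "\<And>x y. 0 < y \<Longrightarrow> q\<^sup>2 * y \<le> x \<Longrightarrow> x \<le> 1 * y \<Longrightarrow> x powr \<kappa> \<le> K4 * y powr \<kappa>"
    using powr_comparable[of "q\<^sup>2" 1 \<kappa>] by (metis zero_less_one)
  show ?thesis
    unfolding pointwise_bound_def
  proof (intro exI[of _ "K2 * K3 * K4"] conjI ballI allI impI)
    show "0 < K2 * K3 * K4" using K2(1) K3(1) K4(1) by simp
    fix f g :: "real \<times> (real ^ 'n) \<Rightarrow> complex" and Z t s s' K1 :: real and l :: nat and X Y :: "(real ^ 'n) set" and E F x
    assume f: "f \<in> Linf_c" and g: "g \<in> Linf_c" and Z: "0 < Z" and t: "Z powr m / q < t" "t < Z powr m / q\<^sup>2"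
      and s: "0 \<le> s" "s < t" and E: "E \<in> sets borel" "E \<subseteq> {s<..<t}" and X: "X \<in> sets borel"
      and XB: "\<forall>y\<in>X. dist x y \<le> 4 * sqrt n * (2 ^ l * Z)"
      and s': "0 \<le> s'" "s' < t" and F: "F \<in> sets borel" "F \<subseteq> {s'<..<t}" and Y: "Y \<in> sets borel"
      and YB: "\<forall>y\<in>Y. dist x y \<le> 4 * sqrt n * (2 ^ l * Z)" and K1: "0 \<le> K1"
      and bd: "mixed_norm b vx (cut (F \<times> Y) (T (cut (E \<times> X) f))) \<le> ennreal (K1 * kbound a b Z l) * mixed_norm a ux (cut (E \<times> X) f)"
    let ?h = "2 ^ l * Z"
    let ?Hf = "avg a {s<..<t} (\<lambda>s. avg ux (ball x ((dilation l * t) powr (1 / m))) (\<lambda>y. ennreal (norm (f (s, y)))))"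
    let ?Hg = "avg (conj_exp b) {s'<..<t} (\<lambda>s. avg (conj_exp vx) (ball x ((dilation l * t) powr (1 / m))) (\<lambda>y. ennreal (norm (g (s, y)))))"
    have h: "0 < ?h" using Z by simp
    let ?p = "Z powr (m * rcp a) * ?h powr (n * rcp ux)"
    let ?p' = "Z powr (m * rcp (conj_exp b)) * ?h powr (n * rcp (conj_exp vx))"
    have t0: "0 < t" using s by simp
    have B0: "0 \<le> kbound a b Z l" using Z by (rule kbound_nonneg)
    have "J f g (E \<times> X) (F \<times> Y) \<le> mixed_norm b vx (cut (F \<times> Y) (T (cut (E \<times> X) f)))
        * mixed_norm (conj_exp b) (conj_exp vx) (cut (F \<times> Y) g)"
      using E F X Y s' by (intro J_Holder f g ab exps borel_Times) (auto simp: half_space_def)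
    also have "\<dots> \<le> (ennreal (K1 * kbound a b Z l) * (ennreal (K2 * ?p) * ?Hf)) * (ennreal (K3 * ?p') * ?Hg)"
      by (intro mult_mono order_trans[OF bd] mult_left_mono ml[OF f Z t s E X XB[rule_format]] mr[OF g Z t s' F Y YB[rule_format]]) auto
    also have "\<dots> = ennreal (K1 * kbound a b Z l * (K2 * ?p) * (K3 * ?p')) * (?Hf * ?Hg)"
      using K1 K2(1) K3(1) B0 by (simp add: ennreal_mult mult_ac)
    also have "\<dots> \<le> ennreal (K2 * K3 * K4 * K1 * 2 powr (- (real l * m * A)) * (Z powr m * ?h powr n) * t powr \<kappa>) * (?Hf * ?Hg)"
    proof (intro mult_right_mono ennreal_leI)
      have "kbound a b Z l * ?p * ?p' = (Z powr (m * \<kappa> - m * bracket a b) * Z powr (m * rcp a) * Z powr (m * rcp (conj_exp b)))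
          * (?h powr (- n * bracket ux vx) * ?h powr (n * rcp ux) * ?h powr (n * rcp (conj_exp vx))) * 2 powr (- (real l * m * A))"
        unfolding kbound_def by (simp only: mult_ac)
      also have "Z powr (m * \<kappa> - m * bracket a b) * Z powr (m * rcp a) * Z powr (m * rcp (conj_exp b)) = Z powr (m * \<kappa> + m)"
        unfolding powr_add[symmetric] rcp_conj_exp[OF ab(2)] bracket_def by (rule arg_cong) (simp add: algebra_simps)
      also have "?h powr (- n * bracket ux vx) * ?h powr (n * rcp ux) * ?h powr (n * rcp (conj_exp vx)) = ?h powr n"
        unfolding powr_add[symmetric] rcp_conj_exp[OF exps(5)] bracket_def by (rule arg_cong) (simp add: algebra_simps)
      also have "Z powr (m * \<kappa> + m) = (Z powr m) powr \<kappa> * Z powr m" by (simp add: powr_add powr_powr)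
      finally have eq: "kbound a b Z l * ?p * ?p' = (Z powr m) powr \<kappa> * Z powr m * ?h powr n * 2 powr (- (real l * m * A))" .
      \<comment> \<open>Z^m and t are comparable in the box, so the weight Z^(m \<kappa>) turns into
        t^\<kappa> whatever the sign of \<kappa>.\<close>
      have "Z powr m \<le> 1 * t" "q\<^sup>2 * t \<le> Z powr m"
      proof -
        have "Z powr m * 1 \<le> Z powr m * (1 / q)" using q_bounds by (intro mult_left_mono) auto
        then show "Z powr m \<le> 1 * t" using t by simp
        show "q\<^sup>2 * t \<le> Z powr m" using t q_bounds by (simp add: field_simps)
      qed
      then have k: "(Z powr m) powr \<kappa> \<le> K4 * t powr \<kappa>" using t0 by (intro K4)
      have "K1 * kbound a b Z l * (K2 * ?p) * (K3 * ?p') = K1 * K2 * K3 * (kbound a b Z l * ?p * ?p')" by (simp only: mult_ac)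
      also have "\<dots> = (K1 * K2 * K3 * (Z powr m * ?h powr n * 2 powr (- (real l * m * A)))) * (Z powr m) powr \<kappa>"
        unfolding eq by (simp only: mult_ac)
      also have "\<dots> \<le> (K1 * K2 * K3 * (Z powr m * ?h powr n * 2 powr (- (real l * m * A)))) * (K4 * t powr \<kappa>)"
        using k K1 K2(1) K3(1) by (intro mult_left_mono) auto
      also have "\<dots> = K2 * K3 * K4 * K1 * 2 powr (- (real l * m * A)) * (Z powr m * ?h powr n) * t powr \<kappa>"
        by (simp only: mult_ac)
      finally show "K1 * kbound a b Z l * (K2 * ?p) * (K3 * ?p')
        \<le> K2 * K3 * K4 * K1 * 2 powr (- (real l * m * A)) * (Z powr m * ?h powr n) * t powr \<kappa>" .
    qed simp
    also have "\<dots> = ennreal (K2 * K3 * K4 * K1 * 2 powr (- (real l * m * A)) * (Z powr m * ?h powr n)) * (ennreal (t powr \<kappa>) * ?Hf * ?Hg)"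
      using K1 K2(1) K3(1) K4(1) by (subst ennreal_mult) (auto simp: mult_ac)
    finally show "J f g (E \<times> X) (F \<times> Y) \<le> ennreal (K2 * K3 * K4 * K1 * 2 powr (- (real l * m * A)) * (Z powr m * ?h powr n))
      * (ennreal (t powr \<kappa>) * ?Hf * ?Hg)" .
  qed
qed

end

section \<open>Decomposition and summation\<close>

text \<open>
  The integral of a function that is not measurable is its lower integral; hence the model operators need not be
  shown to be measurable.
\<close>

lemma disjoint_lower_sum:
  fixes \<phi> :: "'a \<Rightarrow> ennreal"
  assumes "finite S" "disjoint_family_on G S" "\<And>i. i \<in> S \<Longrightarrow> G i \<in> sets M"
  shows "(\<Sum>i\<in>S. (INF p\<in>G i. \<phi> p) * emeasure M (G i)) \<le> (\<integral>\<^sup>+ p. \<phi> p \<partial>M)"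
proof -
  have "(\<Sum>i\<in>S. (INF p\<in>G i. \<phi> p) * emeasure M (G i)) =
      (\<Sum>i\<in>S. \<integral>\<^sup>+ p. (INF p\<in>G i. \<phi> p) * indicator (G i) p \<partial>M)"
    using assms by (intro sum.cong refl) (simp add: nn_integral_cmult_indicator)
  also have "\<dots> = (\<integral>\<^sup>+ p. (\<Sum>i\<in>S. (INF p\<in>G i. \<phi> p) * indicator (G i) p) \<partial>M)"
    using assms by (intro nn_integral_sum[symmetric]) auto
  also have "\<dots> \<le> (\<integral>\<^sup>+ p. \<phi> p \<partial>M)"
  proof (intro nn_integral_mono)
    fix p
    show "(\<Sum>i\<in>S. (INF p\<in>G i. \<phi> p) * indicator (G i) p) \<le> \<phi> p"
    proof (cases "\<exists>i\<in>S. p \<in> G i")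
      case True
      then obtain i where i: "i \<in> S" "p \<in> G i" by blast
      \<comment> \<open>By disjointness only one summand survives at \<open>p\<close>, and its
        infimum is at most the value at \<open>p\<close>.\<close>
      have "(\<Sum>j\<in>S. (INF p\<in>G j. \<phi> p) * indicator (G j) p) = (\<Sum>j\<in>{i}. (INF p\<in>G j. \<phi> p) * indicator (G j) p)"
        using i assms(1,2) by (intro sum.mono_neutral_right) (auto simp: disjoint_family_on_def indicator_def)
      also have "\<dots> \<le> \<phi> p" using i by (simp add: INF_lower)
      finally show ?thesis .
    next
      case False
      then have "(\<Sum>i\<in>S. (INF p\<in>G i. \<phi> p) * indicator (G i) p) = 0"
        by (intro sum.neutral) (auto simp: indicator_def)
      then show ?thesis by simp
    qed
  qed
  finally show ?thesis .
qed

context singular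
begin

section \<open>Splitting and merging in the source and in the target\<close>

lemma J_measurable:
  assumes "f \<in> Linf_c" "g \<in> Linf_c" "E \<in> sets borel" "F \<in> sets borel"
  shows "(\<lambda>p. ennreal (norm (T (cut E f) p) * norm (g p)) * indicator F p) \<in> borel_measurable hs_measure"
proof -
  have [measurable]: "T (cut E f) \<in> borel_measurable hs_measure"
    using assms by (intro T_measurable Linf_c_cut)
  have [measurable]: "g \<in> borel_measurable hs_measure"
    using Linf_c_borel[OF assms(2)] unfolding hs_measure_def by (intro measurable_restrict_space1) simp
  have [measurable]: "indicator F \<in> borel_measurable hs_measure"
    using assms(4) unfolding hs_measure_def by (intro measurable_restrict_space1) simp
  show ?thesis by measurable
qed

text \<open>Disjointness makes the cut of \<open>f\<close> to the union a sum of two cuts, to which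
  subadditivity applies.\<close>

lemma J_Un:
  assumes f: "f \<in> Linf_c" and g: "g \<in> Linf_c" and E: "E1 \<in> sets borel" "E2 \<in> sets borel" "E1 \<inter> E2 = {}"
    and F: "F \<in> sets borel"
  shows "J f g (E1 \<union> E2) F \<le> J f g E1 F + J f g E2 F"
proof -
  have "cut (E1 \<union> E2) f = (\<lambda>p. cut E1 f p + cut E2 f p)"
    using E(3) by (auto simp: cut_def indicator_def fun_eq_iff)
  moreover have "AE p in hs_measure. norm (T (\<lambda>p. cut E1 f p + cut E2 f p) p) \<le> norm (T (cut E1 f) p) + norm (T (cut E2 f) p)"
    using sing f E by (simp add: singular_operator_def subadditive_op_def Linf_c_cut)
  ultimately have ae: "AE p in hs_measure. norm (T (cut (E1 \<union> E2) f) p) \<le> norm (T (cut E1 f) p) + norm (T (cut E2 f) p)"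
    by simp
  have "J f g (E1 \<union> E2) F \<le> (\<integral>\<^sup>+ p. ennreal (norm (T (cut E1 f) p) * norm (g p)) * indicator F p
      + ennreal (norm (T (cut E2 f) p) * norm (g p)) * indicator F p \<partial>hs_measure)"
    unfolding J_def
  proof (intro nn_integral_mono_AE, use ae in eventually_elim)
    case (elim p)
    have "norm (T (cut (E1 \<union> E2) f) p) * norm (g p) \<le> norm (T (cut E1 f) p) * norm (g p) + norm (T (cut E2 f) p) * norm (g p)"
      using mult_right_mono[OF elim, of "norm (g p)"] by (simp add: algebra_simps)
    then show ?case by (auto simp: indicator_def ennreal_plus[symmetric] simp del: ennreal_plus intro!: ennreal_leI)
  qed
  also have "\<dots> = J f g E1 F + J f g E2 F"
    unfolding J_def using f g E F by (intro nn_integral_add J_measurable)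
  finally show ?thesis .
qed

lemma J_UN:
  assumes f: "f \<in> Linf_c" and g: "g \<in> Linf_c" and F: "F \<in> sets borel" and I: "finite I"
    and E0: "E0 \<in> sets borel" "\<And>i. i \<in> I \<Longrightarrow> B i \<in> sets borel"
    and disj: "\<And>i. i \<in> I \<Longrightarrow> E0 \<inter> B i = {}" "\<And>i j. i \<in> I \<Longrightarrow> j \<in> I \<Longrightarrow> i \<noteq> j \<Longrightarrow> B i \<inter> B j = {}"
  shows "J f g (E0 \<union> (\<Union>i\<in>I. B i)) F \<le> J f g E0 F + (\<Sum>i\<in>I. J f g (B i) F)"
  using I E0(2) disj
proof (induction I rule: finite_induct)
  case (insert i I)
  have "J f g (E0 \<union> (\<Union>j\<in>insert i I. B j)) F = J f g ((E0 \<union> (\<Union>j\<in>I. B j)) \<union> B i) F"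
    by (rule arg_cong[where f = "\<lambda>S. J f g S F"]) auto
  also have "\<dots> \<le> J f g (E0 \<union> (\<Union>j\<in>I. B j)) F + J f g (B i) F"
  proof (rule J_Un[OF f g])
    show "E0 \<union> (\<Union>j\<in>I. B j) \<in> sets borel"
      using E0(1) insert.hyps insert.prems(1) by (intro sets.Un sets.finite_UN) auto
    show "(E0 \<union> (\<Union>j\<in>I. B j)) \<inter> B i = {}"
      using insert.prems(2)[of i] insert.prems(3)[of _ i] insert.hyps by blast
  qed (use insert.prems F in auto)
  also have "\<dots> \<le> (J f g E0 F + (\<Sum>i\<in>I. J f g (B i) F)) + J f g (B i) F"
    using insert by (intro add_right_mono) auto
  finally show ?case using insert.hyps by (simp add: ac_simps)
qed simp

lemma J_cover:
  assumes f: "f \<in> Linf_c" and g: "g \<in> Linf_c" and E: "E \<in> sets borel"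
    and S: "finite S" "\<And>i. i \<in> S \<Longrightarrow> F i \<in> sets borel" and cov: "F0 \<subseteq> (\<Union>i\<in>S. F i)"
  shows "J f g E F0 \<le> (\<Sum>i\<in>S. J f g E (F i))"
proof -
  have "J f g E F0 \<le> (\<integral>\<^sup>+ p. (\<Sum>i\<in>S. ennreal (norm (T (cut E f) p) * norm (g p)) * indicator (F i) p) \<partial>hs_measure)"
    unfolding J_def
  proof (intro nn_integral_mono)
    fix p
    show "ennreal (norm (T (cut E f) p) * norm (g p)) * indicator F0 p
      \<le> (\<Sum>i\<in>S. ennreal (norm (T (cut E f) p) * norm (g p)) * indicator (F i) p)"
    proof (cases "p \<in> F0")
      case True
      then obtain i where i: "i \<in> S" "p \<in> F i" using cov by blast
      then show ?thesis
        using member_le_sum[of i S "\<lambda>i. ennreal (norm (T (cut E f) p) * norm (g p)) * indicator (F i) p"] S True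
        by simp
    qed simp
  qed
  also have "\<dots> = (\<Sum>i\<in>S. J f g E (F i))"
    unfolding J_def using f g E S by (intro nn_integral_sum J_measurable)
  finally show ?thesis .
qed

text \<open>For a fixed source the pairing is an integral over the target, so disjoint targets can
  be merged; subadditivity gives nothing of the kind for sources.\<close>

lemma J_packing:
  assumes f: "f \<in> Linf_c" and g: "g \<in> Linf_c" and E: "E \<in> sets borel"
    and S: "finite S" "\<And>i. i \<in> S \<Longrightarrow> F i \<in> sets borel" "disjoint_family_on F S" "\<And>i. i \<in> S \<Longrightarrow> F i \<subseteq> F0"
  shows "(\<Sum>i\<in>S. J f g E (F i)) \<le> J f g E F0"
proof -
  let ?\<phi> = "\<lambda>p. ennreal (norm (T (cut E f) p) * norm (g p))"
  have "(\<Sum>i\<in>S. J f g E (F i)) = (\<integral>\<^sup>+ p. (\<Sum>i\<in>S. ?\<phi> p * indicator (F i) p) \<partial>hs_measure)"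
    unfolding J_def using f g E S by (intro nn_integral_sum[symmetric] J_measurable)
  also have "\<dots> \<le> J f g E F0"
    unfolding J_def
  proof (intro nn_integral_mono)
    fix p
    have "(\<Sum>i\<in>S. indicator (F i) p) = (indicator (\<Union>i\<in>S. F i) p :: ennreal)"
      using S by (intro indicator_UN_disjoint[symmetric])
    also have "\<dots> \<le> indicator F0 p" using S(4) by (auto simp: indicator_def)
    finally show "(\<Sum>i\<in>S. ?\<phi> p * indicator (F i) p) \<le> ?\<phi> p * indicator F0 p"
      unfolding sum_distrib_left[symmetric] by (intro mult_left_mono) auto
  qed
  finally show ?thesis .
qed

text \<open>Induction on the depth: by \<open>near_parent_eq\<close>, each near pair of level d
  splits into near and far pairs of level d + 1. At depth 0 the root is its own only
  neighbour.\<close>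

lemma spatial_decomposition:
  assumes tree: "dyadic_tree P Q0 L" and f: "f \<in> Linf_c" and g: "g \<in> Linf_c"
    and E: "E \<in> sets borel" and F: "F \<in> sets borel"
  shows "J f g (E \<times> Q0) (F \<times> Q0) \<le> (\<Sum>Q\<in>P d. J f g (E \<times> \<Union> (dyadic_tree.near P d Q)) (F \<times> Q))
    + (\<Sum>e<d. \<Sum>Y\<in>P (Suc e). \<Sum>X\<in>dyadic_tree.far P e Y. J f g (E \<times> X) (F \<times> Y))"
proof -
  interpret dyadic_tree P Q0 L by fact
  show ?thesis
  proof (induction d)
    case 0
    then show ?case by (simp add: root near_root)
  next
    case (Suc d)
    let ?N = "\<lambda>d Q. \<Union> (near d Q)"
    let ?h = "\<lambda>Q. J f g (E \<times> ?N (Suc d) Q) (F \<times> Q) + (\<Sum>X\<in>far d Q. J f g (E \<times> X) (F \<times> Q))"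
    have step: "J f g (E \<times> ?N d Q') (F \<times> Q') \<le> (\<Sum>Q\<in>{Q\<in>P (Suc d). Q \<subseteq> Q'}. ?h Q)" if Q': "Q' \<in> P d" for Q'
    proof -
      have "J f g (E \<times> ?N d Q') (F \<times> Q') \<le> (\<Sum>Q\<in>{Q\<in>P (Suc d). Q \<subseteq> Q'}. J f g (E \<times> ?N d Q') (F \<times> Q))"
      proof (rule J_cover[OF f g])
        show "E \<times> ?N d Q' \<in> sets borel"
          using E finite_near P_borel by (intro borel_Times sets.finite_Union) (auto simp: near_def)
        show "finite {Q \<in> P (Suc d). Q \<subseteq> Q'}" using finite_P by simp
        show "F \<times> Q' \<subseteq> (\<Union>Q\<in>{Q \<in> P (Suc d). Q \<subseteq> Q'}. F \<times> Q)"
        proof clarify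
          fix t x assume tx: "t \<in> F" "x \<in> Q'"
          obtain Q where Q: "Q \<in> P (Suc d)" "x \<in> Q" using P_cover[of x "Suc d"] P_subset[OF Q'] tx by blast
          obtain Q'' where Q'': "Q'' \<in> P d" "Q \<subseteq> Q''" using parent[OF Q(1)] by blast
          then have "Q'' = Q'" using P_disjoint[OF Q''(1) Q', of x] Q tx by blast
          then show "(t, x) \<in> (\<Union>Q\<in>{Q \<in> P (Suc d). Q \<subseteq> Q'}. F \<times> Q)" using Q Q'' tx by blast
        qed
      qed (use F P_borel in \<open>auto intro: borel_Times\<close>)
      also have "\<dots> \<le> (\<Sum>Q\<in>{Q\<in>P (Suc d). Q \<subseteq> Q'}. ?h Q)"
      proof (rule sum_mono)
        fix Q assume "Q \<in> {Q\<in>P (Suc d). Q \<subseteq> Q'}"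
        then have Q: "Q \<in> P (Suc d)" "Q \<subseteq> Q'" by auto
        have "E \<times> ?N d Q' = E \<times> ?N (Suc d) Q \<union> (\<Union>X\<in>far d Q. E \<times> X)"
          unfolding near_parent_eq[OF Q(1) Q' Q(2)] by blast
        moreover have "J f g (E \<times> ?N (Suc d) Q \<union> (\<Union>X\<in>far d Q. E \<times> X)) (F \<times> Q) \<le> ?h Q"
        proof (rule J_UN[OF f g])
          show "F \<times> Q \<in> sets borel" using F P_borel[OF Q(1)] by (rule borel_Times)
          show "finite (far d Q)" by (rule finite_far)
          show "E \<times> ?N (Suc d) Q \<in> sets borel"
            using E finite_near P_borel by (intro borel_Times sets.finite_Union) (auto simp: near_def)
          show "E \<times> X \<in> sets borel" if "X \<in> far d Q" for X
            using E that P_borel by (intro borel_Times) (auto simp: far_def)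
          show "E \<times> ?N (Suc d) Q \<inter> E \<times> X = {}" if "X \<in> far d Q" for X
            using near_far_disjoint[of d Q] that by blast
          show "E \<times> X \<inter> E \<times> X' = {}" if "X \<in> far d Q" "X' \<in> far d Q" "X \<noteq> X'" for X X'
          proof -
            have "X \<inter> X' = {}" using P_disjoint[of X "Suc d" X'] that by (auto simp: far_def)
            then show ?thesis by blast
          qed
        qed
        ultimately show "J f g (E \<times> ?N d Q') (F \<times> Q) \<le> ?h Q" by simp
      qed
      finally show ?thesis .
    qed
    have "(\<Sum>Q'\<in>P d. J f g (E \<times> ?N d Q') (F \<times> Q')) \<le> (\<Sum>Q'\<in>P d. \<Sum>Q\<in>{Q\<in>P (Suc d). Q \<subseteq> Q'}. ?h Q)"
      by (intro sum_mono step)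
    also have "\<dots> = (\<Sum>Q'\<in>P d. \<Sum>Q\<in>P (Suc d). if Q \<subseteq> Q' then ?h Q else 0)"
      using finite_P by (intro sum.cong refl sum.inter_filter)
    also have "\<dots> = (\<Sum>Q\<in>P (Suc d). \<Sum>Q'\<in>P d. if Q \<subseteq> Q' then ?h Q else 0)"
      by (rule sum.swap)
    also have "\<dots> = (\<Sum>Q\<in>P (Suc d). ?h Q)"
    proof (rule sum.cong[OF refl])
      fix Q assume Q: "Q \<in> P (Suc d)"
      obtain Q' where Q': "Q' \<in> P d" "Q \<subseteq> Q'" using parent[OF Q] by blast
      obtain x where x: "x \<in> Q" using centre_in_cube[OF cube_centre[OF Q]] by blast
      \<comment> \<open>Every cube has exactly one parent, so the double sum counts each child
        once.\<close>
      have "{R \<in> P d. Q \<subseteq> R} = {Q'}"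
        using Q' x P_disjoint[of _ d Q' x] by blast
      then show "(\<Sum>Q'\<in>P d. if Q \<subseteq> Q' then ?h Q else 0) = ?h Q"
        using finite_P by (simp add: sum.inter_filter[symmetric])
    qed
    also have "\<dots> = (\<Sum>Q\<in>P (Suc d). J f g (E \<times> ?N (Suc d) Q) (F \<times> Q))
        + (\<Sum>Q\<in>P (Suc d). \<Sum>X\<in>far d Q. J f g (E \<times> X) (F \<times> Q))"
      by (rule sum.distrib)
    finally have "(\<Sum>Q'\<in>P d. J f g (E \<times> ?N d Q') (F \<times> Q')) \<le> (\<Sum>Q\<in>P (Suc d). J f g (E \<times> ?N (Suc d) Q) (F \<times> Q))
        + (\<Sum>Q\<in>P (Suc d). \<Sum>X\<in>far d Q. J f g (E \<times> X) (F \<times> Q))" .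
    from order_trans[OF Suc add_right_mono[OF this]] show ?case by (simp add: ac_simps)
  qed
qed

text \<open>Let the target time lie in \<open>whit (\<tau> d)\<close>. A source time is early, or
  broad, or larger than \<tau> d / q. In the last case it lies in a window of index k with k + 2 <=
  d, and the target time is early relative to that window.\<close>

lemma time_decomposition:
  fixes \<tau> :: "nat \<Rightarrow> real"
  assumes \<tau>: "\<And>d. 0 < \<tau> d" "\<And>d. \<tau> (Suc d) = q * \<tau> d"
    and f: "f \<in> Linf_c" and g: "g \<in> Linf_c" and Q0: "Q0 \<in> sets borel"
    and supp: "\<And>t x. f (t, x) \<noteq> 0 \<or> g (t, x) \<noteq> 0 \<Longrightarrow> x \<in> Q0 \<and> \<tau> (Suc N) < t \<and> t \<le> \<tau> 0"
  shows "(\<integral>\<^sup>+ p. ennreal (norm (T f p) * norm (g p)) \<partial>hs_measure) \<le>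
    (\<Sum>d\<le>N. J f g (early (\<tau> d) \<times> Q0) (whit (\<tau> d) \<times> Q0)) + (\<Sum>d\<le>N. J f g (broad (\<tau> d) \<times> Q0) (whit (\<tau> d) \<times> Q0))
    + (\<Sum>d\<le>N. J f g (whit (\<tau> d) \<times> Q0) (early (\<tau> d) \<times> Q0))"
proof -
  have pw: "\<tau> (d + k) = q ^ k * \<tau> d" for d k
    by (induction k) (simp_all add: \<tau>(2))
  have anti: "\<tau> e \<le> \<tau> d" if "d \<le> e" for d e
  proof -
    have "q ^ (e - d) \<le> 1" using q_bounds by (intro power_le_one) auto
    then have "q ^ (e - d) * \<tau> d \<le> 1 * \<tau> d" using \<tau>(1)[of d] by (intro mult_right_mono) auto
    then show ?thesis using pw[of d "e - d"] that by simp
  qed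
  have whit_eq: "whit (\<tau> d) = {\<tau> (Suc d)<..\<tau> d}" for d by (simp add: whit_def \<tau>(2))
  have early_eq: "early (\<tau> d) = {0<..\<tau> (d + 2)}" for d by (simp only: early_def pw)
  have br: "broad (\<tau> d) = {\<tau> (d + 2)<..\<tau> d / q}" for d by (simp only: broad_def pw)
  \<comment> \<open>The windows of index at most k tile the times from \<tau> (Suc k) to \<tau>
    0.\<close>
  have find: "\<exists>d\<le>k. t \<in> whit (\<tau> d)" if "\<tau> (Suc k) < t" "t \<le> \<tau> 0" for k t
    using that
  proof (induction k)
    case 0
    then show ?case by (auto simp: whit_eq)
  next
    case (Suc k)
    then show ?case by (cases "\<tau> (Suc k) < t") (auto simp: whit_eq intro: le_SucI)
  qed
  have whit_disj: "whit (\<tau> d) \<inter> whit (\<tau> e) = {}" if "d \<noteq> e" for d e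
  proof -
    have *: "whit (\<tau> d) \<inter> whit (\<tau> e) = {}" if "d < e" for d e
      using anti[of "Suc d" e] that by (auto simp: whit_eq)
    show ?thesis using *[of d e] *[of e d] that by (cases "d < e") auto
  qed
  have bor: "whit (\<tau> d) \<times> Q0 \<in> sets borel" "early (\<tau> d) \<times> Q0 \<in> sets borel" "broad (\<tau> d) \<times> Q0 \<in> sets borel" for d
    using Q0 by (auto intro!: borel_Times simp: whit_def early_def broad_def)
  let ?U = "(UNIV :: real set) \<times> Q0"
  have U: "?U \<in> sets borel" using Q0 by (intro borel_Times) auto
  have fU: "cut ?U f = f" using supp by (auto simp: cut_def indicator_def fun_eq_iff)
  have "(\<integral>\<^sup>+ p. ennreal (norm (T f p) * norm (g p)) \<partial>hs_measure) = J f g ?U (\<Union>d\<in>{..N}. whit (\<tau> d) \<times> Q0)"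
    unfolding J_def fU
  proof (intro nn_integral_cong)
    fix p :: "real \<times> (real ^ 'n)"
    have "p \<in> (\<Union>d\<in>{..N}. whit (\<tau> d) \<times> Q0)" if "g p \<noteq> 0"
      using supp[of "fst p" "snd p"] find[of N "fst p"] that by (cases p) auto
    then show "ennreal (norm (T f p) * norm (g p)) = ennreal (norm (T f p) * norm (g p)) * indicator (\<Union>d\<in>{..N}. whit (\<tau> d) \<times> Q0) p"
      by (cases "g p = 0") auto
  qed
  also have "\<dots> \<le> (\<Sum>d\<le>N. J f g ?U (whit (\<tau> d) \<times> Q0))"
    by (intro J_cover f g U bor) auto
  also have "\<dots> \<le> (\<Sum>d\<le>N. J f g (early (\<tau> d) \<times> Q0) (whit (\<tau> d) \<times> Q0) + J f g (broad (\<tau> d) \<times> Q0) (whit (\<tau> d) \<times> Q0)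
      + (\<Sum>k\<in>{k. k \<le> N \<and> k + 2 \<le> d}. J f g (whit (\<tau> k) \<times> Q0) (whit (\<tau> d) \<times> Q0)))"
  proof (rule sum_mono)
    fix d assume "d \<in> {..N}"
    let ?A = "early (\<tau> d) \<times> Q0 \<union> broad (\<tau> d) \<times> Q0" and ?I = "{k. k \<le> N \<and> k + 2 \<le> d}"
    let ?F = "whit (\<tau> d) \<times> Q0"
    have below: "\<tau> d / q \<le> \<tau> (Suc k)" if "k + 2 \<le> d" for k
      using anti[OF that] q_bounds \<tau>(2)[of "Suc k"] by (simp add: field_simps)
    have cutA: "cut (?A \<union> (\<Union>k\<in>?I. whit (\<tau> k) \<times> Q0)) f = f"
    proof
      fix p :: "real \<times> (real ^ 'n)"
      obtain s y where p: "p = (s, y)" by (cases p)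
      have "p \<in> ?A \<union> (\<Union>k\<in>?I. whit (\<tau> k) \<times> Q0)" if "f p \<noteq> 0"
      proof -
        have sy: "y \<in> Q0" "\<tau> (Suc N) < s" "s \<le> \<tau> 0" using supp[of s y] that p by auto
        then have "0 < s" using \<tau>(1)[of "Suc N"] by linarith
        consider "s \<le> \<tau> (d + 2)" | "\<tau> (d + 2) < s" "s \<le> \<tau> d / q" | "\<tau> d / q < s" by linarith
        then show ?thesis
        proof cases
          case 1
          then show ?thesis using sy \<open>0 < s\<close> by (auto simp: p early_eq)
        next
          case 2
          then show ?thesis using sy by (auto simp: p br)
        next
          case 3
          obtain k where k: "k \<le> N" "s \<in> whit (\<tau> k)" using find[OF sy(2,3)] by blast
          \<comment> \<open>Otherwise Suc k >= d, and the window of index k would end at or below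
            \<tau> d / q.\<close>
          have "k + 2 \<le> d"
          proof (rule ccontr)
            assume "\<not> k + 2 \<le> d"
            then have "\<tau> (Suc k) \<le> \<tau> d" by (intro anti) auto
            then have "\<tau> k \<le> \<tau> d / q" using q_bounds \<tau>(2)[of k] by (simp add: field_simps)
            then show False using k 3 by (auto simp: whit_eq)
          qed
          then show ?thesis using k sy by (auto simp: p)
        qed
      qed
      then show "cut (?A \<union> (\<Union>k\<in>?I. whit (\<tau> k) \<times> Q0)) f p = f p"
        by (cases "f p = 0") (auto simp: cut_def)
    qed
    have "J f g ?U ?F = J f g (?A \<union> (\<Union>k\<in>?I. whit (\<tau> k) \<times> Q0)) ?F"
      unfolding J_def cutA fU ..
    also have "\<dots> \<le> J f g ?A ?F + (\<Sum>k\<in>?I. J f g (whit (\<tau> k) \<times> Q0) ?F)"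
    proof (rule J_UN[OF f g bor(1)])
      show "finite ?I" by simp
      show "?A \<in> sets borel" using bor by (intro sets.Un)
      show "?A \<inter> whit (\<tau> k) \<times> Q0 = {}" if "k \<in> ?I" for k
        using below[of k] anti[of "Suc k" "d + 2"] that by (auto simp: early_eq br whit_eq)
      show "whit (\<tau> k) \<times> Q0 \<inter> whit (\<tau> j) \<times> Q0 = {}" if "k \<noteq> j" for k j
        using whit_disj[OF that] by blast
    qed (rule bor)
    also have "J f g ?A ?F \<le> J f g (early (\<tau> d) \<times> Q0) ?F + J f g (broad (\<tau> d) \<times> Q0) ?F"
      by (intro J_Un f g bor) (auto simp: early_eq br)
    finally show "J f g ?U ?F \<le> J f g (early (\<tau> d) \<times> Q0) ?F + J f g (broad (\<tau> d) \<times> Q0) ?F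
      + (\<Sum>k\<in>?I. J f g (whit (\<tau> k) \<times> Q0) ?F)"
      by (meson add_right_mono order_trans)
  qed
  also have "\<dots> = (\<Sum>d\<le>N. J f g (early (\<tau> d) \<times> Q0) (whit (\<tau> d) \<times> Q0)) + (\<Sum>d\<le>N. J f g (broad (\<tau> d) \<times> Q0) (whit (\<tau> d) \<times> Q0))
    + (\<Sum>d\<le>N. \<Sum>k\<in>{k. k \<le> N \<and> k + 2 \<le> d}. J f g (whit (\<tau> k) \<times> Q0) (whit (\<tau> d) \<times> Q0))"
    by (simp only: sum.distrib)
  \<comment> \<open>Exchanging the sums fixes the window k of the source, whose times are the larger
    ones; the target windows d >= k + 2 are then packed into
    \<open>early (\<tau> k)\<close>.\<close>
  also have "(\<Sum>d\<le>N. \<Sum>k\<in>{k. k \<le> N \<and> k + 2 \<le> d}. J f g (whit (\<tau> k) \<times> Q0) (whit (\<tau> d) \<times> Q0))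
     = (\<Sum>k\<le>N. \<Sum>d\<in>{d. d \<in> {..N} \<and> k + 2 \<le> d}. J f g (whit (\<tau> k) \<times> Q0) (whit (\<tau> d) \<times> Q0))"
    using sum.swap_restrict[of "{..N}" "{..N}" "\<lambda>d k. J f g (whit (\<tau> k) \<times> Q0) (whit (\<tau> d) \<times> Q0)" "\<lambda>d k. k + 2 \<le> d"]
    by simp
  also have "\<dots> \<le> (\<Sum>k\<le>N. J f g (whit (\<tau> k) \<times> Q0) (early (\<tau> k) \<times> Q0))"
  proof (rule sum_mono)
    fix k
    show "(\<Sum>d\<in>{d. d \<in> {..N} \<and> k + 2 \<le> d}. J f g (whit (\<tau> k) \<times> Q0) (whit (\<tau> d) \<times> Q0))
      \<le> J f g (whit (\<tau> k) \<times> Q0) (early (\<tau> k) \<times> Q0)"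
    proof (rule J_packing[OF f g bor(1) _ bor(1)])
      show "disjoint_family_on (\<lambda>d. whit (\<tau> d) \<times> Q0) {d. d \<in> {..N} \<and> k + 2 \<le> d}"
        using whit_disj unfolding disjoint_family_on_def by blast
      show "whit (\<tau> d) \<times> Q0 \<subseteq> early (\<tau> k) \<times> Q0" if "d \<in> {d. d \<in> {..N} \<and> k + 2 \<le> d}" for d
        using anti[of "k + 2" d] \<tau>(1)[of "Suc d"] that by (auto simp: whit_eq early_eq)
    qed simp
  qed
  finally show ?thesis by (auto intro: add_left_mono)
qed

end

section \<open>From bounds at points to lower sums over boxes\<close>

lemma le_cmult_INF:
  fixes \<phi> :: "'a \<Rightarrow> ennreal"
  assumes "0 < C" "\<And>p. p \<in> G \<Longrightarrow> x \<le> ennreal C * \<phi> p"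
  shows "x \<le> ennreal C * (INF p\<in>G. \<phi> p)"
proof -
  have inv: "ennreal (1 / C) * (ennreal C * y) = y" "ennreal C * (ennreal (1 / C) * y) = y" for y
    using assms(1) by (simp_all add: mult.assoc[symmetric] ennreal_mult[symmetric])
  have "ennreal (1 / C) * x \<le> (INF p\<in>G. \<phi> p)"
  proof (rule INF_greatest)
    fix p assume "p \<in> G"
    from mult_left_mono[OF assms(2)[OF this], of "ennreal (1 / C)"]
    show "ennreal (1 / C) * x \<le> \<phi> p" by (simp add: inv)
  qed
  from mult_left_mono[OF this, of "ennreal C"] show ?thesis by (simp add: inv)
qed

context singular
begin

text \<open>The time interval is ((2 Z)^m, (4 Z)^m). It starts where \<open>broad\<close> ends, so
  that all windows lie below it, and successive dyadic Z give disjoint intervals.\<close>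

definition upper_box :: "real \<Rightarrow> (real ^ 'n) set \<Rightarrow> (real \<times> (real ^ 'n)) set" where
  "upper_box Z Y = {Z powr m / q<..<Z powr m / q\<^sup>2} \<times> Y"

text \<open>Common integrand of the three model terms: the lower ends \<open>\<sigma> t\<close> and
  \<open>\<sigma>' t\<close> of the time windows are 0 for \<open>H_ca\<close> and c^m t for
  \<open>H_w\<close>.\<close>

definition Phi :: "ennreal \<Rightarrow> ennreal \<Rightarrow> (real \<Rightarrow> real) \<Rightarrow> (real \<Rightarrow> real) \<Rightarrow>
    (real \<times> (real ^ 'n) \<Rightarrow> complex) \<Rightarrow> (real \<times> (real ^ 'n) \<Rightarrow> complex) \<Rightarrow> real \<Rightarrow> real \<times> (real ^ 'n) \<Rightarrow> ennreal" where
  "Phi a b \<sigma> \<sigma>' f g \<delta> = (\<lambda>(t, x). ennreal (t powr \<kappa>)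
     * avg a {\<sigma> t<..<t} (\<lambda>s. avg ux (ball x ((\<delta> * t) powr (1 / m))) (\<lambda>y. ennreal (norm (f (s, y)))))
     * avg (conj_exp b) {\<sigma>' t<..<t} (\<lambda>s. avg (conj_exp vx) (ball x ((\<delta> * t) powr (1 / m))) (\<lambda>y. ennreal (norm (g (s, y))))))"

lemma upper_box_borel: "Y \<in> sets borel \<Longrightarrow> upper_box Z Y \<in> sets borel"
  unfolding upper_box_def by (intro borel_Times) auto

lemma upper_box_half_space: "0 < Z \<Longrightarrow> upper_box Z Y \<subseteq> half_space"
proof -
  assume "0 < Z"
  then have "0 < Z powr m / q" using q_bounds by simp
  then show ?thesis by (auto simp: upper_box_def half_space_def)
qed

lemma upper_box_sets_hs: "0 < Z \<Longrightarrow> Y \<in> sets borel \<Longrightarrow> upper_box Z Y \<in> sets hs_measure"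
  using upper_box_borel[of Y Z] upper_box_half_space[of Z Y]
  by (auto simp: hs_measure_def sets_restrict_space_iff)

lemma emeasure_upper_box:
  assumes "0 < Z" "cube z h Y"
  shows "ennreal (Z powr m * h powr n) \<le> emeasure hs_measure (upper_box Z Y)"
proof -
  have h: "0 < h" using assms(2) by (rule cube_pos)
  have Y: "Y \<in> sets borel" using assms(2) by (rule cube_borel)
  let ?\<tau> = "Z powr m"
  have \<tau>: "0 < ?\<tau>" using assms by simp
  have "?\<tau> / q\<^sup>2 - ?\<tau> / q = ?\<tau> / q * (1 / q - 1)" using q_bounds by (simp add: field_simps power2_eq_square)
  also have "\<dots> \<ge> ?\<tau> / 1 * 1"
  proof (intro mult_mono frac_le)
    show "1 \<le> 1 / q - 1" using q_bounds by (simp add: field_simps)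
  qed (use q_bounds \<tau> in auto)
  finally have le: "?\<tau> \<le> ?\<tau> / q\<^sup>2 - ?\<tau> / q" by simp
  have "emeasure hs_measure (upper_box Z Y) = emeasure lborel (upper_box Z Y)"
    unfolding hs_measure_def using upper_box_half_space[OF assms(1)] by (intro emeasure_restrict_space) auto
  also have "\<dots> = emeasure (lborel \<Otimes>\<^sub>M lborel) ({?\<tau> / q<..<?\<tau> / q\<^sup>2} \<times> Y)"
    by (simp add: upper_box_def lborel_prod)
  also have "\<dots> = emeasure lborel {?\<tau> / q<..<?\<tau> / q\<^sup>2} * emeasure lborel Y"
    using Y by (intro lborel.emeasure_pair_measure_Times) auto
  also have "\<dots> = ennreal (?\<tau> / q\<^sup>2 - ?\<tau> / q) * ennreal (h ^ CARD('n))"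
  proof -
    have "?\<tau> / q \<le> ?\<tau> / q\<^sup>2" using le \<tau> by linarith
    then show ?thesis by (simp add: emeasure_cube[OF assms(2)])
  qed
  finally show ?thesis
    using le \<tau> h by (auto simp: card powr_realpow ennreal_mult[symmetric] intro!: ennreal_leI mult_right_mono)
qed

definition box_bound :: "ennreal \<Rightarrow> ennreal \<Rightarrow> (real \<Rightarrow> real) \<Rightarrow> (real \<Rightarrow> real) \<Rightarrow> real \<Rightarrow> bool" where
  "box_bound a b \<sigma> \<sigma>' K \<longleftrightarrow> (\<forall>f\<in>Linf_c. \<forall>g\<in>Linf_c. \<forall>Z l X Y E F z K1. 0 < Z \<longrightarrow> cube z (2 ^ l * Z) Y \<longrightarrow>
      X \<in> sets borel \<longrightarrow> E \<in> sets borel \<longrightarrow> F \<in> sets borel \<longrightarrow>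
      (\<forall>t. Z powr m / q < t \<longrightarrow> t < Z powr m / q\<^sup>2 \<longrightarrow>
         0 \<le> \<sigma> t \<and> \<sigma> t < t \<and> E \<subseteq> {\<sigma> t<..<t} \<and> 0 \<le> \<sigma>' t \<and> \<sigma>' t < t \<and> F \<subseteq> {\<sigma>' t<..<t}) \<longrightarrow>
      (\<forall>x\<in>Y. \<forall>y\<in>X. dist x y \<le> 4 * sqrt n * (2 ^ l * Z)) \<longrightarrow> 0 < K1 \<longrightarrow>
      mixed_norm b vx (cut (F \<times> Y) (T (cut (E \<times> X) f))) \<le> ennreal (K1 * kbound a b Z l) * mixed_norm a ux (cut (E \<times> X) f) \<longrightarrow>
      J f g (E \<times> X) (F \<times> Y) \<le> ennreal (K * K1 * 2 powr (- (real l * m * A))) *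
        ((INF p\<in>upper_box Z Y. Phi a b \<sigma> \<sigma>' f g (dilation l) p) * emeasure hs_measure (upper_box Z Y)))"

text \<open>The bound holds at every point of the box, hence for the infimum, and its factor Z^m
  (2^l Z)^n is at most the measure of the box.\<close>

lemma key_INF:
  fixes a b :: ennreal and \<sigma> \<sigma>' :: "real \<Rightarrow> real"
  assumes ab: "1 \<le> a" "1 \<le> b"
  shows "\<exists>K>0. box_bound a b \<sigma> \<sigma>' K"
proof -
  obtain K where K: "0 < K" "pointwise_bound a b K" using key_estimate[OF ab] by blast
  note key = K(2)[unfolded pointwise_bound_def]
  show ?thesis
    unfolding box_bound_def
  proof (intro exI[of _ K] conjI ballI allI impI)
    fix f g :: "real \<times> (real ^ 'n) \<Rightarrow> complex" and Z K1 :: real and l :: nat and X Y :: "(real ^ 'n) set" and E F z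
    assume f: "f \<in> Linf_c" and g: "g \<in> Linf_c" and Z: "0 < Z" and Y: "cube z (2 ^ l * Z) Y" and X: "X \<in> sets borel"
      and E: "E \<in> sets borel" and F: "F \<in> sets borel"
      and win: "\<forall>t. Z powr m / q < t \<longrightarrow> t < Z powr m / q\<^sup>2 \<longrightarrow>
         0 \<le> \<sigma> t \<and> \<sigma> t < t \<and> E \<subseteq> {\<sigma> t<..<t} \<and> 0 \<le> \<sigma>' t \<and> \<sigma>' t < t \<and> F \<subseteq> {\<sigma>' t<..<t}"
      and dist: "\<forall>x\<in>Y. \<forall>y\<in>X. dist x y \<le> 4 * sqrt n * (2 ^ l * Z)" and K1: "0 < K1"
      and bd: "mixed_norm b vx (cut (F \<times> Y) (T (cut (E \<times> X) f))) \<le> ennreal (K1 * kbound a b Z l) * mixed_norm a ux (cut (E \<times> X) f)"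
    let ?h = "2 ^ l * Z"
    let ?w = "K * K1 * 2 powr (- (real l * m * A))" and ?V = "Z powr m * ?h powr n"
    have Yd: "dist x y \<le> 4 * sqrt n * ?h" if "x \<in> Y" "y \<in> Y" for x y
      using near_geometry(1,2)[OF Y] that by (auto simp: card)
    have pos: "0 < ?w" "0 < ?V" using K(1) K1 Z by auto
    have "J f g (E \<times> X) (F \<times> Y) \<le> ennreal (?w * ?V) * (INF p\<in>upper_box Z Y. Phi a b \<sigma> \<sigma>' f g (dilation l) p)"
    proof (rule le_cmult_INF)
      show "0 < ?w * ?V" using pos by simp
      fix p assume "p \<in> upper_box Z Y"
      then obtain t x where p: "p = (t, x)" and t: "Z powr m / q < t" "t < Z powr m / q\<^sup>2" and x: "x \<in> Y"
        by (auto simp: upper_box_def)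
      have w: "0 \<le> \<sigma> t" "\<sigma> t < t" "E \<subseteq> {\<sigma> t<..<t}" "0 \<le> \<sigma>' t" "\<sigma>' t < t" "F \<subseteq> {\<sigma>' t<..<t}"
        using win t by auto
      show "J f g (E \<times> X) (F \<times> Y) \<le> ennreal (?w * ?V) * Phi a b \<sigma> \<sigma>' f g (dilation l) p"
        unfolding p Phi_def prod.case
        by (rule key[rule_format, OF f g Z t w(1,2) E w(3) X _ w(4,5) F w(6) cube_borel[OF Y]])
          (use dist x Yd K1 bd in auto)
    qed
    also have "\<dots> = ennreal ?w * ((INF p\<in>upper_box Z Y. Phi a b \<sigma> \<sigma>' f g (dilation l) p) * ennreal ?V)"
      using pos by (subst ennreal_mult) (auto simp: mult_ac)
    also have "\<dots> \<le> ennreal ?w * ((INF p\<in>upper_box Z Y. Phi a b \<sigma> \<sigma>' f g (dilation l) p) * emeasure hs_measure (upper_box Z Y))"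
      by (intro mult_left_mono emeasure_upper_box[OF Z Y]) auto
    finally show "J f g (E \<times> X) (F \<times> Y) \<le> ennreal ?w *
        ((INF p\<in>upper_box Z Y. Phi a b \<sigma> \<sigma>' f g (dilation l) p) * emeasure hs_measure (upper_box Z Y))" .
  qed (rule K(1))
qed

abbreviation "full \<equiv> (\<lambda>t :: real. 0 :: real)"
abbreviation "local \<equiv> (\<lambda>t. c powr m * t)"

text \<open>The four powers of \<open>q\<close> are used up here: c^m t \<le> q^4 Z^m / q^2 = q^2
  Z^m, which is the lower end of \<open>broad\<close>.\<close>

lemma windows:
  assumes "0 < Z" "Z powr m / q < t" "t < Z powr m / q\<^sup>2"
  shows "0 < t" "local t < t" "0 \<le> local t" "early (Z powr m) \<subseteq> {0<..<t}"
    "whit (Z powr m) \<subseteq> {local t<..<t}" "broad (Z powr m) \<subseteq> {local t<..<t}"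
proof -
  let ?\<tau> = "Z powr m"
  have \<tau>: "0 < ?\<tau>" using assms by simp
  show t: "0 < t" using assms \<tau> q_bounds by (smt (verit) divide_pos_pos)
  have "c powr m \<le> q ^ 4" by (rule c_powr)
  then have "c powr m * t \<le> q ^ 4 * (?\<tau> / q\<^sup>2)"
    using assms t by (intro mult_mono) auto
  also have "\<dots> = q\<^sup>2 * ?\<tau>" using q_bounds by (simp add: field_simps power2_eq_square power4_eq_xxxx)
  finally have lo: "c powr m * t \<le> q\<^sup>2 * ?\<tau>" .
  have b: "2 * ?\<tau> \<le> ?\<tau> / q" using broad_whit(8)[OF \<tau>] .
  note qt = q_time[OF \<tau>]
  have q2: "q\<^sup>2 * ?\<tau> \<le> q * ?\<tau>" "q\<^sup>2 * ?\<tau> < t" using qt b assms \<tau> by linarith+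
  show "local t < t" using lo q2 by simp
  show "0 \<le> local t" using t by simp
  show "early ?\<tau> \<subseteq> {0<..<t}" using q2 by (auto simp: early_def)
  have "c powr m * t \<le> q * ?\<tau>" "?\<tau> < t" using lo q2 b assms \<tau> by linarith+
  then show "whit ?\<tau> \<subseteq> {local t<..<t}" by (auto simp: whit_def simp del: mult_le_cancel_right)
  show "broad ?\<tau> \<subseteq> {local t<..<t}" using lo assms by (auto simp: broad_def)
qed

lemma window_borel: "early \<tau> \<in> sets borel" "whit \<tau> \<in> sets borel" "broad \<tau> \<in> sets borel"
  by (auto simp: early_def whit_def broad_def)

text \<open>Leaving the windows and the integrand open allows all three combinations of windows to
  share one summation over the tree.\<close>

definition far_bound :: "(real \<Rightarrow> real set) \<Rightarrow> (real \<Rightarrow> real set) \<Rightarrow>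
    ((real \<times> (real ^ 'n) \<Rightarrow> complex) \<Rightarrow> (real \<times> (real ^ 'n) \<Rightarrow> complex) \<Rightarrow> real \<Rightarrow> real \<times> (real ^ 'n) \<Rightarrow> ennreal) \<Rightarrow> real \<Rightarrow> bool" where
  "far_bound E F \<Phi> K \<longleftrightarrow> (\<forall>f\<in>Linf_c. \<forall>g\<in>Linf_c. \<forall>Z l X Y z. 0 < Z \<longrightarrow> separated (2 ^ l * Z) X Y \<longrightarrow> cube z (2 ^ l * Z) Y \<longrightarrow>
     (\<forall>x\<in>Y. \<forall>y\<in>X. dist x y \<le> 4 * sqrt n * (2 ^ l * Z)) \<longrightarrow>
     J f g (E (Z powr m) \<times> X) (F (Z powr m) \<times> Y) \<le> ennreal (K * 2 powr (- (real l * m * A))) *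
        ((INF p\<in>upper_box Z Y. \<Phi> f g (dilation l) p) * emeasure hs_measure (upper_box Z Y)))"

definition near_bound :: "(real \<Rightarrow> real set) \<Rightarrow> (real \<Rightarrow> real set) \<Rightarrow>
    ((real \<times> (real ^ 'n) \<Rightarrow> complex) \<Rightarrow> (real \<times> (real ^ 'n) \<Rightarrow> complex) \<Rightarrow> real \<Rightarrow> real \<times> (real ^ 'n) \<Rightarrow> ennreal) \<Rightarrow> real \<Rightarrow> bool" where
  "near_bound E F \<Phi> K \<longleftrightarrow> (\<forall>f\<in>Linf_c. \<forall>g\<in>Linf_c. \<forall>Z N Q z. cube z Z Q \<longrightarrow> N \<in> sets borel \<longrightarrow> N \<subseteq> ccube z (3 * Z) \<longrightarrow>
     J f g (E (Z powr m) \<times> N) (F (Z powr m) \<times> Q) \<le> ennreal K *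
        ((INF p\<in>upper_box Z Q. \<Phi> f g (dilation 0) p) * emeasure hs_measure (upper_box Z Q)))"

lemma far_bound_separated:
  assumes "(E, F, \<sigma>, \<sigma>') = (early, whit, full, local) \<or> (E, F, \<sigma>, \<sigma>') = (whit, early, local, full)"
  shows "\<exists>K>0. far_bound E F (Phi ut vt \<sigma> \<sigma>') K"
proof -
  obtain K1 where K1: "0 < K1" "\<forall>f\<in>Linf_c. \<forall>Z l X Y E F. 0 < Z \<longrightarrow> early_late (Z powr m) E F \<longrightarrow> separated (2 ^ l * Z) X Y \<longrightarrow>
     mixed_norm vt vx (cut (F \<times> Y) (T (cut (E \<times> X) f)))
       \<le> ennreal (K1 * kbound ut vt Z l) * mixed_norm ut ux (cut (E \<times> X) f)"
    using far_separated_estimate by (elim exE conjE) (rule that)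
  obtain K where K: "0 < K" "box_bound ut vt \<sigma> \<sigma>' K" using key_INF[OF exps(2,4)] by blast
  note key = K(2)[unfolded box_bound_def]
  show ?thesis
    unfolding far_bound_def
  proof (intro exI[of _ "K * K1"] conjI ballI allI impI)
    show "0 < K * K1" using K(1) K1(1) by simp
    fix f g :: "real \<times> (real ^ 'n) \<Rightarrow> complex" and Z :: real and l :: nat and X Y :: "(real ^ 'n) set" and z
    assume h: "f \<in> Linf_c" "g \<in> Linf_c" "0 < Z" "separated (2 ^ l * Z) X Y" "cube z (2 ^ l * Z) Y"
      "\<forall>x\<in>Y. \<forall>y\<in>X. dist x y \<le> 4 * sqrt n * (2 ^ l * Z)"
    show "J f g (E (Z powr m) \<times> X) (F (Z powr m) \<times> Y) \<le> ennreal (K * K1 * 2 powr (- (real l * m * A))) *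
        ((INF p\<in>upper_box Z Y. Phi ut vt \<sigma> \<sigma>' f g (dilation l) p) * emeasure hs_measure (upper_box Z Y))"
    proof (rule key[rule_format, OF h(1,2,3,5)])
      show "X \<in> sets borel" using h(4) cube_borel by (auto simp: separated_def)
      show "E (Z powr m) \<in> sets borel" "F (Z powr m) \<in> sets borel" using assms window_borel by auto
      show "mixed_norm vt vx (cut (F (Z powr m) \<times> Y) (T (cut (E (Z powr m) \<times> X) f)))
        \<le> ennreal (K1 * kbound ut vt Z l) * mixed_norm ut ux (cut (E (Z powr m) \<times> X) f)"
        by (rule K1(2)[rule_format, OF h(1,3) _ h(4)]) (use assms in \<open>auto simp: early_late_def\<close>)
      fix t assume "Z powr m / q < t" "t < Z powr m / q\<^sup>2"
      from windows[OF h(3) this]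
      show "0 \<le> \<sigma> t \<and> \<sigma> t < t \<and> E (Z powr m) \<subseteq> {\<sigma> t<..<t} \<and> 0 \<le> \<sigma>' t \<and> \<sigma>' t < t \<and> F (Z powr m) \<subseteq> {\<sigma>' t<..<t}"
        using assms by auto
    qed (use h K1 in auto)
  qed
qed

lemma near_bound_separated:
  assumes "(E, F, \<sigma>, \<sigma>') = (early, whit, full, local) \<or> (E, F, \<sigma>, \<sigma>') = (whit, early, local, full)"
  shows "\<exists>K>0. near_bound E F (Phi ut vt \<sigma> \<sigma>') K"
proof -
  obtain K1 where K1: "0 < K1" "\<forall>f\<in>Linf_c. \<forall>Z z Q E F. cube z Z Q \<longrightarrow> early_late (Z powr m) E F \<longrightarrow>
     mixed_norm vt vx (cut (F \<times> Q) (T (cut (E \<times> ccube z (3 * Z)) f)))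
       \<le> ennreal (K1 * kbound ut vt Z 0) * mixed_norm ut ux (cut (E \<times> ccube z (3 * Z)) f)"
    using near_separated_estimate by (elim exE conjE) (rule that)
  obtain K where K: "0 < K" "box_bound ut vt \<sigma> \<sigma>' K" using key_INF[OF exps(2,4)] by blast
  note key = K(2)[unfolded box_bound_def]
  show ?thesis
    unfolding near_bound_def
  proof (intro exI[of _ "K * K1"] conjI ballI allI impI)
    show "0 < K * K1" using K(1) K1(1) by simp
    fix f g :: "real \<times> (real ^ 'n) \<Rightarrow> complex" and Z :: real and N Q :: "(real ^ 'n) set" and z
    assume f: "f \<in> Linf_c" and g: "g \<in> Linf_c" and Q: "cube z Z Q" and N: "N \<in> sets borel" "N \<subseteq> ccube z (3 * Z)"
    have Z: "0 < Z" using Q by (rule cube_pos)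
    let ?E = "E (Z powr m)" and ?F = "F (Z powr m)"
    have E: "?E \<in> sets borel" "?F \<in> sets borel" using assms window_borel by auto
    have Q0: "cube z (2 ^ 0 * Z) Q" using Q by simp
    \<comment> \<open>The bound for the tripled cube is applied to \<open>f\<close> cut to
      \<open>N\<close>; its source is then \<open>N\<close> itself, which need not be a
      cube.\<close>
    let ?f = "cut (UNIV \<times> N) f"
    have f': "?f \<in> Linf_c" using f N by (intro Linf_c_cut borel_Times) auto
    have eq: "cut (?E \<times> ccube z (3 * Z)) ?f = cut (?E \<times> N) f"
      using N(2) by (auto simp: cut_def indicator_def fun_eq_iff)
    have "J f g (?E \<times> N) (?F \<times> Q) \<le> ennreal (K * K1 * 2 powr (- (real 0 * m * A))) *
        ((INF p\<in>upper_box Z Q. Phi ut vt \<sigma> \<sigma>' f g (dilation 0) p) * emeasure hs_measure (upper_box Z Q))"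
    proof (rule key[rule_format, OF f g Z Q0 N(1) E])
      show "mixed_norm vt vx (cut (?F \<times> Q) (T (cut (?E \<times> N) f)))
        \<le> ennreal (K1 * kbound ut vt Z 0) * mixed_norm ut ux (cut (?E \<times> N) f)"
        unfolding eq[symmetric]
        by (rule K1(2)[rule_format, OF f' Q]) (use assms in \<open>auto simp: early_late_def\<close>)
      show "dist x y \<le> 4 * sqrt n * (2 ^ 0 * Z)" if "x \<in> Q" "y \<in> N" for x y
        using near_geometry(2)[OF Q] N that by (auto simp: card)
      fix t assume "Z powr m / q < t" "t < Z powr m / q\<^sup>2"
      from windows[OF Z this]
      show "0 \<le> \<sigma> t \<and> \<sigma> t < t \<and> ?E \<subseteq> {\<sigma> t<..<t} \<and> 0 \<le> \<sigma>' t \<and> \<sigma>' t < t \<and> ?F \<subseteq> {\<sigma>' t<..<t}"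
        using assms by auto
    qed (rule K1)
    then show "J f g (?E \<times> N) (?F \<times> Q) \<le> ennreal (K * K1) *
        ((INF p\<in>upper_box Z Q. Phi ut vt \<sigma> \<sigma>' f g (dilation 0) p) * emeasure hs_measure (upper_box Z Q))" by simp
  qed
qed

lemma far_bound_comparable: "\<exists>K>0. far_bound broad whit (Phi r r local local) K"
proof -
  obtain K1 where K1: "0 < K1" "\<forall>f\<in>Linf_c. \<forall>Z l X Y. 0 < Z \<longrightarrow> separated (2 ^ l * Z) X Y \<longrightarrow>
     mixed_norm r vx (cut (whit (Z powr m) \<times> Y) (T (cut (broad (Z powr m) \<times> X) f)))
       \<le> ennreal (K1 * kbound r r Z l) * mixed_norm r ux (cut (broad (Z powr m) \<times> X) f)"
    using far_comparable_estimate by (elim exE conjE) (rule that)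
  obtain K where K: "0 < K" "box_bound r r local local K" using key_INF[OF exps(1,1)] by blast
  note key = K(2)[unfolded box_bound_def]
  show ?thesis
    unfolding far_bound_def
  proof (intro exI[of _ "K * K1"] conjI ballI allI impI)
    show "0 < K * K1" using K(1) K1(1) by simp
    fix f g :: "real \<times> (real ^ 'n) \<Rightarrow> complex" and Z :: real and l :: nat and X Y :: "(real ^ 'n) set" and z
    assume h: "f \<in> Linf_c" "g \<in> Linf_c" "0 < Z" "separated (2 ^ l * Z) X Y" "cube z (2 ^ l * Z) Y"
      "\<forall>x\<in>Y. \<forall>y\<in>X. dist x y \<le> 4 * sqrt n * (2 ^ l * Z)"
    show "J f g (broad (Z powr m) \<times> X) (whit (Z powr m) \<times> Y) \<le> ennreal (K * K1 * 2 powr (- (real l * m * A))) *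
        ((INF p\<in>upper_box Z Y. Phi r r local local f g (dilation l) p) * emeasure hs_measure (upper_box Z Y))"
    proof (rule key[rule_format, OF h(1,2,3,5) _ window_borel(3,2)])
      show "X \<in> sets borel" using h(4) cube_borel by (auto simp: separated_def)
      show "mixed_norm r vx (cut (whit (Z powr m) \<times> Y) (T (cut (broad (Z powr m) \<times> X) f)))
        \<le> ennreal (K1 * kbound r r Z l) * mixed_norm r ux (cut (broad (Z powr m) \<times> X) f)"
        by (rule K1(2)[rule_format, OF h(1,3,4)])
      fix t assume "Z powr m / q < t" "t < Z powr m / q\<^sup>2"
      from windows[OF h(3) this]
      show "0 \<le> local t \<and> local t < t \<and> broad (Z powr m) \<subseteq> {local t<..<t} \<and> 0 \<le> local t \<and> local t < t \<and> whit (Z powr m) \<subseteq> {local t<..<t}"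
        by auto
    qed (use h K1 in auto)
  qed
qed

end

lemma AE_superset_same_measure:
  assumes "E' \<in> sets M" "E \<in> sets M" "E' \<subseteq> E" "emeasure M E = emeasure M E'" "emeasure M E' \<noteq> \<infinity>"
  shows "AE z in M. z \<in> E \<longrightarrow> z \<in> E'"
proof (rule AE_I)
  show "{z \<in> space M. \<not> (z \<in> E \<longrightarrow> z \<in> E')} \<subseteq> E - E'" by auto
  show "E - E' \<in> sets M" using assms by auto
  show "emeasure M (E - E') = 0" using assms by (subst emeasure_Diff) auto
qed

lemma emeasure_Times:
  fixes A :: "'a::euclidean_space set" and B :: "'b::euclidean_space set"
  assumes "A \<in> sets borel" "B \<in> sets borel"
  shows "emeasure lborel (A \<times> B) = emeasure lborel A * emeasure lborel B"
  using lborel.emeasure_pair_measure_Times[of A lborel B] assms by (simp add: lborel_prod)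

section \<open>Packing of boxes and summation over all scales\<close>

context singular
begin

text \<open>For fixed l, boxes with the same d stand over disjoint cubes of one level, and boxes
  with different d have disjoint time intervals. For l <= d the cubes of level d - l have side 2^l L
  d; for l > d the truncated difference gives the root, and the boxes are still disjoint.\<close>

lemma packing:
  fixes \<phi> :: "real \<times> (real ^ 'n) \<Rightarrow> ennreal"
  assumes tree: "dyadic_tree P Q0 L" and D: "finite D"
  shows "(\<Sum>d\<in>D. \<Sum>Y\<in>P (d - l). (INF p\<in>upper_box (L d) Y. \<phi> p) * emeasure hs_measure (upper_box (L d) Y))
    \<le> (\<integral>\<^sup>+ p. \<phi> p \<partial>hs_measure)"
proof -
  interpret dyadic_tree P Q0 L by fact
  let ?S = "Sigma D (\<lambda>d. P (d - l))" and ?G = "\<lambda>(d, Y). upper_box (L d) Y"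
  have "(\<Sum>d\<in>D. \<Sum>Y\<in>P (d - l). (INF p\<in>upper_box (L d) Y. \<phi> p) * emeasure hs_measure (upper_box (L d) Y))
      = (\<Sum>i\<in>?S. (INF p\<in>?G i. \<phi> p) * emeasure hs_measure (?G i))"
    using D finite_P by (subst sum.Sigma) (auto simp: case_prod_unfold)
  also have "\<dots> \<le> (\<integral>\<^sup>+ p. \<phi> p \<partial>hs_measure)"
  proof (rule disjoint_lower_sum)
    show "finite ?S" using D finite_P by auto
    show "?G i \<in> sets hs_measure" if "i \<in> ?S" for i
      using that upper_box_sets_hs L_pos P_borel by auto
    have lt: "upper_box (L d) Y \<inter> upper_box (L e) Y' = {}" if "d < e" for d e Y Y'
    proof -
      have "L d = L e * 2 ^ (e - d)"
      proof -
        have "(2::real) ^ e = 2 ^ (e - d) * 2 ^ d" using that by (simp add: power_add[symmetric])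
        then show ?thesis using L_eq[of d e] by simp
      qed
      moreover have "(2::real) ^ 1 \<le> 2 ^ (e - d)" using that by (intro power_increasing) auto
      then have "L e * 2 \<le> L e * 2 ^ (e - d)" using L_pos[of e] by (intro mult_left_mono) auto
      ultimately have "4 * L e \<le> 2 * L d" by simp
      then have "(4 * L e) powr m \<le> (2 * L d) powr m" using L_pos[of e] m by (intro powr_mono2) auto
      then show ?thesis using L_pos by (auto simp: upper_box_def time_div_q)
    qed
    show "disjoint_family_on ?G ?S"
      unfolding disjoint_family_on_def
    proof (intro ballI impI)
      fix i j assume ij: "i \<in> ?S" "j \<in> ?S" "i \<noteq> j"
      obtain d Y where i: "i = (d, Y)" by (cases i)
      obtain e Y' where j: "j = (e, Y')" by (cases j)
      consider "d < e" | "e < d" | "d = e" "Y \<noteq> Y'" using ij i j by fastforce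
      then show "?G i \<inter> ?G j = {}"
      proof cases
        case 3
        then have "Y \<inter> Y' = {}" using P_disjoint[of Y "d - l" Y'] ij i j by blast
        then show ?thesis by (auto simp: i j upper_box_def)
      next
        case 1
        then show ?thesis using lt[of d e Y Y'] by (simp add: i j)
      next
        case 2
        then show ?thesis using lt[of e d Y' Y] by (simp add: i j Int_commute)
      qed
    qed
  qed
  finally show ?thesis .
qed

text \<open>A cube \<open>Y\<close> of level e + 1 has side 2^l L d with l = d - (e + 1). Sorting by
  l produces one packed family of boxes for each l, and the bound 8^n on the number of far partners
  of \<open>Y\<close> enters the constant.\<close>

lemma far_sum:
  assumes tree: "dyadic_tree P Q0 L" and far: "far_bound E F \<Phi> K" and K: "0 < K"
    and f: "f \<in> Linf_c" and g: "g \<in> Linf_c"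
  shows "(\<Sum>d\<le>N. \<Sum>e<d. \<Sum>Y\<in>P (Suc e). \<Sum>X\<in>dyadic_tree.far P e Y.
        J f g (E (L d powr m) \<times> X) (F (L d powr m) \<times> Y))
    \<le> ennreal (8 ^ CARD('n) * K) * (\<Sum>l\<le>N. ennreal (2 powr (- (real l * m * A))) * (\<integral>\<^sup>+ p. \<Phi> f g (dilation l) p \<partial>hs_measure))"
proof -
  interpret dyadic_tree P Q0 L by fact
  let ?I = "\<lambda>d l Y. (INF p\<in>upper_box (L d) Y. \<Phi> f g (dilation l) p) * emeasure hs_measure (upper_box (L d) Y)"
  let ?w = "\<lambda>l. ennreal (2 powr (- (real l * m * A)))"
  let ?c = "ennreal (8 ^ CARD('n) * K)"
  let ?a = "\<lambda>d l. \<Sum>Y\<in>P (d - l). ?c * ?w l * ?I d l Y"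
  have step: "(\<Sum>Y\<in>P (Suc e). \<Sum>X\<in>far e Y. J f g (E (L d powr m) \<times> X) (F (L d powr m) \<times> Y)) \<le> ?a d (d - Suc e)"
    if "e < d" for d e
  proof -
    let ?l = "d - Suc e"
    have dl: "d - ?l = Suc e" using that by simp
    have scale: "2 ^ ?l * L d = L (Suc e)"
    proof -
      have "(2::real) ^ d = 2 ^ ?l * 2 ^ (Suc e)" unfolding power_add[symmetric] using that by simp
      then show ?thesis using L_eq[of "Suc e" d] by simp
    qed
    have "(\<Sum>X\<in>far e Y. J f g (E (L d powr m) \<times> X) (F (L d powr m) \<times> Y)) \<le> ?c * ?w ?l * ?I d ?l Y"
      if Y: "Y \<in> P (Suc e)" for Y
    proof -
      have "(\<Sum>X\<in>far e Y. J f g (E (L d powr m) \<times> X) (F (L d powr m) \<times> Y))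
          \<le> of_nat (card (far e Y)) * (ennreal (K * 2 powr (- (real ?l * m * A))) * ?I d ?l Y)"
      proof (rule sum_bounded_above)
        fix X assume X: "X \<in> far e Y"
        note geo = far_geometry[OF Y X]
        have "X \<in> P (Suc e)" using X by (simp add: far_def)
        then have "separated (2 ^ ?l * L d) X Y"
          unfolding scale separated_def using geo(2-5)[folded card] cube_centre[OF Y] cube_centre[of X] by blast
        then show "J f g (E (L d powr m) \<times> X) (F (L d powr m) \<times> Y)
            \<le> ennreal (K * 2 powr (- (real ?l * m * A))) * ?I d ?l Y"
          using far[unfolded far_bound_def, rule_format, OF f g L_pos, of ?l d X Y "centre Y"]
            cube_centre[OF Y] geo(1) by (auto simp: scale card)
      qed
      also have "\<dots> \<le> of_nat (8 ^ CARD('n)) * (ennreal (K * 2 powr (- (real ?l * m * A))) * ?I d ?l Y)"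
        using card_far[OF Y] by (intro mult_right_mono of_nat_mono) auto
      also have "\<dots> = ?c * ?w ?l * ?I d ?l Y"
      proof -
        have "(of_nat (8 ^ CARD('n)) :: ennreal) = ennreal (8 ^ CARD('n))"
          by (subst ennreal_of_nat_eq_real_of_nat) simp
        then show ?thesis using K by (simp add: ennreal_mult mult_ac)
      qed
      finally show ?thesis .
    qed
    then show ?thesis unfolding dl by (intro sum_mono)
  qed
  have "(\<Sum>d\<le>N. \<Sum>e<d. \<Sum>Y\<in>P (Suc e). \<Sum>X\<in>far e Y. J f g (E (L d powr m) \<times> X) (F (L d powr m) \<times> Y))
      \<le> (\<Sum>d\<le>N. \<Sum>e<d. ?a d (d - Suc e))"
    by (intro sum_mono step) auto
  also have "\<dots> = (\<Sum>d\<le>N. \<Sum>l<d. ?a d l)"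
    by (intro sum.cong refl sum.nat_diff_reindex)
  also have "\<dots> = (\<Sum>d\<le>N. \<Sum>l\<in>{l. l \<in> {..N} \<and> l < d}. ?a d l)"
    by (intro sum.cong refl) auto
  also have "\<dots> = (\<Sum>l\<le>N. \<Sum>d\<in>{d. d \<in> {..N} \<and> l < d}. ?a d l)"
    by (rule sum.swap_restrict) auto
  also have "\<dots> \<le> (\<Sum>l\<le>N. ?c * (?w l * (\<integral>\<^sup>+ p. \<Phi> f g (dilation l) p \<partial>hs_measure)))"
  proof (rule sum_mono)
    fix l
    have "(\<Sum>d\<in>{d. d \<in> {..N} \<and> l < d}. ?a d l) = ?c * ?w l * (\<Sum>d\<in>{d. d \<in> {..N} \<and> l < d}. \<Sum>Y\<in>P (d - l). ?I d l Y)"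
      by (simp only: sum_distrib_left)
    also have "\<dots> \<le> ?c * ?w l * (\<integral>\<^sup>+ p. \<Phi> f g (dilation l) p \<partial>hs_measure)"
      by (intro mult_left_mono packing[OF tree]) auto
    finally show "(\<Sum>d\<in>{d. d \<in> {..N} \<and> l < d}. ?a d l) \<le> ?c * (?w l * (\<integral>\<^sup>+ p. \<Phi> f g (dilation l) p \<partial>hs_measure))"
      by (simp only: mult.assoc)
  qed
  finally show ?thesis by (simp only: sum_distrib_left)
qed

lemma near_sum:
  assumes tree: "dyadic_tree P Q0 L" and near: "near_bound E F \<Phi> K"
    and f: "f \<in> Linf_c" and g: "g \<in> Linf_c"
  shows "(\<Sum>d\<le>N. \<Sum>Q\<in>P d. J f g (E (L d powr m) \<times> \<Union> (dyadic_tree.near P d Q)) (F (L d powr m) \<times> Q))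
    \<le> ennreal K * (\<integral>\<^sup>+ p. \<Phi> f g (dilation 0) p \<partial>hs_measure)"
proof -
  interpret dyadic_tree P Q0 L by fact
  have "(\<Sum>d\<le>N. \<Sum>Q\<in>P d. J f g (E (L d powr m) \<times> \<Union> (near d Q)) (F (L d powr m) \<times> Q))
    \<le> (\<Sum>d\<le>N. \<Sum>Q\<in>P d. ennreal K * ((INF p\<in>upper_box (L d) Q. \<Phi> f g (dilation 0) p) * emeasure hs_measure (upper_box (L d) Q)))"
  proof (intro sum_mono)
    fix d Q assume Q: "Q \<in> P d"
    have "\<Union> (near d Q) \<in> sets borel"
      using finite_near P_borel by (intro sets.finite_Union) (auto simp: near_def)
    then show "J f g (E (L d powr m) \<times> \<Union> (near d Q)) (F (L d powr m) \<times> Q)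
      \<le> ennreal K * ((INF p\<in>upper_box (L d) Q. \<Phi> f g (dilation 0) p) * emeasure hs_measure (upper_box (L d) Q))"
      using near[unfolded near_bound_def] f g cube_centre[OF Q] near_subset[OF Q] by blast
  qed
  also have "\<dots> = ennreal K * (\<Sum>d\<le>N. \<Sum>Q\<in>P d. (INF p\<in>upper_box (L d) Q. \<Phi> f g (dilation 0) p) * emeasure hs_measure (upper_box (L d) Q))"
    by (simp only: sum_distrib_left)
  also have "\<dots> \<le> ennreal K * (\<integral>\<^sup>+ p. \<Phi> f g (dilation 0) p \<partial>hs_measure)"
    using packing[OF tree, where D = "{..N}" and l = 0 and \<phi> = "\<Phi> f g (dilation 0)"] by (intro mult_left_mono) auto
  finally show ?thesis .
qed

definition series :: "(real \<Rightarrow> real \<times> (real ^ 'n) \<Rightarrow> ennreal) \<Rightarrow> ennreal" where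
  "series \<phi> = (\<Sum>j. ennreal (2 powr (- (real j * m * A))) * (\<integral>\<^sup>+ p. \<phi> (2 powr (real j * m)) p \<partial>hs_measure))"

text \<open>Piece l equals term l + l0 of the series up to the fixed factor 2^(l0 m A). The shifted
  partial sum omits only nonnegative terms.\<close>

lemma sum_le_series:
  "(\<Sum>l\<le>N. ennreal (2 powr (- (real l * m * A))) * (\<integral>\<^sup>+ p. \<phi> (dilation l) p \<partial>hs_measure))
    \<le> ennreal (2 powr (real l0 * m * A)) * series \<phi>"
proof -
  let ?u = "\<lambda>j. ennreal (2 powr (- (real j * m * A))) * (\<integral>\<^sup>+ p. \<phi> (2 powr (real j * m)) p \<partial>hs_measure)"
  have "ennreal (2 powr (- (real l * m * A))) * (\<integral>\<^sup>+ p. \<phi> (dilation l) p \<partial>hs_measure) = ennreal (2 powr (real l0 * m * A)) * ?u (l + l0)" for l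
  proof -
    have "2 powr (- (real l * m * A)) = 2 powr (real l0 * m * A) * 2 powr (- (real (l + l0) * m * A))"
      unfolding powr_add[symmetric] by (rule arg_cong) (simp add: algebra_simps)
    then show ?thesis by (simp add: dilation_def ennreal_mult mult.assoc)
  qed
  then have "(\<Sum>l\<le>N. ennreal (2 powr (- (real l * m * A))) * (\<integral>\<^sup>+ p. \<phi> (dilation l) p \<partial>hs_measure))
      = ennreal (2 powr (real l0 * m * A)) * (\<Sum>l\<le>N. ?u (l + l0))"
    by (simp only: sum_distrib_left)
  also have "\<dots> \<le> ennreal (2 powr (real l0 * m * A)) * series \<phi>"
  proof (rule mult_left_mono)
    have "(\<Sum>l\<le>N. ?u (l + l0)) = sum ?u ((\<lambda>l. l + l0) ` {..N})"
      by (subst sum.reindex) auto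
    also have "\<dots> \<le> suminf ?u" by (intro sum_le_suminf) auto
    finally show "(\<Sum>l\<le>N. ?u (l + l0)) \<le> series \<phi>" unfolding series_def .
  qed simp
  finally show ?thesis .
qed

lemma term_le_series:
  "(\<integral>\<^sup>+ p. \<phi> (dilation 0) p \<partial>hs_measure) \<le> ennreal (2 powr (real l0 * m * A)) * series \<phi>"
  using sum_le_series[where N = 0 and \<phi> = \<phi>] by simp

text \<open>The constant is quantified before the tree and the depth \<open>N\<close>, since both
  will be chosen according to the supports of \<open>f\<close> and \<open>g\<close>.\<close>

lemma separated_sum:
  assumes "(E, F, \<sigma>, \<sigma>') = (early, whit, full, local) \<or> (E, F, \<sigma>, \<sigma>') = (whit, early, local, full)"
  shows "\<exists>C>0. \<forall>P Q0 L N. \<forall>f\<in>Linf_c. \<forall>g\<in>Linf_c. dyadic_tree P Q0 L \<longrightarrow>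
    (\<Sum>d\<le>N. J f g (E (L d powr m) \<times> Q0) (F (L d powr m) \<times> Q0)) \<le> ennreal C * series (Phi ut vt \<sigma> \<sigma>' f g)"
proof -
  let ?\<Phi> = "Phi ut vt \<sigma> \<sigma>'"
  obtain K where K: "0 < K" "far_bound E F ?\<Phi> K" using far_bound_separated[OF assms] by blast
  obtain K' where K': "0 < K'" "near_bound E F ?\<Phi> K'" using near_bound_separated[OF assms] by blast
  let ?C = "(K' + 8 ^ CARD('n) * K) * 2 powr (real l0 * m * A)"
  show ?thesis
  proof (intro exI[of _ ?C] conjI allI ballI impI)
    show "0 < ?C" using K K' by (simp add: add_pos_pos)
    fix P :: "nat \<Rightarrow> (real ^ 'n) set set" and Q0 L and N :: nat and f g :: "real \<times> (real ^ 'n) \<Rightarrow> complex"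
    assume f: "f \<in> Linf_c" and g: "g \<in> Linf_c" and tree: "dyadic_tree P Q0 L"
    let ?S = "series (?\<Phi> f g)" and ?w = "ennreal (2 powr (real l0 * m * A))"
    have "(\<Sum>d\<le>N. J f g (E (L d powr m) \<times> Q0) (F (L d powr m) \<times> Q0)) \<le>
        (\<Sum>d\<le>N. (\<Sum>Q\<in>P d. J f g (E (L d powr m) \<times> \<Union> (dyadic_tree.near P d Q)) (F (L d powr m) \<times> Q))
        + (\<Sum>e<d. \<Sum>Y\<in>P (Suc e). \<Sum>X\<in>dyadic_tree.far P e Y. J f g (E (L d powr m) \<times> X) (F (L d powr m) \<times> Y)))"
      using assms window_borel by (intro sum_mono spatial_decomposition[OF tree f g]) auto
    also have "\<dots> \<le> ennreal K' * (?w * ?S) + ennreal (8 ^ CARD('n) * K) * (?w * ?S)"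
      unfolding sum.distrib
      by (intro add_mono order_trans[OF near_sum[OF tree K'(2) f g]] order_trans[OF far_sum[OF tree K(2,1) f g]]
        mult_left_mono term_le_series sum_le_series) auto
    also have "\<dots> = ennreal ?C * ?S"
      using K K' by (simp add: ennreal_mult ennreal_plus algebra_simps)
    finally show "(\<Sum>d\<le>N. J f g (E (L d powr m) \<times> Q0) (F (L d powr m) \<times> Q0)) \<le> ennreal ?C * ?S" .
  qed
qed

section \<open>The sparse sum\<close>

definition sparse_term :: "(real \<times> (real ^ 'n) \<Rightarrow> complex) \<Rightarrow> (real \<times> (real ^ 'n) \<Rightarrow> complex) \<Rightarrow> (real ^ 'n) set \<Rightarrow> ennreal" where
  "sparse_term f g Q = ennreal (side Q powr (m * \<kappa>))
        * avg r (whitney_enl m Q) (\<lambda>p. ennreal (norm (f p)))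
        * avg (conj_exp r) (whitney m Q) (\<lambda>p. ennreal (norm (g p)))
        * emeasure lborel (whitney m Q)"

text \<open>Translation between the Whitney regions of the theorem and the windows; they differ in
  endpoints of time intervals and faces of cubes, which form a null set.\<close>

lemma whitney_cube:
  fixes Q :: "(real ^ 'n) set"
  assumes "cube z Z Q"
  defines "\<tau> \<equiv> Z powr m"
  shows "whitney m Q = {q * \<tau><..<\<tau>} \<times> Q" "whitney_enl m Q = {q\<^sup>2 * \<tau><..<\<tau> / q} \<times> triple Q"
    "emeasure lborel (whitney m Q) = ennreal ((1 - q) * \<tau> * Z powr n)"
    "emeasure lborel (whitney_enl m Q) = ennreal ((1 / q - q\<^sup>2) * 3 powr n * (\<tau> * Z powr n))"
    "AE p in lborel. p \<in> whit \<tau> \<times> Q \<longrightarrow> p \<in> whitney m Q"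
    "AE p in lborel. p \<in> broad \<tau> \<times> ccube z (3 * Z) \<longrightarrow> p \<in> whitney_enl m Q"
    "whitney m Q \<in> sets borel" "whitney_enl m Q \<in> sets borel"
proof -
  have Z: "0 < Z" using assms(1) by (rule cube_pos)
  have \<tau>: "0 < \<tau>" using Z by (simp add: \<tau>_def)
  have s: "side Q = Z" using assms(1) by (rule side_eq)
  have q4: "4 powr (- m) = q\<^sup>2" "2 powr m = 1 / q"
  proof -
    have "(4 :: real) powr (- m) = (2 powr 2) powr (- m)" by simp
    also have "\<dots> = 2 powr (- m + - m)" by (simp only: powr_powr) simp
    also have "\<dots> = q\<^sup>2" unfolding powr_add by (simp add: q_def power2_eq_square)
    finally show "4 powr (- m) = q\<^sup>2" .
    show "2 powr m = 1 / q" by (simp add: q_def powr_minus_divide)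
  qed
  show w: "whitney m Q = {q * \<tau><..<\<tau>} \<times> Q" by (simp add: whitney_def s q_def \<tau>_def)
  show we: "whitney_enl m Q = {q\<^sup>2 * \<tau><..<\<tau> / q} \<times> triple Q"
    by (simp add: whitney_enl_def s q4 \<tau>_def)
  note t = cube_triple[OF assms(1)]
  have bQ: "Q \<in> sets borel" "triple Q \<in> sets borel" "ccube z (3 * Z) \<in> sets borel"
    using assms(1) t by (auto intro: cube_borel ccube_borel)
  show bor: "whitney m Q \<in> sets borel" "whitney_enl m Q \<in> sets borel"
    unfolding w we using bQ by (auto intro: borel_Times)
  have pw: "Z ^ CARD('n) = Z powr n" "(3 * Z) ^ CARD('n) = 3 powr n * Z powr n"
    "(3 :: real) ^ CARD('n) = 3 powr n"
    using Z by (simp_all add: card powr_realpow power_mult_distrib)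
  have "q * \<tau> \<le> \<tau>" using q_time[OF \<tau>] \<tau> by linarith
  have "q\<^sup>2 * \<tau> \<le> \<tau> / q" using q_time[OF \<tau>] \<tau> broad_whit(8)[OF \<tau>] by linarith
  show early_late: "emeasure lborel (whitney m Q) = ennreal ((1 - q) * \<tau> * Z powr n)"
    unfolding w using bQ \<open>q * \<tau> \<le> \<tau>\<close>
    by (simp add: emeasure_Times emeasure_cube[OF assms(1)] pw ennreal_mult[symmetric] algebra_simps)
  show ewe: "emeasure lborel (whitney_enl m Q) = ennreal ((1 / q - q\<^sup>2) * 3 powr n * (\<tau> * Z powr n))"
    unfolding we using bQ \<open>q\<^sup>2 * \<tau> \<le> \<tau> / q\<close>
    by (simp add: emeasure_Times emeasure_cube[OF t] pw ennreal_mult[symmetric] algebra_simps)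
  have "emeasure lborel (whit \<tau> \<times> Q) = emeasure lborel (whitney m Q)"
    unfolding w whit_def using bQ \<open>q * \<tau> \<le> \<tau>\<close> by (simp add: emeasure_Times)
  then show "AE p in lborel. p \<in> whit \<tau> \<times> Q \<longrightarrow> p \<in> whitney m Q"
    using bor bQ early_late by (intro AE_superset_same_measure) (auto simp: w whit_def intro!: borel_Times)
  have "emeasure lborel (broad \<tau> \<times> ccube z (3 * Z)) = emeasure lborel (whitney_enl m Q)"
    unfolding we broad_def using bQ \<open>q\<^sup>2 * \<tau> \<le> \<tau> / q\<close> Z
    by (simp add: emeasure_Times emeasure_cube[OF t] emeasure_box_ccube)
  moreover have "whitney_enl m Q \<subseteq> broad \<tau> \<times> ccube z (3 * Z)"
    using cube_subset_ccube[OF t] by (auto simp: we broad_def)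
  ultimately show "AE p in lborel. p \<in> broad \<tau> \<times> ccube z (3 * Z) \<longrightarrow> p \<in> whitney_enl m Q"
    using bor bQ ewe by (intro AE_superset_same_measure) (auto simp: broad_def intro!: borel_Times)
qed

text \<open>Bound (i) has equal source and target, so the target is first enlarged to the source
  region. If V is the volume of the Whitney region and R V that of its enlargement, the averages
  contribute (R V)^(1/r) V^(1/r') = R^(1/r) V, and R depends on n and m only.\<close>

lemma sparse_estimate:
  "\<exists>C>0. \<forall>f\<in>Linf_c. \<forall>g\<in>Linf_c. \<forall>Z N Q z. cube z Z Q \<longrightarrow> N \<in> sets borel \<longrightarrow> N \<subseteq> ccube z (3 * Z) \<longrightarrow>
     J f g (broad (Z powr m) \<times> N) (whit (Z powr m) \<times> Q) \<le> ennreal C * sparse_term f g Q"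
proof -
  obtain K where K: "0 < K" and loc: "\<forall>f\<in>Linf_c. \<forall>Z z. 0 < Z \<longrightarrow>
     mixed_norm r r (cut (broad (Z powr m) \<times> ccube z (3 * Z)) (T (cut (broad (Z powr m) \<times> ccube z (3 * Z)) f)))
       \<le> ennreal (K * Z powr (m * \<kappa>)) * mixed_norm r r (cut (broad (Z powr m) \<times> ccube z (3 * Z)) f)"
    using near_comparable_estimate by (elim exE conjE) (rule that)
  define R where "R = (1 / q - q\<^sup>2) * 3 powr n / (1 - q)"
  have R: "0 < R"
  proof -
    have "1 < 1 / q" using q_bounds q_less_1 by simp
    then have "0 < 1 / q - q\<^sup>2" using q_less_1 by linarith
    then show ?thesis unfolding R_def using q_less_1 by (intro divide_pos_pos mult_pos_pos) auto
  qed
  show ?thesis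
  proof (intro exI[of _ "K * R powr rcp r"] conjI ballI allI impI)
    show "0 < K * R powr rcp r" using K R by simp
    fix f g :: "real \<times> (real ^ 'n) \<Rightarrow> complex" and Z :: real and N Q :: "(real ^ 'n) set" and z
    assume f: "f \<in> Linf_c" and g: "g \<in> Linf_c" and Q: "cube z Z Q" and N: "N \<in> sets borel" "N \<subseteq> ccube z (3 * Z)"
    let ?X = "ccube z (3 * Z)" and ?\<tau> = "Z powr m"
    let ?E = "broad ?\<tau> \<times> ?X" and ?F = "whit ?\<tau> \<times> Q" and ?f = "cut (UNIV \<times> N) f"
    let ?af = "avg r (whitney_enl m Q) (\<lambda>p. ennreal (norm (f p)))"
    let ?ag = "avg (conj_exp r) (whitney m Q) (\<lambda>p. ennreal (norm (g p)))"
    have Z: "0 < Z" using Q by (rule cube_pos)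
    have \<tau>: "0 < ?\<tau>" using Z by simp
    note wc = whitney_cube[OF Q]
    have f': "?f \<in> Linf_c" using f N by (intro Linf_c_cut borel_Times) auto
    have bor: "?E \<in> sets borel" "?F \<in> sets borel" "broad ?\<tau> \<times> N \<in> sets borel"
      using Q N by (auto intro!: borel_Times window_borel ccube_borel cube_borel)
    have hs: "?E \<subseteq> half_space" "?F \<subseteq> half_space"
      using q_time[OF \<tau>] by (auto simp: half_space_def broad_def whit_def)
    have FE: "?F \<subseteq> ?E" using broad_whit(7)[OF \<tau>] near_geometry(1)[OF Q] by blast
    have eq: "cut ?E ?f = cut (broad ?\<tau> \<times> N) f"
      using N(2) by (auto simp: cut_def indicator_def fun_eq_iff)
    let ?w = "(1 / q - q\<^sup>2) * 3 powr n * (?\<tau> * Z powr n)" and ?v = "(1 - q) * ?\<tau> * Z powr n"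
    have v: "0 < ?v" using q_less_1 \<tau> Z by simp
    have wv: "?w = R * ?v"
    proof -
      have "R * (1 - q) = (1 / q - q\<^sup>2) * 3 powr n" using q_less_1 by (simp add: R_def)
      then show ?thesis by (simp only: mult.assoc[symmetric])
    qed
    have w: "0 < ?w" unfolding wv using R v by simp
    have Tm: "T (cut ?E ?f) \<in> borel_measurable hs_measure"
      by (intro T_measurable Linf_c_cut f' bor)
    have "J f g (broad ?\<tau> \<times> N) ?F \<le> mixed_norm r r (cut ?F (T (cut (broad ?\<tau> \<times> N) f)))
        * mixed_norm (conj_exp r) (conj_exp r) (cut ?F g)"
      by (intro J_Holder f g bor hs exps)
    also have "\<dots> \<le> (ennreal (K * Z powr (m * \<kappa>)) * (ennreal (?w powr rcp r) * ?af)) * (ennreal (?v powr rcp (conj_exp r)) * ?ag)"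
    proof (rule mult_mono)
    have "mixed_norm r r (cut ?F (T (cut (broad ?\<tau> \<times> N) f))) \<le> mixed_norm r r (cut ?E (T (cut ?E ?f)))"
      unfolding eq[symmetric] using FE
      by (intro mixed_norm_mono_AE measurable_cut_hs bor hs Tm exps AE_I2) (auto simp: cut_def indicator_def)
    also have "\<dots> \<le> ennreal (K * Z powr (m * \<kappa>)) * mixed_norm r r (cut ?E ?f)"
      by (rule loc[rule_format, OF f' Z])
    also have "\<dots> \<le> ennreal (K * Z powr (m * \<kappa>)) * (ennreal (?w powr rcp r) * ?af)"
    proof (intro mult_left_mono)
      have "mixed_norm r r (cut ?E ?f) \<le> mixed_norm r r (cut ?E f)"
        by (intro mixed_norm_mono_AE measurable_cut bor Linf_c_borel f f' exps AE_I2) (auto simp: cut_def indicator_def)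
      also have "\<dots> \<le> ennreal (?w powr rcp r) * ?af"
        by (rule mixed_norm_le_avg[OF Linf_c_borel[OF f] exps(1) bor(1) wc(8,4) w wc(6)])
      finally show "mixed_norm r r (cut ?E ?f) \<le> ennreal (?w powr rcp r) * ?af" .
    qed simp
    finally show "mixed_norm r r (cut ?F (T (cut (broad ?\<tau> \<times> N) f)))
      \<le> ennreal (K * Z powr (m * \<kappa>)) * (ennreal (?w powr rcp r) * ?af)" .
    show "mixed_norm (conj_exp r) (conj_exp r) (cut ?F g) \<le> ennreal (?v powr rcp (conj_exp r)) * ?ag"
      by (rule mixed_norm_le_avg[OF Linf_c_borel[OF g] one_le_conj_exp[OF exps(1)] bor(2) wc(7,3) v wc(5)])
    qed auto
    also have "\<dots> = ennreal (K * Z powr (m * \<kappa>) * ?w powr rcp r * ?v powr rcp (conj_exp r)) * (?af * ?ag)"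
      using K by (simp add: ennreal_mult mult_ac)
    also have "K * Z powr (m * \<kappa>) * ?w powr rcp r * ?v powr rcp (conj_exp r) = K * R powr rcp r * (Z powr (m * \<kappa>) * ?v)"
    proof -
      have "?v powr rcp r * ?v powr rcp (conj_exp r) = ?v"
        unfolding powr_add[symmetric] rcp_conj_exp[OF exps(1)] using v by simp
      then show ?thesis unfolding wv powr_mult[of R] by (simp only: mult_ac)
    qed
    also have "ennreal \<dots> * (?af * ?ag) = ennreal (K * R powr rcp r) * sparse_term f g Q"
      unfolding sparse_term_def side_eq[OF Q] wc(3) using K v
      by (subst ennreal_mult, simp, simp, subst (2) ennreal_mult) (auto simp: mult_ac)
    finally show "J f g (broad ?\<tau> \<times> N) ?F \<le> ennreal (K * R powr rcp r) * sparse_term f g Q" .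
  qed
qed


lemma comparable_sum:
  "\<exists>C>0. \<forall>\<D> P Q0 L N. \<forall>f\<in>Linf_c. \<forall>g\<in>Linf_c. dyadic_tree P Q0 L \<longrightarrow> (\<forall>d. P d \<subseteq> \<D>) \<longrightarrow>
    (\<Sum>d\<le>N. J f g (broad (L d powr m) \<times> Q0) (whit (L d powr m) \<times> Q0))
      \<le> ennreal C * (sparse_part \<kappa> m r \<D> f g + series (Phi r r local local f g))"
proof -
  let ?\<Phi> = "Phi r r local local"
  obtain K where K: "0 < K" "far_bound broad whit ?\<Phi> K" using far_bound_comparable by blast
  obtain K' where K': "0 < K'" and sp: "\<forall>f\<in>Linf_c. \<forall>g\<in>Linf_c. \<forall>Z N Q z. cube z Z Q \<longrightarrow> N \<in> sets borel \<longrightarrow> N \<subseteq> ccube z (3 * Z) \<longrightarrow>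
     J f g (broad (Z powr m) \<times> N) (whit (Z powr m) \<times> Q) \<le> ennreal K' * sparse_term f g Q"
    using sparse_estimate by (elim exE conjE) (rule that)
  let ?K2 = "8 ^ CARD('n) * K * 2 powr (real l0 * m * A)"
  show ?thesis
  proof (intro exI[of _ "K' + ?K2"] conjI allI ballI impI)
    show "0 < K' + ?K2" using K K' by (simp add: add_pos_pos)
    fix \<D> :: "(real ^ 'n) set set" and P :: "nat \<Rightarrow> (real ^ 'n) set set" and Q0 L and N :: nat
      and f g :: "real \<times> (real ^ 'n) \<Rightarrow> complex"
    assume f: "f \<in> Linf_c" and g: "g \<in> Linf_c" and tree: "dyadic_tree P Q0 L" and sub: "\<forall>d. P d \<subseteq> \<D>"
    interpret dyadic_tree P Q0 L by fact
    let ?S = "series (?\<Phi> f g)" and ?w = "ennreal (2 powr (real l0 * m * A))"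
    have "(\<Sum>d\<le>N. J f g (broad (L d powr m) \<times> Q0) (whit (L d powr m) \<times> Q0)) \<le>
        (\<Sum>d\<le>N. (\<Sum>Q\<in>P d. J f g (broad (L d powr m) \<times> \<Union> (near d Q)) (whit (L d powr m) \<times> Q))
        + (\<Sum>e<d. \<Sum>Y\<in>P (Suc e). \<Sum>X\<in>far e Y. J f g (broad (L d powr m) \<times> X) (whit (L d powr m) \<times> Y)))"
      using window_borel by (intro sum_mono spatial_decomposition[OF tree f g]) auto
    also have "\<dots> = (\<Sum>d\<le>N. \<Sum>Q\<in>P d. J f g (broad (L d powr m) \<times> \<Union> (near d Q)) (whit (L d powr m) \<times> Q))
        + (\<Sum>d\<le>N. \<Sum>e<d. \<Sum>Y\<in>P (Suc e). \<Sum>X\<in>far e Y. J f g (broad (L d powr m) \<times> X) (whit (L d powr m) \<times> Y))"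
      by (rule sum.distrib)
    also have "\<dots> \<le> ennreal K' * sparse_part \<kappa> m r \<D> f g + ennreal (8 ^ CARD('n) * K) * (?w * ?S)"
    proof (rule add_mono)
      have "(\<Sum>d\<le>N. \<Sum>Q\<in>P d. J f g (broad (L d powr m) \<times> \<Union> (near d Q)) (whit (L d powr m) \<times> Q))
          \<le> (\<Sum>d\<le>N. \<Sum>Q\<in>P d. ennreal K' * sparse_term f g Q)"
      proof (intro sum_mono)
        fix d Q assume Q: "Q \<in> P d"
        have "\<Union> (near d Q) \<in> sets borel"
          using finite_near P_borel by (intro sets.finite_Union) (auto simp: near_def)
        then show "J f g (broad (L d powr m) \<times> \<Union> (near d Q)) (whit (L d powr m) \<times> Q) \<le> ennreal K' * sparse_term f g Q"
          using sp f g cube_centre[OF Q] near_subset[OF Q] by blast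
      qed
      also have "\<dots> = ennreal K' * (\<Sum>d\<le>N. \<Sum>Q\<in>P d. sparse_term f g Q)"
        by (simp only: sum_distrib_left)
      \<comment> \<open>The side of a cube determines its level, so no cube occurs at two levels and
        the finite sum is a partial sum of the one over \<D>.\<close>
      also have "(\<Sum>d\<le>N. \<Sum>Q\<in>P d. sparse_term f g Q) = (\<Sum>Q\<in>(\<Union>d\<in>{..N}. P d). sparse_term f g Q)"
      proof (rule sum.UNION_disjoint[symmetric])
        show "\<forall>d\<in>{..N}. \<forall>e\<in>{..N}. d \<noteq> e \<longrightarrow> P d \<inter> P e = {}"
        proof (intro ballI impI)
          fix d e :: nat assume "d \<noteq> e"
          have "d = e" if "Q \<in> P d" "Q \<in> P e" for Q
          proof -
            have "L d = L e" using side_eq[OF cube_centre[OF that(1)]] side_eq[OF cube_centre[OF that(2)]] by simp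
            moreover have "L d = L e * 2 ^ e / 2 ^ d" by (rule L_eq)
            ultimately have "(2 :: real) ^ e = 2 ^ d" using L_pos[of e] by (simp add: field_simps)
            then show ?thesis by simp
          qed
          with \<open>d \<noteq> e\<close> show "P d \<inter> P e = {}" by blast
        qed
      qed (use finite_P in auto)
      also have "ennreal K' * (\<Sum>Q\<in>(\<Union>d\<in>{..N}. P d). sparse_term f g Q) \<le> ennreal K' * sparse_part \<kappa> m r \<D> f g"
      proof (rule mult_left_mono)
        have "(\<Sum>Q\<in>(\<Union>d\<in>{..N}. P d). sparse_term f g Q) \<le> (\<Sum>\<^sub>\<infinity>Q\<in>\<D>. sparse_term f g Q)"
          using sub finite_P by (subst nonneg_infsum_complete) (auto intro!: SUP_upper)
        then show "(\<Sum>Q\<in>(\<Union>d\<in>{..N}. P d). sparse_term f g Q) \<le> sparse_part \<kappa> m r \<D> f g"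
          by (simp add: sparse_part_def sparse_term_def)
      qed simp
      finally show "(\<Sum>d\<le>N. \<Sum>Q\<in>P d. J f g (broad (L d powr m) \<times> \<Union> (near d Q)) (whit (L d powr m) \<times> Q))
          \<le> ennreal K' * sparse_part \<kappa> m r \<D> f g" .
      show "(\<Sum>d\<le>N. \<Sum>e<d. \<Sum>Y\<in>P (Suc e). \<Sum>X\<in>far e Y. J f g (broad (L d powr m) \<times> X) (whit (L d powr m) \<times> Y))
          \<le> ennreal (8 ^ CARD('n) * K) * (?w * ?S)"
        by (intro order_trans[OF far_sum[OF tree K(2,1) f g]] mult_left_mono sum_le_series) auto
    qed
    also have "\<dots> = ennreal K' * sparse_part \<kappa> m r \<D> f g + ennreal ?K2 * ?S"
      using K by (simp add: ennreal_mult mult.assoc)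
    also have "\<dots> \<le> ennreal (K' + ?K2) * sparse_part \<kappa> m r \<D> f g + ennreal (K' + ?K2) * ?S"
      using K K' by (intro add_mono mult_right_mono ennreal_leI) auto
    finally show "(\<Sum>d\<le>N. J f g (broad (L d powr m) \<times> Q0) (whit (L d powr m) \<times> Q0))
      \<le> ennreal (K' + ?K2) * (sparse_part \<kappa> m r \<D> f g + ?S)" by (simp only: distrib_left)
  qed
qed

section \<open>Causality, supports and the final estimate\<close>

lemma J_eq_0:
  assumes "f \<in> Linf_c" "AE p in hs_measure. p \<in> F \<longrightarrow> T (cut E f) p = 0"
  shows "J f g E F = 0"
proof -
  have "AE p in hs_measure. ennreal (norm (T (cut E f) p) * norm (g p)) * indicator F p = 0"
    using assms(2) by eventually_elim (auto simp: indicator_def)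
  then have "J f g E F = (\<integral>\<^sup>+ p. 0 \<partial>(hs_measure :: (real \<times> (real ^ 'n)) measure))"
    unfolding J_def by (rule nn_integral_cong_AE)
  then show ?thesis by simp
qed

text \<open>The source starts at q \<tau>, after the target has ended at q^2 \<tau>.\<close>

lemma causal_late:
  assumes "causal T" "f \<in> Linf_c" "0 < \<tau>" "Q0 \<in> sets borel"
  shows "J f g (whit \<tau> \<times> Q0) (early \<tau> \<times> Q0) = 0"
proof (rule J_eq_0[OF assms(2)])
  have lt: "q * \<tau> < \<tau>" "0 < q * \<tau>" "q\<^sup>2 * \<tau> < q * \<tau>" using q_time[OF assms(3)] assms(3) by linarith+
  have le: "t < q * \<tau>" if "t \<le> q\<^sup>2 * \<tau>" for t using that lt(3) by linarith
  have "AE (t, x) in hs_measure. t < Inf (whit \<tau>) \<longrightarrow> T (cut (whit \<tau> \<times> Q0) f) (t, x) = 0"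
  proof (rule assms(1)[unfolded causal_def, rule_format, OF assms(2) window_borel(2) assms(4)])
    show "whit \<tau> \<noteq> {}" using lt(1) by (simp add: whit_def)
    show "whit \<tau> \<subseteq> {0<..}"
    proof
      fix s assume "s \<in> whit \<tau>"
      then have "q * \<tau> < s" by (simp add: whit_def)
      with lt(2) show "s \<in> {0<..}" unfolding greaterThan_iff by linarith
    qed
  qed
  moreover have "Inf (whit \<tau>) = q * \<tau>" using lt by (simp add: whit_def)
  ultimately show "AE p in hs_measure. p \<in> early \<tau> \<times> Q0 \<longrightarrow> T (cut (whit \<tau> \<times> Q0) f) p = 0"
    using le by (auto elim!: eventually_mono simp: early_def split: prod.splits)
qed

lemma anti_causal_early:
  assumes "anti_causal T" "f \<in> Linf_c" "0 < \<tau>" "Q0 \<in> sets borel"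
  shows "J f g (early \<tau> \<times> Q0) (whit \<tau> \<times> Q0) = 0"
proof (rule J_eq_0[OF assms(2)])
  have lt: "0 < q\<^sup>2 * \<tau>" "q\<^sup>2 * \<tau> < q * \<tau>" using q_time[OF assms(3)] assms(3) by linarith+
  have "AE (t, x) in hs_measure. t > Sup (early \<tau>) \<longrightarrow> T (cut (early \<tau> \<times> Q0) f) (t, x) = 0"
    by (rule assms(1)[unfolded anti_causal_def, rule_format, OF assms(2) window_borel(1) assms(4)])
      (use lt in \<open>auto simp: early_def\<close>)
  moreover have "Sup (early \<tau>) = q\<^sup>2 * \<tau>" using lt by (simp add: early_def)
  ultimately show "AE p in hs_measure. p \<in> whit \<tau> \<times> Q0 \<longrightarrow> T (cut (early \<tau> \<times> Q0) f) p = 0"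
    using lt by (auto elim!: eventually_mono simp: whit_def split: prod.splits)
qed

lemma series_model_term:
  "series (Phi ut vt full local f g) = model_term m \<kappa> A
     (\<lambda>\<delta>. H_ca m (ut, ux) \<delta> f) (\<lambda>\<delta>. H_w c m (conj_exp vt, conj_exp vx) \<delta> g)"
  "series (Phi ut vt local full f g) = model_term m \<kappa> A
     (\<lambda>\<delta>. H_w c m (ut, ux) \<delta> f) (\<lambda>\<delta>. H_ca m (conj_exp vt, conj_exp vx) \<delta> g)"
  "series (Phi r r local local f g) = model_term m \<kappa> A
     (\<lambda>\<delta>. H_w c m (r, ux) \<delta> f) (\<lambda>\<delta>. H_w c m (conj_exp r, conj_exp vx) \<delta> g)"
  unfolding series_def model_term_def Phi_def H_ca_def H_w_def fst_conv snd_conv by (rule refl)+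

lemma support_box:
  fixes f g :: "real \<times> (real ^ 'n) \<Rightarrow> complex"
  assumes "f \<in> Linf_c" "g \<in> Linf_c"
  obtains \<epsilon> R B where "0 < \<epsilon>" "bounded B" "\<And>t x. f (t, x) \<noteq> 0 \<or> g (t, x) \<noteq> 0 \<Longrightarrow> x \<in> B \<and> \<epsilon> < t \<and> t \<le> R"
proof -
  obtain K1 where K1: "compact K1" "K1 \<subseteq> half_space" "\<And>p. p \<notin> K1 \<Longrightarrow> f p = 0"
    using assms(1) by (auto simp: Linf_c_def)
  obtain K2 where K2: "compact K2" "K2 \<subseteq> half_space" "\<And>p. p \<notin> K2 \<Longrightarrow> g p = 0"
    using assms(2) by (auto simp: Linf_c_def)
  let ?K = "K1 \<union> K2"
  have K: "compact ?K" using K1 K2 by auto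
  have cf: "compact (fst ` ?K)" using K by (intro compact_continuous_image continuous_intros)
  have cs: "compact (snd ` ?K)" using K by (intro compact_continuous_image continuous_intros)
  have supp: "(t, x) \<in> ?K" if "f (t, x) \<noteq> 0 \<or> g (t, x) \<noteq> 0" for t x using K1(3) K2(3) that by blast
  show ?thesis
  proof (cases "?K = {}")
    case True
    show ?thesis
    proof (rule that[of 1 "{}" 0])
      fix t x assume "f (t, x) \<noteq> 0 \<or> g (t, x) \<noteq> 0"
      then show "x \<in> {} \<and> 1 < t \<and> t \<le> 0" using supp True by blast
    qed auto
  next
    case False
    then have ne: "fst ` ?K \<noteq> {}" by auto
    obtain a where a: "a \<in> fst ` ?K" "\<And>t. t \<in> fst ` ?K \<Longrightarrow> a \<le> t"
      using compact_attains_inf[OF cf ne] by blast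
    obtain b where b: "\<And>t. t \<in> fst ` ?K \<Longrightarrow> t \<le> b"
      using compact_attains_sup[OF cf ne] by blast
    have "0 < a" using a(1) K1(2) K2(2) by (auto simp: half_space_def)
    show ?thesis
    \<comment> \<open>The least time in the supports is attained; halving it makes the lower bound
      strict.\<close>
    proof (rule that[of "a / 2" "snd ` ?K" b])
      show "0 < a / 2" using \<open>0 < a\<close> by simp
      show "bounded (snd ` ?K)" using cs by (rule compact_imp_bounded)
      fix t x assume "f (t, x) \<noteq> 0 \<or> g (t, x) \<noteq> 0"
      then have "(t, x) \<in> ?K" by (rule supp)
      then have "fst (t, x) \<in> fst ` ?K" "snd (t, x) \<in> snd ` ?K" by (intro imageI; assumption)+
      then show "x \<in> snd ` ?K \<and> a / 2 < t \<and> t \<le> b" using a(2)[of t] b[of t] \<open>0 < a\<close> by simp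
    qed
  qed
qed

end

theorem theorem3p6:
  fixes T :: "(real \<times> (real ^ 'n) \<Rightarrow> complex) \<Rightarrow> (real \<times> (real ^ 'n) \<Rightarrow> complex)"
    and \<D> :: "(real ^ 'n) set set"
    and r ut ux vt vx :: ennreal
    and c \<kappa> M m :: real
  assumes "0 < c" "c < 1" "c \<le> 1 / (16 * sqrt (real CARD('n)))"
    and "dyadic_system \<D>"
    and "1 \<le> r" "1 \<le> ut" "1 \<le> ux" "1 \<le> vt" "1 \<le> vx"
    and "1 \<le> m"
    and "singular_operator c \<kappa> m r (ut, ux) (vt, vx) M T"
  shows "\<exists>C>0. \<forall>f\<in>Linf_c. \<forall>g\<in>Linf_c.
     (let a = M + bracket ut vt - \<kappa>;
          w_w = model_term m \<kappa> a
            (\<lambda>\<delta>. H_w c m (r, ux) \<delta> f) (\<lambda>\<delta>. H_w c m (conj_exp r, conj_exp vx) \<delta> g);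
          ca_w = model_term m \<kappa> a
            (\<lambda>\<delta>. H_ca m (ut, ux) \<delta> f) (\<lambda>\<delta>. H_w c m (conj_exp vt, conj_exp vx) \<delta> g);
          w_ca = model_term m \<kappa> a
            (\<lambda>\<delta>. H_w c m (ut, ux) \<delta> f) (\<lambda>\<delta>. H_ca m (conj_exp vt, conj_exp vx) \<delta> g)
      in (\<integral>\<^sup>+ p. ennreal (norm (T f p) * norm (g p)) \<partial>hs_measure)
           \<le> ennreal C * (sparse_part \<kappa> m r \<D> f g + w_w
                + (if anti_causal T then 0 else ca_w)
                + (if causal T then 0 else w_ca)))"
proof -
  interpret singular T r ut ux vt vx c \<kappa> M m "real CARD('n)"
    using assms by unfold_locales auto
  obtain C1 where C1: "0 < C1" and ca_w: "\<forall>P Q0 L N. \<forall>f\<in>Linf_c. \<forall>g\<in>Linf_c. dyadic_tree P Q0 L \<longrightarrow>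
      (\<Sum>d\<le>N. J f g (early (L d powr m) \<times> Q0) (whit (L d powr m) \<times> Q0)) \<le> ennreal C1 * series (Phi ut vt full local f g)"
    using separated_sum[OF disjI1[OF refl]] by (elim exE conjE) (rule that)
  obtain C2 where C2: "0 < C2" and w_ca: "\<forall>P Q0 L N. \<forall>f\<in>Linf_c. \<forall>g\<in>Linf_c. dyadic_tree P Q0 L \<longrightarrow>
      (\<Sum>d\<le>N. J f g (whit (L d powr m) \<times> Q0) (early (L d powr m) \<times> Q0)) \<le> ennreal C2 * series (Phi ut vt local full f g)"
    using separated_sum[OF disjI2[OF refl]] by (elim exE conjE) (rule that)
  obtain C3 where C3: "0 < C3" and w_w: "\<forall>\<D> P Q0 L N. \<forall>f\<in>Linf_c. \<forall>g\<in>Linf_c. dyadic_tree P Q0 L \<longrightarrow> (\<forall>d. P d \<subseteq> \<D>) \<longrightarrow>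
      (\<Sum>d\<le>N. J f g (broad (L d powr m) \<times> Q0) (whit (L d powr m) \<times> Q0))
        \<le> ennreal C3 * (sparse_part \<kappa> m r \<D> f g + series (Phi r r local local f g))"
    using comparable_sum by (elim exE conjE) (rule that)
  let ?C = "C1 + C2 + C3"
  have bound: "(\<integral>\<^sup>+ p. ennreal (norm (T f p) * norm (g p)) \<partial>hs_measure)
      \<le> ennreal ?C * (sparse_part \<kappa> m r \<D> f g + series (Phi r r local local f g)
          + (if anti_causal T then 0 else series (Phi ut vt full local f g))
          + (if causal T then 0 else series (Phi ut vt local full f g)))"
    if f: "f \<in> Linf_c" and g: "g \<in> Linf_c" for f g
  proof -
    obtain \<epsilon> R B where \<epsilon>: "0 < \<epsilon>" and B: "bounded B"
      and supp: "\<And>t x. f (t, x) \<noteq> 0 \<or> g (t, x) \<noteq> 0 \<Longrightarrow> x \<in> B \<and> \<epsilon> < t \<and> t \<le> R"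
      by (rule support_box[OF f g], rule that)
    \<comment> \<open>The side of the root is at least 1 and at least R; since m >= 1, its time
      scale L 0 powr m is then at least R.\<close>
    obtain P Q0 L where tree: "dyadic_tree P Q0 L" and sub: "\<And>d. P d \<subseteq> \<D>" and Q0: "B \<subseteq> Q0" and L0: "max 1 R \<le> L 0"
      by (rule dyadic_system_tree[OF assms(4) B, where l = "max 1 R"], rule that)
    interpret dyadic_tree P Q0 L by fact
    define \<tau> where "\<tau> d = L d powr m" for d
    have \<tau>: "0 < \<tau> d" "\<tau> (Suc d) = q * \<tau> d" for d
    proof -
      show "0 < \<tau> d" using L_pos[of d] by (simp add: \<tau>_def)
      show "\<tau> (Suc d) = q * \<tau> d"
        unfolding \<tau>_def L_Suc[of d] using L_pos[of "Suc d"] by (simp add: q_def powr_mult powr_minus_divide)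
    qed
    have R: "R \<le> \<tau> 0"
    proof -
      have "L 0 powr 1 \<le> L 0 powr m" using L0 assms by (intro powr_mono) auto
      then show ?thesis using L0 by (simp add: \<tau>_def)
    qed
    have \<tau>_eq: "\<tau> d = q ^ d * \<tau> 0" for d by (induction d) (simp_all add: \<tau>(2))
    \<comment> \<open>After this many generations the windows have passed below the supports, so
      finitely many scales suffice.\<close>
    obtain N where N: "q ^ N < \<epsilon> / \<tau> 0"
      using real_arch_pow_inv[OF divide_pos_pos[OF \<epsilon> \<tau>(1)[of 0]] q_less_1(1)] by (elim exE) (rule that)
    have "\<tau> (Suc N) < \<epsilon>"
    proof -
      have "\<tau> (Suc N) \<le> 1 * \<tau> N" unfolding \<tau>(2) using \<tau>(1)[of N] q_less_1 by (intro mult_right_mono) auto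
      also have "\<dots> < \<epsilon>" using N \<tau>(1)[of 0] by (simp add: \<tau>_eq[of N] field_simps)
      finally show ?thesis .
    qed
    then have supp': "x \<in> Q0 \<and> \<tau> (Suc N) < t \<and> t \<le> \<tau> 0" if "f (t, x) \<noteq> 0 \<or> g (t, x) \<noteq> 0" for t x
      using supp[OF that] Q0 R by auto
    have early_le: "(\<Sum>d\<le>N. J f g (early (\<tau> d) \<times> Q0) (whit (\<tau> d) \<times> Q0))
        \<le> ennreal ?C * (if anti_causal T then 0 else series (Phi ut vt full local f g))"
    proof (cases "anti_causal T")
      case True
      then show ?thesis using anti_causal_early[OF True f \<tau>(1) Q0_borel] by simp
    next
      case False
      have "(\<Sum>d\<le>N. J f g (early (\<tau> d) \<times> Q0) (whit (\<tau> d) \<times> Q0)) \<le> ennreal C1 * series (Phi ut vt full local f g)"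
        unfolding \<tau>_def by (rule ca_w[rule_format, OF f g tree])
      also have "\<dots> \<le> ennreal ?C * series (Phi ut vt full local f g)"
        using C1 C2 C3 by (intro mult_right_mono ennreal_leI) auto
      finally show ?thesis using False by simp
    qed
    have late_le: "(\<Sum>d\<le>N. J f g (whit (\<tau> d) \<times> Q0) (early (\<tau> d) \<times> Q0))
        \<le> ennreal ?C * (if causal T then 0 else series (Phi ut vt local full f g))"
    proof (cases "causal T")
      case True
      then show ?thesis using causal_late[OF True f \<tau>(1) Q0_borel] by simp
    next
      case False
      have "(\<Sum>d\<le>N. J f g (whit (\<tau> d) \<times> Q0) (early (\<tau> d) \<times> Q0)) \<le> ennreal C2 * series (Phi ut vt local full f g)"
        unfolding \<tau>_def by (rule w_ca[rule_format, OF f g tree])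
      also have "\<dots> \<le> ennreal ?C * series (Phi ut vt local full f g)"
        using C1 C2 C3 by (intro mult_right_mono ennreal_leI) auto
      finally show ?thesis using False by simp
    qed
    have broad_le: "(\<Sum>d\<le>N. J f g (broad (\<tau> d) \<times> Q0) (whit (\<tau> d) \<times> Q0))
        \<le> ennreal ?C * (sparse_part \<kappa> m r \<D> f g + series (Phi r r local local f g))"
    proof -
      have "(\<Sum>d\<le>N. J f g (broad (\<tau> d) \<times> Q0) (whit (\<tau> d) \<times> Q0))
        \<le> ennreal C3 * (sparse_part \<kappa> m r \<D> f g + series (Phi r r local local f g))"
        unfolding \<tau>_def by (rule w_w[rule_format, OF f g tree sub])
      also have "\<dots> \<le> ennreal ?C * (sparse_part \<kappa> m r \<D> f g + series (Phi r r local local f g))"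
        using C1 C2 C3 by (intro mult_right_mono ennreal_leI) auto
      finally show ?thesis .
    qed
    have "(\<integral>\<^sup>+ p. ennreal (norm (T f p) * norm (g p)) \<partial>hs_measure) \<le>
      (\<Sum>d\<le>N. J f g (early (\<tau> d) \<times> Q0) (whit (\<tau> d) \<times> Q0)) + (\<Sum>d\<le>N. J f g (broad (\<tau> d) \<times> Q0) (whit (\<tau> d) \<times> Q0))
      + (\<Sum>d\<le>N. J f g (whit (\<tau> d) \<times> Q0) (early (\<tau> d) \<times> Q0))"
      by (rule time_decomposition[where \<tau> = \<tau>, OF \<tau> f g Q0_borel]) (rule supp')
    from order_trans[OF this add_mono[OF add_mono[OF early_le broad_le] late_le]]
    show ?thesis unfolding distrib_left by (simp only: add.assoc add.commute add.left_commute)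
  qed
  have "0 < ?C" using C1 C2 C3 by simp
  with bound show ?thesis
    unfolding Let_def A_def[symmetric] series_model_term[symmetric]
    by (intro exI[of _ ?C] conjI ballI)
qed

end
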